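(* Consider the dynamic discrete choice model and UFXP estimator described in the context, with true parameter $\theta$. Define $N(x)\equiv\sum_{a\in\mathbb{A}}n_a(x)$, $N\equiv\sum_{x\in\mathbb{X}}N(x)$, and $\eta(x)\equiv\lim_{N\to\infty}N(x)/N$, assumed to exist and be positive for each $x$. Suppose: (Compactness) the true parameter $\theta$ is an interior point of the compact set $\Theta\subset\mathbb{R}^t$; (Smoothness) $u^{\theta}$ is continuously differentiable in $\theta$ on $\Theta$; (Error-distribution regularity) $e$ has a strictly positive, continuously differentiable joint density $g$ on $\mathbb{R}^A$ with integrable first moment and integrable gradient; (Identification) the map $\theta\mapsto C^{\theta}_{V^{\theta}_{P^{\theta}}}\Delta'$ is injective on $\Theta$; (Full rank) the Jacobian $\tfrac{\partial}{\partial\theta}\operatorname{vec}\big(C^{\theta}_{V^{\theta}_{P}}\Delta'\big)\big|_{P=P^{\theta}}$ has full rank $t$ on $\Theta$; (Random projection) $Z_1,\dots,Z_m$, with $m>t$, are $X\times(A-1)$ matrices whose entries are i.i.d. draws from a distribution absolutely continuous with respect to Lebesgue measure; for $x\in\mathbb{X}$, $z(x)$ is the $(A-1)\times m$ matrix whose $i$-th column is the transpose of the $x$-th row of $Z_i$. Then, with probability one over the distribution of $\{Z_i\}_{i=1}^m$, as $N\to\infty$: (1) $\hat\theta_{\mathrm{UFXP}}\to\theta$ in probability, and (2) $\sqrt{N}(\hat\theta_{\mathrm{UFXP}}-\theta)\to\mathcal{N}(0,\Sigma_{\mathrm{UFXP}})$ in distribution, where \[ \Sigma_{\mathrm{UFXP}}\equiv\big((D^{\theta})'D^{\theta}\big)^{-1}(D^{\theta})'\Big(\sum_{x\in\mathbb{X}}\frac{z(x)'\Gamma(x)\Sigma(x)\Gamma(x)'z(x)}{\eta(x)}\Big)D^{\theta}\big((D^{\theta})'D^{\theta}\big)^{-1},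 \] \[ D^{\theta}\equiv\sum_{x\in\mathbb{X}}z(x)'\Big(\Delta\tfrac{\partial}{\partial\theta}u^{\theta}(x)+\beta\sum_{x'\in\mathbb{X}}\Delta f(x'|x)\,\tfrac{\partial}{\partial\theta}v^{\theta}_{P^{\theta}}(x')\Big), \] $\Sigma(x)\equiv\operatorname{diag}(P^{\theta}(x))-P^{\theta}(x)P^{\theta}(x)'$, and $\Gamma(x)\equiv\tfrac{\partial}{\partial P(x)}\rho^{-1}(P^{\theta}(x))$.
   Context: Discrete choice primitives: $\mathbb{A}=\{1,\dots,A\}$ actions; shock $e\in\mathbb{R}^A$ with density $g$; $\nu(c)\equiv\int\max_a(e_a+c_a)g(e)de$; $\mathbb{P}$ the probability simplex on $\mathbb{A}$; $I^{+}$ maps $(v_1,\dots,v_{A-1})'$ to $(v_1,\dots,v_{A-1},0)'$; $\Delta$ is the $(A-1)\times A$ matrix mapping $(v_1,\dots,v_A)'$ to $(v_1-v_A,\dots,v_{A-1}-v_A)'$; $\rho(v)\equiv\nabla\nu(I^{+}v)$ for $v\in\mathbb{R}^{A-1}$, which is invertible onto choice probabilities with inverse $\rho^{-1}$; $\epsilon(p)\equiv\nu(I^{+}\rho^{-1}(p))-p'I^{+}\rho^{-1}(p)$. When $\rho,\rho^{-1}$ are applied to a matrix they act row-wise. Model: finite state space $\mathbb{X}=\{1,\dots,X\}$, discount factor $\beta\in[0,1)$, per-period utility $e_a+u^{\theta}_a(x)$ with $\theta\in\Theta\subset\mathbb{R}^t$, known transition probabilities $f_a(x'|x)$; $u^{\theta}(x)$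 and $f(x'|x)$ denote the length-$A$ vectors with entries $u^\theta_a(x)$, $f_a(x'|x)$. $U^{\theta}_a\in\mathbb{R}^X$ has entries $u^{\theta}_a(x)$ and $F_a$ is the $X\times X$ matrix with entries $f_a(x'|x)$. A policy $P$ assigns to each $x$ a vector $P(x)\in\mathbb{P}$; $P_a\in\mathbb{R}^X$ has entries $P_a(x)$; $E(P)\in\mathbb{R}^X$ has entries $\epsilon(P(x))$; $U^{\theta}_P\equiv E(P)+\sum_a\operatorname{diag}(P_a)U^{\theta}_a$; $F_P\equiv\sum_a\operatorname{diag}(P_a)F_a$; $V^{\theta}_P\equiv(I-\beta F_P)^{-1}U^{\theta}_P$ with entries $v^{\theta}_P(x)$, and $\tfrac{\partial}{\partial\theta}v^{\theta}_P$ denotes its derivative in $\theta$ holding $P$ fixed. For $V\in\mathbb{R}^X$, $C^{\theta}_V$ is the $X\times A$ matrix with $a$-th column $U^{\theta}_a+\beta F_aV$. The value function $V^{\theta}$ (entries $v^\theta(x)$) is the unique solution of $v^{\theta}(x)=\nu\big(u^{\theta}(x)+\beta\sum_{x'}f(x'|x)v^{\theta}(x')\big)$ for all $x$, and the optimal conditional choice probabilities are $P^{\theta}\equiv\rho(C^{\theta}_{V^{\theta}}\Delta')$ (row-wise); equivalently $\rho^{-1}(P^{\theta})=C^{\theta}_{V^{\theta}}\Delta'$, and $V^\theta=V^\theta_{P^\theta}$. Data and estimator: the sample consists of $N$ state–action observations in which, given the state $x$, actions are independent draws from $P^{\theta}(x)$ at the true parameter $\theta$; $n_a\in\mathbb{R}^X$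 counts the action-$a$, state-$x$ observations, and $\hat P(x)$ is the empirical choice frequency vector $(n_a(x)/N(x))_{a}$. The unnested fixed point (UFXP) estimator is \[ \hat\theta_{\mathrm{UFXP}}\equiv\arg\min_{\theta\in\Theta}\mathcal{Q}^{\theta}_Z,\qquad \mathcal{Q}^{\theta}_Z\equiv\sum_{i=1}^m\operatorname{tr}\big(Z_i'(\rho^{-1}(\hat P)-C^{\theta}_{V^{\theta}_{\hat P}}\Delta')\big)^2 . \] *)

theory Defs
  imports "HOL-Probability.Probability"
begin

(* Conventions.  Actions are the type  'd::finite option : the action  None  plays the role of the
   last action A (the normalising action), and  Some d  (d :: 'd::finite) are the actions 1..A-1.
   Hence R^A = real^('d::finite option) and R^(A-1) = real^'d::finite.  States: 'x::finite.  Parameters: real^'t::finite. *)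

definition Iplus :: "real^'d::finite \<Rightarrow> real^('d::finite option)" where
  "Iplus v = (\<chi> a. case a of Some d \<Rightarrow> v $ d | None \<Rightarrow> 0)"

definition Delta :: "real^('d::finite option) \<Rightarrow> real^'d::finite" where
  "Delta w = (\<chi> d. w $ Some d - w $ None)"

definition prob_simplex :: "(real^'a::finite) set" where
  "prob_simplex = {p. (\<forall>a. 0 \<le> p $ a) \<and> (\<Sum>a\<in>UNIV. p $ a) = 1}"

definition grad :: "(real^'n::finite \<Rightarrow> real) \<Rightarrow> real^'n::finite \<Rightarrow> real^'n::finite" where
  "grad F c = (\<chi> a. frechet_derivative F (at c) (axis a 1))"

definition nu :: "(real^('d::finite option) \<Rightarrow> real) \<Rightarrow> real^('d::finite option) \<Rightarrow> real" where
  "nu g c = (\<integral>e. Max (range (\<lambda>a. e $ a + c $ a)) * g e \<partial>lborel)"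

definition rho :: "(real^('d::finite option) \<Rightarrow> real) \<Rightarrow> real^'d::finite \<Rightarrow> real^('d::finite option)" where
  "rho g v = grad (nu g) (Iplus v)"

definition rho_inv :: "(real^('d::finite option) \<Rightarrow> real) \<Rightarrow> real^('d::finite option) \<Rightarrow> real^'d::finite" where
  "rho_inv g p = (THE v. rho g v = p)"

definition eps :: "(real^('d::finite option) \<Rightarrow> real) \<Rightarrow> real^('d::finite option) \<Rightarrow> real" where
  "eps g p = nu g (Iplus (rho_inv g p)) - p \<bullet> Iplus (rho_inv g p)"

definition FP :: "('d::finite option \<Rightarrow> 'x::finite \<Rightarrow> 'x::finite \<Rightarrow> real) \<Rightarrow> ('x::finite \<Rightarrow> real^('d::finite option)) \<Rightarrow> real^'x::finite^'x::finite" where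
  "FP f P = (\<chi> x x'. \<Sum>a\<in>UNIV. P x $ a * f a x x')"

definition UP :: "(real^('d::finite option) \<Rightarrow> real) \<Rightarrow> (real^'t::finite \<Rightarrow> 'x::finite \<Rightarrow> real^('d::finite option))
    \<Rightarrow> real^'t::finite \<Rightarrow> ('x::finite \<Rightarrow> real^('d::finite option)) \<Rightarrow> real^'x::finite" where
  "UP g u \<theta> P = (\<chi> x. eps g (P x) + (\<Sum>a\<in>UNIV. P x $ a * u \<theta> x $ a))"

definition VP :: "(real^('d::finite option) \<Rightarrow> real) \<Rightarrow> (real^'t::finite \<Rightarrow> 'x::finite \<Rightarrow> real^('d::finite option))
    \<Rightarrow> ('d::finite option \<Rightarrow> 'x::finite \<Rightarrow> 'x::finite \<Rightarrow> real) \<Rightarrow> real \<Rightarrow> real^'t::finite \<Rightarrow> ('x::finite \<Rightarrow> real^('d::finite option)) \<Rightarrow> real^'x::finite" where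
  "VP g u f \<beta> \<theta> P = matrix_inv (mat 1 - \<beta> *\<^sub>R FP f P) *v UP g u \<theta> P"

definition Cmat :: "(real^'t::finite \<Rightarrow> 'x::finite \<Rightarrow> real^('d::finite option)) \<Rightarrow> ('d::finite option \<Rightarrow> 'x::finite \<Rightarrow> 'x::finite \<Rightarrow> real)
    \<Rightarrow> real \<Rightarrow> real^'t::finite \<Rightarrow> real^'x::finite \<Rightarrow> 'x::finite \<Rightarrow> 'd::finite option \<Rightarrow> real" where
  "Cmat u f \<beta> \<theta> V x a = u \<theta> x $ a + \<beta> * (\<Sum>x'\<in>UNIV. f a x x' * V $ x')"

definition CD :: "(real^'t::finite \<Rightarrow> 'x::finite \<Rightarrow> real^('d::finite option)) \<Rightarrow> ('d::finite option \<Rightarrow> 'x::finite \<Rightarrow> 'x::finite \<Rightarrow> real)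
    \<Rightarrow> real \<Rightarrow> real^'t::finite \<Rightarrow> real^'x::finite \<Rightarrow> real^'d::finite^'x::finite" where
  "CD u f \<beta> \<theta> V = (\<chi> x. Delta (\<chi> a. Cmat u f \<beta> \<theta> V x a))"

definition Vstar :: "(real^('d::finite option) \<Rightarrow> real) \<Rightarrow> (real^'t::finite \<Rightarrow> 'x::finite \<Rightarrow> real^('d::finite option))
    \<Rightarrow> ('d::finite option \<Rightarrow> 'x::finite \<Rightarrow> 'x::finite \<Rightarrow> real) \<Rightarrow> real \<Rightarrow> real^'t::finite \<Rightarrow> real^'x::finite" where
  "Vstar g u f \<beta> \<theta> = (THE V. \<forall>x. V $ x =
      nu g (u \<theta> x + \<beta> *\<^sub>R (\<Sum>x'\<in>UNIV. V $ x' *\<^sub>R (\<chi> a. f a x x'))))"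

definition Pstar :: "(real^('d::finite option) \<Rightarrow> real) \<Rightarrow> (real^'t::finite \<Rightarrow> 'x::finite \<Rightarrow> real^('d::finite option))
    \<Rightarrow> ('d::finite option \<Rightarrow> 'x::finite \<Rightarrow> 'x::finite \<Rightarrow> real) \<Rightarrow> real \<Rightarrow> real^'t::finite \<Rightarrow> 'x::finite \<Rightarrow> real^('d::finite option)" where
  "Pstar g u f \<beta> \<theta> x = rho g (CD u f \<beta> \<theta> (Vstar g u f \<beta> \<theta>) $ x)"

(* UFXP criterion  Q^theta_Z = sum_i tr(Z_i' (rho^{-1}(Phat) - C^theta_{V^theta_Phat} Delta'))^2 ;
   Z i x d is the (x,d) entry of Z_i *)
definition Qcrit :: "(real^('d::finite option) \<Rightarrow> real) \<Rightarrow> (real^'t::finite \<Rightarrow> 'x::finite \<Rightarrow> real^('d::finite option))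
    \<Rightarrow> ('d::finite option \<Rightarrow> 'x::finite \<Rightarrow> 'x::finite \<Rightarrow> real) \<Rightarrow> real \<Rightarrow> ('m::finite \<Rightarrow> 'x::finite \<Rightarrow> 'd::finite \<Rightarrow> real)
    \<Rightarrow> ('x::finite \<Rightarrow> real^('d::finite option)) \<Rightarrow> real^'t::finite \<Rightarrow> real" where
  "Qcrit g u f \<beta> Z Phat \<theta> =
     (\<Sum>i\<in>UNIV. (\<Sum>x\<in>UNIV. \<Sum>d\<in>UNIV.
        Z i x d * (rho_inv g (Phat x) $ d - CD u f \<beta> \<theta> (VP g u f \<beta> \<theta> Phat) $ x $ d))\<^sup>2)"

definition act_pmf :: "real^'a::finite \<Rightarrow> 'a::finite pmf" where
  "act_pmf p = embed_pmf (\<lambda>a. p $ a)"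

(* sample: for each state x, Ns x observations (x,j), j < Ns x, actions iid from P(x) *)
definition sample_pmf :: "('x::finite \<Rightarrow> nat) \<Rightarrow> ('x::finite \<Rightarrow> real^('d::finite option)) \<Rightarrow> ('x::finite \<times> nat \<Rightarrow> 'd::finite option) pmf" where
  "sample_pmf Ns P = Pi_pmf {(x, j). j < Ns x} None (\<lambda>(x, j). act_pmf (P x))"

definition Phat :: "('x::finite \<Rightarrow> nat) \<Rightarrow> ('x::finite \<times> nat \<Rightarrow> 'd::finite option) \<Rightarrow> 'x::finite \<Rightarrow> real^('d::finite option)" where
  "Phat Ns \<omega> x = (\<chi> a. real (card {j. j < Ns x \<and> \<omega> (x, j) = a}) / real (Ns x))"

definition mvn :: "real^'t::finite^'t::finite \<Rightarrow> (real^'t::finite) measure" where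
  "mvn S = distr (PiM UNIV (\<lambda>_::'t::finite. std_normal_distribution)) borel
      (\<lambda>w. (SOME L. L ** transpose L = S) *v vec_lambda w)"

definition conv_distr :: "(nat \<Rightarrow> 'e::euclidean_space measure) \<Rightarrow> 'e measure \<Rightarrow> bool" where
  "conv_distr Ms M \<longleftrightarrow> (\<forall>h::'e \<Rightarrow> real. continuous_on UNIV h \<and> bounded (range h) \<longrightarrow>
      (\<lambda>n. \<integral>y. h y \<partial>Ms n) \<longlonglongrightarrow> (\<integral>y. h y \<partial>M))"

definition Dmat :: "(real^('d::finite option) \<Rightarrow> real) \<Rightarrow> (real^'t::finite \<Rightarrow> 'x::finite \<Rightarrow> real^('d::finite option))
    \<Rightarrow> ('d::finite option \<Rightarrow> 'x::finite \<Rightarrow> 'x::finite \<Rightarrow> real) \<Rightarrow> real \<Rightarrow> ('m::finite \<Rightarrow> 'x::finite \<Rightarrow> 'd::finite \<Rightarrow> real) \<Rightarrow> real^'t::finite \<Rightarrow> real^'t::finite^'m::finite" where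
  "Dmat g u f \<beta> Z \<theta> = (\<chi> i j. \<Sum>x\<in>UNIV. \<Sum>d\<in>UNIV. Z i x d *
      (Delta (frechet_derivative (\<lambda>\<theta>'. u \<theta>' x) (at \<theta>) (axis j 1)) $ d
       + \<beta> * (\<Sum>x'\<in>UNIV. Delta (\<chi> a. f a x x') $ d *
           frechet_derivative (\<lambda>\<theta>'. VP g u f \<beta> \<theta>' (Pstar g u f \<beta> \<theta>)) (at \<theta>) (axis j 1) $ x')))"

definition zmat :: "('m::finite \<Rightarrow> 'x::finite \<Rightarrow> 'd::finite \<Rightarrow> real) \<Rightarrow> 'x::finite \<Rightarrow> real^'m::finite^'d::finite" where
  "zmat Z x = (\<chi> d i. Z i x d)"

definition SigmaP :: "real^'a::finite \<Rightarrow> real^'a::finite^'a::finite" where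
  "SigmaP p = (\<chi> a b. (if a = b then p $ a else 0) - p $ a * p $ b)"

definition Gamma :: "(real^('d::finite option) \<Rightarrow> real) \<Rightarrow> real^('d::finite option) \<Rightarrow> real^('d::finite option)^'d::finite" where
  "Gamma g p = matrix (frechet_derivative (rho_inv g) (at p within prob_simplex))"

definition Sigma_UFXP :: "(real^('d::finite option) \<Rightarrow> real) \<Rightarrow> (real^'t::finite \<Rightarrow> 'x::finite \<Rightarrow> real^('d::finite option))
    \<Rightarrow> ('d::finite option \<Rightarrow> 'x::finite \<Rightarrow> 'x::finite \<Rightarrow> real) \<Rightarrow> real \<Rightarrow> ('m::finite \<Rightarrow> 'x::finite \<Rightarrow> 'd::finite \<Rightarrow> real) \<Rightarrow> ('x::finite \<Rightarrow> real)
    \<Rightarrow> real^'t::finite \<Rightarrow> real^'t::finite^'t::finite" where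
  "Sigma_UFXP g u f \<beta> Z \<eta> \<theta> =
    (let D = Dmat g u f \<beta> Z \<theta>;
         B = matrix_inv (transpose D ** D);
         M = (\<Sum>x\<in>UNIV. (1 / \<eta> x) *\<^sub>R
               (transpose (zmat Z x) ** Gamma g (Pstar g u f \<beta> \<theta> x) ** SigmaP (Pstar g u f \<beta> \<theta> x)
                 ** transpose (Gamma g (Pstar g u f \<beta> \<theta> x)) ** zmat Z x))
     in B ** transpose D ** M ** D ** B)"

end

(* The proof avoids first-order conditions. Write Y(s,P) = C^s_{V^s_P} Delta' and let P0 = P^theta be
   the true choice probabilities. Since P0 is optimal at theta, Y(theta,P) = Y(theta,P0) + o(P - P0)
   (an envelope argument), while Y(s,P) - Y(theta,P) depends on P in a Lipschitz way with constant
   O(|s - theta|). So the projected residual is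
     F(s,P) = Z(rho^{-1}(P) - Y(s,P)) = Z Gamma (P - P0) - D (s - theta) + o(|P - P0| + |s - theta|),
   and comparing the minimiser of |F| with the least-squares solution of the linearised problem gives
     s = theta + (D'D)^{-1} D' Z Gamma (P - P0) + o(P - P0)
   deterministically. The limit theorem for the multinomial frequencies does the rest.

   The point theta is identified with P0 held fixed: if Y(s,P0) = rho^{-1}(P0), then V^s_{P0} solves
   the Bellman equation at s, whence P^s = P0. Random projections preserve this and the rank because
   m > t linear conditions cannot be met along a smooth t-dimensional family. The derivative of rho is
   invertible because a shift of the utilities changes the choice on a slab of shocks whose volume is
   proportional to the shift; rho is differentiable because translates of g are differentiable in L^1. *)
theory Submission
  imports Defs
begin

text \<open>Three obstacles shape the argument. First, the estimator is an arbitrary selection of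
  minimisers, pinned down only on samples in which every action frequency is positive. The analysis
  of the minimiser is therefore a deterministic inequality, uniform over all policies near the
  truth, and probability enters only afterwards, through tightness of sqrt(N) (Phat - P0) and a
  Slutsky argument; on a \<open>pmf\<close> every function is measurable, so measurability of the
  estimator is automatic. Second, there is no separate consistency proof: identification on the
  compact \<Theta> together with the rank condition bounds the projected gap below by c |s -
  \<theta>| on all of \<Theta>, so the minimiser is within O(|P - P0|) of \<theta> at once, and
  consistency is read off from the expansion. Third, \<open>rho_inv\<close> is a definite
  description on a simplex with empty interior. It is handled in the coordinates that drop the last
  probability, where invariance of domain makes the image of \<open>rho\<close> open, and its
  derivative \<open>Gamma\<close> enters only through differences of probability vectors, on which
  it is determined.\<close>

section \<open>Random projections\<close>

text \<open>Induction on the index set with Tonelli. A null set of the product has null sections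
  outside a null set of the remaining coordinates; absolute continuity transfers the sections from
  Lebesgue measure to \<mu>, and the induction hypothesis transfers the exceptional set.\<close>

lemma null_sets_PiM_absolutely_continuous:
  assumes prob: "prob_space \<mu>" and sets: "sets \<mu> = sets borel"
    and ac: "absolutely_continuous lborel (\<mu> :: real measure)" and "finite I"
  shows "A \<in> null_sets (PiM I (\<lambda>_. lborel)) \<Longrightarrow> A \<in> null_sets (PiM I (\<lambda>_. \<mu>))"
  using \<open>finite I\<close>
proof (induction I arbitrary: A)
  case empty
  then show ?case
    by (simp add: PiM_empty)
next
  case (insert i I)
  interpret L: product_sigma_finite "\<lambda>_. lborel :: real measure"
    by standard
  interpret M: product_sigma_finite "\<lambda>_. \<mu>"
    using prob by (intro product_sigma_finite.intro prob_space_imp_sigma_finite)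
  have sets_eq: "sets (PiM J (\<lambda>_. \<mu>)) = sets (PiM J (\<lambda>_. lborel))" for J :: "'a set"
    using sets by (intro sets_PiM_cong) auto
  have A: "A \<in> sets (PiM (insert i I) (\<lambda>_. lborel))"
    using insert.prems by auto
  then have A': "A \<in> sets (PiM (insert i I) (\<lambda>_. \<mu>))"
    by (simp add: sets_eq)
  have inner: "(\<integral>\<^sup>+y. indicator A (x(i := y)) \<partial>lborel) = 0 \<longleftrightarrow> (AE y in lborel. x(i := y) \<notin> A)"
    if "x \<in> space (PiM I (\<lambda>_. lborel))" for x
  proof -
    have "(\<lambda>y. x(i := y)) \<in> measurable lborel (PiM (insert i I) (\<lambda>_. lborel))"
      using that by measurable
    then have "(\<lambda>y. indicator A (x(i := y)) :: ennreal) \<in> borel_measurable lborel"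
      using A by measurable
    then show ?thesis
      by (subst nn_integral_0_iff_AE) (auto simp: indicator_def)
  qed
  have inner': "(\<integral>\<^sup>+y. indicator A (x(i := y)) \<partial>\<mu>) = 0 \<longleftrightarrow> (AE y in \<mu>. x(i := y) \<notin> A)"
    if "x \<in> space (PiM I (\<lambda>_. \<mu>))" for x
  proof -
    have "(\<lambda>y. x(i := y)) \<in> measurable \<mu> (PiM (insert i I) (\<lambda>_. \<mu>))"
      using that by measurable
    then have "(\<lambda>y. indicator A (x(i := y)) :: ennreal) \<in> borel_measurable \<mu>"
      using A' by measurable
    then show ?thesis
      by (subst nn_integral_0_iff_AE) (auto simp: indicator_def)
  qed
  have meas: "(\<lambda>x. \<integral>\<^sup>+y. indicator A (x(i := y)) \<partial>lborel) \<in> borel_measurable (PiM I (\<lambda>_. lborel))"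
    using A by measurable
  have "emeasure (PiM (insert i I) (\<lambda>_. lborel)) A = 0"
    using insert.prems by auto
  then have "(\<integral>\<^sup>+x. (\<integral>\<^sup>+y. indicator A (x(i := y)) \<partial>lborel) \<partial>PiM I (\<lambda>_. lborel)) = 0"
    using A insert.hyps by (subst L.product_nn_integral_insert[symmetric]) auto
  then have "AE x in PiM I (\<lambda>_. lborel). (\<integral>\<^sup>+y. indicator A (x(i := y)) \<partial>lborel) = 0"
    using meas by (subst (asm) nn_integral_0_iff_AE) auto
  then obtain N where N: "N \<in> null_sets (PiM I (\<lambda>_. lborel))"
      "{x \<in> space (PiM I (\<lambda>_. lborel)). (\<integral>\<^sup>+y. indicator A (x(i := y)) \<partial>lborel) \<noteq> 0} \<subseteq> N"
    by (auto elim!: AE_E simp: null_sets_def)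
  have "AE x in PiM I (\<lambda>_. \<mu>). (\<integral>\<^sup>+y. indicator A (x(i := y)) \<partial>lborel) = 0"
  proof (rule AE_I')
    show "N \<in> null_sets (PiM I (\<lambda>_. \<mu>))"
      by (rule insert.IH[OF N(1)])
    show "{x \<in> space (PiM I (\<lambda>_. \<mu>)). (\<integral>\<^sup>+y. indicator A (x(i := y)) \<partial>lborel) \<noteq> 0} \<subseteq> N"
      using N(2) sets_eq_imp_space_eq[OF sets_eq[of I]] by simp
  qed
  then have "AE x in PiM I (\<lambda>_. \<mu>). (\<integral>\<^sup>+y. indicator A (x(i := y)) \<partial>\<mu>) = 0"
    using AE_space
  proof eventually_elim
    case (elim x)
    then have "AE y in lborel. x(i := y) \<notin> A"
      using inner sets_eq_imp_space_eq[OF sets_eq[of I]] by simp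
    then have "AE y in \<mu>. x(i := y) \<notin> A"
      by (rule absolutely_continuous_AE[rotated 2]) (use ac sets in auto)
    then show ?case
      using inner' elim(2) by simp
  qed
  then have "(\<integral>\<^sup>+x. (\<integral>\<^sup>+y. indicator A (x(i := y)) \<partial>\<mu>) \<partial>PiM I (\<lambda>_. \<mu>)) = 0"
    by (subst nn_integral_cong_AE[where v="\<lambda>_. 0"]) auto
  then have "emeasure (PiM (insert i I) (\<lambda>_. \<mu>)) A = 0"
    using A' insert.hyps by (subst (asm) M.product_nn_integral_insert[symmetric]) auto
  then show ?case
    using A' by auto
qed

lemma borel_measurable_vec_lambda:
  "vec_lambda \<in> measurable (PiM UNIV (\<lambda>_::'n::finite. borel :: real measure)) (borel :: (real^'n) measure)"
proof -
  have "(\<lambda>z. \<Sum>i\<in>UNIV. z i *\<^sub>R axis i (1::real)) \<in> measurable (PiM UNIV (\<lambda>_::'n. borel :: real measure)) (borel :: (real^'n) measure)"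
    by measurable
  also have "(\<lambda>z. \<Sum>i\<in>UNIV. z i *\<^sub>R axis i (1::real)) = (vec_lambda :: _ \<Rightarrow> real^'n)"
    by (auto simp: fun_eq_iff vec_eq_iff axis_def if_distrib cong: if_cong)
  finally show ?thesis .
qed

text \<open>Links two pictures of R^n: the entries of the projections are drawn from a
  \<open>PiM\<close> over functions, whereas negligibility is a notion on \<open>real^'n\<close>.
  The two measures agree on open boxes.\<close>

lemma lborel_vec_eq:
  "distr (PiM UNIV (\<lambda>_::'n::finite. lborel :: real measure)) borel vec_lambda = (lborel :: (real^'n) measure)"
proof (rule lborel_eqI[symmetric])
  show "sets (distr (PiM UNIV (\<lambda>_::'n. lborel :: real measure)) borel vec_lambda) = sets borel"
    by simp
  interpret product_sigma_finite "\<lambda>_::'n. lborel :: real measure"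
    by standard
  have m: "vec_lambda \<in> measurable (PiM UNIV (\<lambda>_::'n. lborel :: real measure)) (borel :: (real^'n) measure)"
    using borel_measurable_vec_lambda by (subst measurable_cong_sets[OF sets_PiM_cong[OF refl] refl]) auto
  have Basis: "(Basis :: (real^'n) set) = range (\<lambda>i. axis i 1)"
    by (auto simp: Basis_vec_def)
  fix l u :: "real^'n"
  assume "\<And>b. b \<in> Basis \<Longrightarrow> l \<bullet> b \<le> u \<bullet> b"
  then have le: "l $ i \<le> u $ i" for i
    using Basis by (metis inner_axis' inner_commute mult.left_neutral real_inner_1_left rangeI)
  have "vec_lambda -` box l u \<inter> space (PiM UNIV (\<lambda>_::'n. lborel :: real measure)) =
     PiE UNIV (\<lambda>i. {l $ i <..< u $ i})"
    by (auto simp: mem_box_cart space_PiM PiE_iff)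
  then have "emeasure (distr (PiM UNIV (\<lambda>_::'n. lborel :: real measure)) borel vec_lambda) (box l u) =
     (\<Prod>i\<in>UNIV. emeasure lborel {l $ i <..< u $ i})"
    using m by (simp add: emeasure_distr emeasure_PiM)
  also have "\<dots> = (\<Prod>i\<in>UNIV. ennreal (u $ i - l $ i))"
    using le by simp
  also have "\<dots> = ennreal (\<Prod>i\<in>UNIV. u $ i - l $ i)"
    using le by (intro prod_ennreal) auto
  also have "(\<Prod>i\<in>UNIV. u $ i - l $ i) = (\<Prod>b\<in>Basis. (u - l) \<bullet> b)"
    unfolding Basis by (subst prod.reindex) (auto simp: inner_axis inj_on_def axis_eq_axis)
  finally show "emeasure (distr (PiM UNIV (\<lambda>_::'n. lborel :: real measure)) borel vec_lambda) (box l u) =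
     (\<Prod>b\<in>Basis. (u - l) \<bullet> b)" .
qed

lemma AE_PiM_notin_negligible:
  assumes prob: "prob_space \<mu>" and sets: "sets \<mu> = sets borel"
    and ac: "absolutely_continuous lborel (\<mu> :: real measure)" and N: "negligible (N :: (real^'n::finite) set)"
  shows "AE z in PiM UNIV (\<lambda>_::'n. \<mu>). vec_lambda z \<notin> N"
proof -
  \<comment> \<open>\<open>negligible\<close> refers to the completed measure, so \<open>N\<close>
    is first enclosed in a Borel null set.\<close>
  from N obtain N' where N': "N' \<in> null_sets lborel" "N \<subseteq> N'"
    unfolding negligible_iff_null_sets null_sets_completion_iff2 by auto
  have m: "vec_lambda \<in> measurable (PiM UNIV (\<lambda>_::'n. lborel :: real measure)) (borel :: (real^'n) measure)"
    using borel_measurable_vec_lambda by (subst measurable_cong_sets[OF sets_PiM_cong[OF refl] refl]) auto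
  let ?B = "vec_lambda -` N' \<inter> space (PiM UNIV (\<lambda>_::'n. lborel :: real measure))"
  have "N' \<in> null_sets (distr (PiM UNIV (\<lambda>_::'n. lborel :: real measure)) borel vec_lambda)"
    using N'(1) by (simp add: lborel_vec_eq)
  then have "?B \<in> null_sets (PiM UNIV (\<lambda>_::'n. lborel :: real measure))"
    using m by (simp add: null_sets_distr_iff)
  then have "?B \<in> null_sets (PiM UNIV (\<lambda>_::'n. \<mu>))"
    by (intro null_sets_PiM_absolutely_continuous[OF prob sets ac]) auto
  then show ?thesis
    by (rule AE_I') (use N'(2) in \<open>auto simp: space_PiM\<close>)
qed

text \<open>A family \<open>G s \<noteq> 0\<close> depending differentiably on \<open>t < m\<close> parameters: the \<open>Z\<close> that annihilate
  some \<open>G s\<close> with \<open>G s $ k \<noteq> 0\<close> are the image of a subset of a hyperplane, because the \<open>m\<close> coordinates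
  \<open>Z $ (i, k)\<close> are determined by \<open>s\<close> and the rest, and \<open>s\<close> can be stored in \<open>t\<close> of these slots.\<close>

lemma AE_projection_nonzero:
  fixes G :: "real^'t::finite \<Rightarrow> real^'k::finite"
  assumes prob: "prob_space \<mu>" and sets: "sets \<mu> = sets borel"
    and ac: "absolutely_continuous lborel (\<mu> :: real measure)"
    and card: "CARD('t) < CARD('m::finite)"
    and diff: "G differentiable_on S" and nz: "\<And>s. s \<in> S \<Longrightarrow> G s \<noteq> 0"
  shows "AE z in PiM UNIV (\<lambda>_::'m \<times> 'k. \<mu>). \<forall>s\<in>S. \<exists>i. (\<Sum>k\<in>UNIV. z (i, k) * G s $ k) \<noteq> 0"
proof -
  obtain j :: "'t \<Rightarrow> 'm" where j: "inj j"
    using card by (metis card_le_inj finite_class.finite_UNIV less_imp_le)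
  have "range j \<noteq> UNIV"
    using card j by (metis card_image less_irrefl)
  \<comment> \<open>This row exists because t < m. Its slot in column \<open>k\<close> carries no
    parameter and is set to 0, which confines the stored data to a hyperplane.\<close>
  then obtain i0 where i0: "i0 \<notin> range j" by auto
  define par :: "'k \<Rightarrow> real^('m \<times> 'k) \<Rightarrow> real^'t" where "par k Z = (\<chi> l. Z $ (j l, k))" for k Z
  define D where "D k = {Z. Z $ (i0, k) = 0 \<and> par k Z \<in> S \<and> G (par k Z) $ k \<noteq> 0}" for k
  define F :: "'k \<Rightarrow> real^('m \<times> 'k) \<Rightarrow> real^('m \<times> 'k)" where
    "F k Z = (\<chi> p. if snd p = k then - (\<Sum>l\<in>UNIV - {k}. Z $ (fst p, l) * G (par k Z) $ l) / G (par k Z) $ k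
                     else Z $ p)" for k Z
  have bad: "negligible (F k ` D k)" for k
  \<comment> \<open>Source and target are the same space, so differentiability alone makes the image
    of a null set null.\<close>
  proof (rule negligible_differentiable_image_negligible)
    have "D k \<subseteq> {Z. axis (i0, k) 1 \<bullet> Z = 0}"
      by (auto simp: D_def inner_axis')
    then show "negligible (D k)"
      by (rule negligible_subset[rotated]) (rule negligible_hyperplane, simp add: axis_eq_0_iff)
    have "linear (par k)"
      by (rule linearI) (auto simp: par_def vec_eq_iff)
    then have par: "par k differentiable_on D k"
      by (rule linear_imp_differentiable_on)
    have "par k ` D k \<subseteq> S"
      by (auto simp: D_def)
    then have "(\<lambda>Z. G (par k Z)) differentiable_on D k"
      using differentiable_on_compose[OF par, of G] differentiable_on_subset[OF diff] by blast
    then have "(\<lambda>Z. axis l 1 \<bullet> G (par k Z)) differentiable_on D k" for l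
      unfolding differentiable_on_def by (intro ballI differentiable_inner differentiable_const) auto
    then have GD: "(\<lambda>Z. G (par k Z) $ l) differentiable_on D k" for l
      by (simp add: inner_axis')
    have ZD: "(\<lambda>Z :: real^('m \<times> 'k). Z $ p) differentiable_on D k" for p
      by (intro linear_imp_differentiable_on linearI) auto
    have "(\<lambda>Z. F k Z $ p) differentiable_on D k" for p
    proof (cases "snd p = k")
      case True
      have "(\<lambda>Z. - (\<Sum>l\<in>UNIV - {k}. Z $ (fst p, l) * G (par k Z) $ l) / G (par k Z) $ k) differentiable_on D k"
        unfolding differentiable_on_def
      proof
        fix Z assume "Z \<in> D k"
        then show "(\<lambda>Z. - (\<Sum>l\<in>UNIV - {k}. Z $ (fst p, l) * G (par k Z) $ l) / G (par k Z) $ k) differentiable at Z within D k"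
          using GD ZD unfolding differentiable_on_def
          by (intro differentiable_divide differentiable_minus differentiable_sum differentiable_mult) (auto simp: D_def)
      qed
      then show ?thesis using True by (simp add: F_def)
    next
      case False
      then show ?thesis using ZD by (simp add: F_def)
    qed
    then show "F k differentiable_on D k"
      unfolding differentiable_on_def
      by (subst differentiable_componentwise_within) (auto simp: Basis_vec_def inner_axis)
  qed auto
  have sub: "{Z. \<exists>s\<in>S. \<forall>i. (\<Sum>k\<in>UNIV. Z $ (i, k) * G s $ k) = 0} \<subseteq> (\<Union>k. F k ` D k)"
  proof clarify
    fix Z :: "real^('m \<times> 'k)" and s
    assume s: "s \<in> S" and zero: "\<forall>i :: 'm. (\<Sum>k\<in>UNIV. Z $ (i, k) * G s $ k) = 0"
    from nz[OF s] obtain k where k: "G s $ k \<noteq> 0"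
      by (auto simp: vec_eq_iff)
    \<comment> \<open>\<open>Y\<close> is \<open>Z\<close> with column \<open>k\<close> overwritten
      by the parameter; the equations \<open>zero\<close>, divided by \<open>G s $ k\<close>, let
      \<open>F k\<close> restore that column.\<close>
    define Y :: "real^('m \<times> 'k)" where
      "Y = (\<chi> p. if snd p = k then (if fst p \<in> range j then s $ (inv j (fst p)) else 0) else Z $ p)"
    have pY: "par k Y = s"
      using j by (auto simp: par_def Y_def vec_eq_iff)
    have "Y \<in> D k"
      using s k i0 by (simp add: D_def pY) (simp add: Y_def)
    moreover have "F k Y = Z"
    proof -
      have "- (\<Sum>l\<in>UNIV - {k}. Y $ (i, l) * G s $ l) / G s $ k = Z $ (i, k)" for i
      proof -
        have "(\<Sum>l\<in>UNIV - {k}. Y $ (i, l) * G s $ l) = (\<Sum>l\<in>UNIV - {k}. Z $ (i, l) * G s $ l)"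
          by (rule sum.cong) (auto simp: Y_def)
        also have "\<dots> = - (Z $ (i, k) * G s $ k)"
          using zero[rule_format, of i] by (subst (asm) sum.remove[of _ k]) auto
        finally show ?thesis using k by simp
      qed
      then show ?thesis
        by (auto simp: F_def pY vec_eq_iff) (auto simp: Y_def)
    qed
    ultimately show "Z \<in> (\<Union>k. F k ` D k)" by blast
  qed
  have "negligible (\<Union>k. F k ` D k)"
    using bad by (intro negligible_Union) auto
  from AE_PiM_notin_negligible[OF prob sets ac this] show ?thesis
  proof eventually_elim
    case (elim z)
    then have "vec_lambda z \<notin> {Z. \<exists>s\<in>S. \<forall>i. (\<Sum>k\<in>UNIV. Z $ (i, k) * G s $ k) = 0}"
      using sub by blast
    then show ?case by auto
  qed
qed

section \<open>Characteristic functions and weak convergence\<close>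

text \<open>Finite sums of characters. Convergence of characteristic functions is convergence of the
  integrals of these functions, so weak convergence reduces to approximating test functions by
  them.\<close>

inductive_set trig_polys :: "('a::euclidean_space \<Rightarrow> complex) set" where
  trig_cis: "(\<lambda>y. c * cis (b \<bullet> y)) \<in> trig_polys"
| trig_add: "p \<in> trig_polys \<Longrightarrow> q \<in> trig_polys \<Longrightarrow> (\<lambda>y. p y + q y) \<in> trig_polys"

lemma trig_const: "(\<lambda>y. c) \<in> trig_polys"
  using trig_cis[of c 0] by simp

lemma trig_cmult: "p \<in> trig_polys \<Longrightarrow> (\<lambda>y. c * p y) \<in> trig_polys"
proof (induction rule: trig_polys.induct)
  case (trig_cis a b)
  show ?case using trig_polys.trig_cis[of "c * a" b] by (simp add: mult.assoc)
next
  case (trig_add p q)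
  then show ?case using trig_polys.trig_add by (simp add: distrib_left)
qed

lemma trig_mult_cis: "p \<in> trig_polys \<Longrightarrow> (\<lambda>y. cis (b \<bullet> y) * p y) \<in> trig_polys"
proof (induction rule: trig_polys.induct)
  case (trig_cis c a)
  have "(\<lambda>y. cis (b \<bullet> y) * (c * cis (a \<bullet> y))) = (\<lambda>y. c * cis ((b + a) \<bullet> y))"
    by (auto simp: fun_eq_iff cis_mult inner_add_left mult_ac add_ac)
  then show ?case using trig_polys.trig_cis[of c "b + a"] by simp
next
  case (trig_add p q)
  then show ?case using trig_polys.trig_add by (simp add: distrib_left)
qed

lemma trig_mult: "p \<in> trig_polys \<Longrightarrow> q \<in> trig_polys \<Longrightarrow> (\<lambda>y. p y * q y) \<in> trig_polys"
proof (induction rule: trig_polys.induct)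
  case (trig_cis c b)
  show ?case using trig_cmult[OF trig_mult_cis[OF trig_cis(1), of b], of c] by (simp add: mult.assoc)
next
  case (trig_add p q)
  then show ?case using trig_polys.trig_add by (simp add: distrib_right)
qed

lemma trig_sum: "finite I \<Longrightarrow> (\<And>i. i \<in> I \<Longrightarrow> p i \<in> trig_polys) \<Longrightarrow> (\<lambda>y. \<Sum>i\<in>I. p i y) \<in> trig_polys"
  by (induction I rule: finite_induct) (auto intro: trig_const trig_add)

lemma trig_cos: "(\<lambda>y. of_real (cos (b \<bullet> y))) \<in> trig_polys"
proof -
  have "(\<lambda>y. 1/2 * cis (b \<bullet> y) + 1/2 * cis ((- b) \<bullet> y)) \<in> trig_polys"
    by (intro trig_add trig_cis)
  also have "(\<lambda>y. 1/2 * cis (b \<bullet> y) + 1/2 * cis ((- b) \<bullet> y)) = (\<lambda>y. complex_of_real (cos (b \<bullet> y)))"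
    by (auto simp: fun_eq_iff complex_eq_iff)
  finally show ?thesis .
qed

lemma trig_sin: "(\<lambda>y. of_real (sin (b \<bullet> y))) \<in> trig_polys"
proof -
  have "(\<lambda>y. (-\<i>/2) * cis (b \<bullet> y) + \<i>/2 * cis ((- b) \<bullet> y)) \<in> trig_polys"
    by (intro trig_add trig_cis)
  also have "(\<lambda>y. (-\<i>/2) * cis (b \<bullet> y) + \<i>/2 * cis ((- b) \<bullet> y)) = (\<lambda>y. complex_of_real (sin (b \<bullet> y)))"
    by (auto simp: fun_eq_iff complex_eq_iff)
  finally show ?thesis .
qed

lemma trig_integral_tendsto:
  fixes Ms :: "nat \<Rightarrow> 'a::euclidean_space measure"
  assumes "\<And>n. prob_space (Ms n)" "\<And>n. sets (Ms n) = sets borel" "prob_space M" "sets M = sets borel"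
    and char: "\<And>b. (\<lambda>n. \<integral>y. cis (b \<bullet> y) \<partial>Ms n) \<longlonglongrightarrow> (\<integral>y. cis (b \<bullet> y) \<partial>M)"
    and p: "p \<in> trig_polys"
  shows "(\<forall>n. integrable (Ms n) p) \<and> integrable M p \<and> (\<lambda>n. \<integral>y. p y \<partial>Ms n) \<longlonglongrightarrow> (\<integral>y. p y \<partial>M)"
  using p
proof induction
  case (trig_cis c b)
  have int: "integrable N (\<lambda>y. cis (b \<bullet> y))" if "prob_space N" "sets N = sets borel" for N :: "'a measure"
  proof -
    interpret prob_space N by fact
    have "(\<lambda>y::'a. cis (b \<bullet> y)) \<in> borel_measurable borel"
      by (intro borel_measurable_continuous_onI continuous_intros)
    then show ?thesis
      by (intro integrable_const_bound[where B=1]) (auto simp: that(2) cong: measurable_cong_sets)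
  qed
  show ?case
    using int assms(1-4) char by (auto intro!: tendsto_mult)
next
  case (trig_add p q)
  then show ?case by (auto intro!: tendsto_add)
qed

text \<open>Wraps R^n around the unit torus with period 2 L in each coordinate. Real polynomials on
  the torus pull back to trigonometric polynomials, which opens the class to
  Stone-Weierstrass.\<close>

definition torus :: "real \<Rightarrow> real^'n::finite \<Rightarrow> complex^'n" where
  "torus L y = (\<chi> j. cis (pi * y $ j / L))"

lemma trig_polynomial_torus:
  assumes "real_polynomial_function (p :: complex^'n::finite \<Rightarrow> real)"
  shows "(\<lambda>y. complex_of_real (p (torus L y))) \<in> trig_polys"
  using assms
proof induction
  case (linear f)
  interpret bounded_linear f by fact
  have eq: "torus L y = (\<Sum>j\<in>UNIV. cos (((pi / L) *\<^sub>R axis j 1) \<bullet> y) *\<^sub>R axis j 1 + sin (((pi / L) *\<^sub>R axis j 1) \<bullet> y) *\<^sub>R axis j \<i>)" for y :: "real^'n"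
  proof (subst vec_eq_iff, intro allI)
    fix i
    have "(\<Sum>j\<in>UNIV. cos (((pi / L) *\<^sub>R axis j 1) \<bullet> y) *\<^sub>R axis j 1 + sin (((pi / L) *\<^sub>R axis j 1) \<bullet> y) *\<^sub>R axis j \<i>) $ i
      = (\<Sum>j\<in>UNIV. if j = i then cis (pi * y $ i / L) else 0)"
      unfolding sum_component inner_scaleR_left inner_axis' by (rule sum.cong) (auto simp: axis_def complex_eq_iff)
    then show "torus L y $ i = (\<Sum>j\<in>UNIV. cos (((pi / L) *\<^sub>R axis j 1) \<bullet> y) *\<^sub>R axis j 1 + sin (((pi / L) *\<^sub>R axis j 1) \<bullet> y) *\<^sub>R axis j \<i>) $ i"
      by (simp add: torus_def)
  qed
  have "complex_of_real (f (torus L y)) =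
     (\<Sum>j\<in>UNIV. complex_of_real (f (axis j 1)) * complex_of_real (cos (((pi / L) *\<^sub>R axis j 1) \<bullet> y)) +
        complex_of_real (f (axis j \<i>)) * complex_of_real (sin (((pi / L) *\<^sub>R axis j 1) \<bullet> y)))" for y :: "real^'n"
    unfolding eq by (simp add: sum add scaleR mult.commute)
  then show ?case
    by (simp only:) (intro trig_sum trig_add trig_cmult trig_cos trig_sin; simp)
next
  case (const c)
  show ?case by (rule trig_const)
next
  case (add f g)
  then show ?case by (simp add: trig_add)
next
  case (mult f g)
  then show ?case by (simp add: trig_mult)
qed

text \<open>A test function cut off to vanish near the faces of the cube of half-side
  \<open>L\<close> descends to a continuous function on the torus, where Stone-Weierstrass applies.
  The approximant is periodic and so does not follow \<open>h\<close> far away, but it inherits the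
  global bound B + e, and that bound makes the tails harmless.\<close>

lemma trig_approx:
  fixes h :: "real^'n::finite \<Rightarrow> real"
  assumes h: "continuous_on UNIV h" and B: "\<And>y. \<bar>h y\<bar> \<le> B" and R: "0 < R" and e: "0 < e"
  obtains T where "(\<lambda>y. complex_of_real (T y)) \<in> trig_polys"
    "\<And>y. norm y \<le> R \<Longrightarrow> \<bar>h y - T y\<bar> < e" "\<And>y. \<bar>T y\<bar> < B + e"
proof -
  \<comment> \<open>The cutoff vanishes from norm R + 1 on, hence before the seam at distance R +
    2.\<close>
  define L where "L = R + 2"
  define h' where "h' y = max 0 (min 1 (R + 1 - norm y)) * h y" for y
  have h': "continuous_on UNIV h'"
    unfolding h'_def by (intro continuous_intros h)
  have supp: "h' y = 0" if "R + 1 \<le> \<bar>y $ j\<bar>" for y j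
    using that component_le_norm_cart[of y j] by (simp add: h'_def max_def min_def)
  have B': "\<bar>h' y\<bar> \<le> B" for y
  proof -
    have "\<bar>h' y\<bar> \<le> 1 * \<bar>h y\<bar>"
      unfolding h'_def abs_mult by (intro mult_right_mono) auto
    then show ?thesis using B[of y] by simp
  qed
  define K where "K = {z :: complex^'n. \<forall>j. cmod (z $ j) = 1}"
  define H where "H z = h' (\<chi> j. L / pi * Arg (z $ j))" for z :: "complex^'n"
  have K: "compact K"
  proof -
    have "closed K"
      unfolding K_def by (intro closed_Collect_all closed_Collect_eq continuous_intros)
    moreover have "bounded K"
    proof (rule boundedI)
      fix z assume "z \<in> K"
      then have "(\<Sum>j\<in>UNIV. cmod (z $ j)) = real CARD('n)" by (simp add: K_def)
      then show "norm z \<le> real CARD('n)"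
        using L2_set_le_sum[of UNIV "\<lambda>j. norm (z $ j)"] by (simp add: norm_vec_def)
    qed
    ultimately show ?thesis by (simp add: compact_eq_bounded_closed)
  qed
  have "continuous_on K H"
    unfolding continuous_on_eq_continuous_within
  proof
    fix z assume z: "z \<in> K"
    show "continuous (at z within K) H"
    \<comment> \<open>On the torus \<open>Arg\<close> jumps only where a coordinate is -1, the seam;
      there the cutoff makes \<open>H\<close> vanish on a whole neighbourhood.\<close>
    proof (cases "\<forall>j. z $ j \<notin> \<real>\<^sub>\<le>\<^sub>0")
      case True
      have "((\<lambda>z. \<chi> j. L / pi * Arg (z $ j)) \<longlongrightarrow> (\<chi> j. L / pi * Arg (z $ j))) (at z within K)"
        using True by (intro tendsto_intros) auto
      moreover have "isCont h' (\<chi> j. L / pi * Arg (z $ j))"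
        using h' by (simp add: continuous_on_eq_continuous_at)
      ultimately have "((\<lambda>z. h' (\<chi> j. L / pi * Arg (z $ j))) \<longlongrightarrow> h' (\<chi> j. L / pi * Arg (z $ j))) (at z within K)"
        by (rule isCont_tendsto_compose[rotated])
      then show ?thesis
        unfolding continuous_within H_def .
    next
      case False
      then obtain j where "z $ j \<in> \<real>\<^sub>\<le>\<^sub>0" by auto
      moreover have "cmod (z $ j) = 1" using z by (simp add: K_def)
      ultimately have zj: "z $ j = -1"
        by (auto elim!: nonpos_Reals_cases)
      \<comment> \<open>The angle that corresponds to the coordinate value R + 1; from there on
        \<open>h'\<close> is 0.\<close>
      define \<alpha> where "\<alpha> = pi * (R + 1) / L"
      have \<alpha>: "0 < \<alpha>" "\<alpha> < pi"
        using R by (auto simp: \<alpha>_def L_def field_simps intro: add_pos_pos)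
      have "cos pi < cos \<alpha>"
        using \<alpha> by (intro cos_monotone_0_pi) auto
      then have c: "Re (z $ j) < cos \<alpha>"
        by (simp add: zj)
      have "((\<lambda>w. Re (w $ j)) \<longlongrightarrow> Re (z $ j)) (at z within K)"
        by (intro tendsto_intros)
      then have ev: "\<forall>\<^sub>F w in at z within K. Re (w $ j) < cos \<alpha>"
        using c by (rule order_tendstoD)
      have zero: "H w = 0" if "w \<in> K" "Re (w $ j) < cos \<alpha>" for w
      proof -
        have "cmod (w $ j) = 1" using that by (simp add: K_def)
        then have "w $ j = cis (Arg (w $ j))"
          by (subst cis_Arg) (auto simp: sgn_eq)
        then have "cos \<bar>Arg (w $ j)\<bar> < cos \<alpha>"
          using that(2) by (metis cis.simps(1) cos_abs_real)
        moreover have "\<bar>Arg (w $ j)\<bar> \<le> pi"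
          using Arg_bounded[of "w $ j"] by auto
        ultimately have "\<alpha> < \<bar>Arg (w $ j)\<bar>"
          using \<alpha> cos_mono_less_eq[of "\<bar>Arg (w $ j)\<bar>" \<alpha>] by simp
        then have "R + 1 \<le> \<bar>L / pi * Arg (w $ j)\<bar>"
          using R by (simp add: \<alpha>_def L_def abs_mult field_simps)
        then show ?thesis
          unfolding H_def by (intro supp[where j=j]) simp
      qed
      have "H z = 0"
        using zero z c by simp
      moreover have "(H \<longlongrightarrow> 0) (at z within K)"
        by (rule tendsto_eventually) (use ev in \<open>auto simp: eventually_at_filter zero elim: eventually_mono\<close>)
      ultimately show ?thesis
        unfolding continuous_within by simp
    qed
  qed
  then obtain p where p: "real_polynomial_function p" "\<And>z. z \<in> K \<Longrightarrow> \<bar>H z - p z\<bar> < e"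
    using Stone_Weierstrass_real_polynomial_function[OF K _ e] by blast
  have tK: "torus L y \<in> K" for y
    by (simp add: K_def torus_def)
  show ?thesis
  proof
    show "(\<lambda>y. complex_of_real (p (torus L y))) \<in> trig_polys"
      by (rule trig_polynomial_torus[OF p(1)])
    show "\<bar>p (torus L y)\<bar> < B + e" for y
    proof -
      have "\<bar>H (torus L y)\<bar> \<le> B" by (simp add: H_def B')
      then show ?thesis using p(2)[OF tK[of y]] by linarith
    qed
    show "\<bar>h y - p (torus L y)\<bar> < e" if y: "norm y \<le> R" for y
    proof -
      have "Arg (cis (pi * y $ j / L)) = pi * y $ j / L" for j
      proof (rule Arg_cis)
        have "\<bar>y $ j\<bar> < L" using component_le_norm_cart[of y j] y by (simp add: L_def)
        then have "\<bar>pi * y $ j / L\<bar> < pi"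
          using R mult_strict_left_mono[of "\<bar>y $ j\<bar>" L pi] by (simp add: abs_mult L_def field_simps)
        then show "pi * y $ j / L \<in> {-pi<..pi}" by (simp only: abs_less_iff) auto
      qed
      then have "(\<chi> j. L / pi * Arg (torus L y $ j)) = y"
        using R by (simp add: torus_def vec_eq_iff L_def)
      then have "H (torus L y) = h y"
        using y by (simp add: H_def h'_def)
      then show ?thesis using p(2)[OF tK[of y]] by simp
    qed
  qed
qed

text \<open>With tightness given, one trigonometric approximant on a large ball settles the matter:
  its integrals converge, and outside the ball both \<open>h\<close> and the approximant are
  bounded, so the error is a multiple of the tail mass.\<close>

lemma conv_distr_char:
  fixes Ms :: "nat \<Rightarrow> (real^'n::finite) measure"
  assumes Ms: "\<And>n. prob_space (Ms n)" "\<And>n. sets (Ms n) = sets borel" "prob_space M" "sets M = sets borel"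
    and char: "\<And>b. (\<lambda>n. \<integral>y. cis (b \<bullet> y) \<partial>Ms n) \<longlonglongrightarrow> (\<integral>y. cis (b \<bullet> y) \<partial>M)"
    and tight: "\<And>e. 0 < e \<Longrightarrow> \<exists>R. \<forall>\<^sub>F n in sequentially. measure (Ms n) {y. R < norm y} \<le> e"
  shows "conv_distr Ms M"
  unfolding conv_distr_def
proof (intro allI impI)
  fix h :: "real^'n \<Rightarrow> real"
  assume h: "continuous_on UNIV h \<and> bounded (range h)"
  then obtain B where B: "\<And>y. \<bar>h y\<bar> \<le> B"
    by (auto simp: bounded_iff)
  then have B0: "0 \<le> B" using abs_ge_zero order_trans by blast
  have hm: "h \<in> borel_measurable borel"
    using h by (intro borel_measurable_continuous_onI) auto
  have err: "\<bar>(\<integral>y. h y \<partial>N) - (\<integral>y. T y \<partial>N)\<bar> \<le> e + (2 * B + e) * measure N {y. R < norm y}"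
    if N: "prob_space N" "sets N = sets borel" and T: "integrable N T" and "0 < e"
      and T1: "\<And>y. norm y \<le> R \<Longrightarrow> \<bar>h y - T y\<bar> < e" and T2: "\<And>y. \<bar>T y\<bar> < B + e"
    for N :: "(real^'n) measure" and T e R
  proof -
    interpret prob_space N by fact
    have hi: "integrable N h"
      by (rule integrable_const_bound[where B=B]) (use B hm N(2) in \<open>auto cong: measurable_cong_sets\<close>)
    have S: "{y. R < norm y} \<in> sets N"
      unfolding N(2) by measurable
    have i: "integrable N (\<lambda>y. indicator {y. R < norm y} y :: real)"
      by (rule integrable_real_indicator[OF S]) (simp add: emeasure_eq_measure)
    have "\<bar>(\<integral>y. h y \<partial>N) - (\<integral>y. T y \<partial>N)\<bar> = \<bar>\<integral>y. h y - T y \<partial>N\<bar>"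
      using hi T by simp
    also have "\<dots> \<le> (\<integral>y. \<bar>h y - T y\<bar> \<partial>N)"
      by (rule integral_abs_bound)
    also have "\<dots> \<le> (\<integral>y. e + (2 * B + e) * indicator {y. R < norm y} y \<partial>N)"
    proof (rule integral_mono)
      show "\<bar>h y - T y\<bar> \<le> e + (2 * B + e) * indicator {y. R < norm y} y" for y
        using T1[of y] T2[of y] B[of y] \<open>0 < e\<close> by (cases "norm y \<le> R") (auto simp: indicator_def)
    qed (use hi T i in auto)
    also have "\<dots> = e + (2 * B + e) * measure N {y. R < norm y}"
      using i S sets.sets_into_space[OF S] by (simp add: prob_space Int_absorb2)
    finally show ?thesis .
  qed
  show "(\<lambda>n. \<integral>y. h y \<partial>Ms n) \<longlonglongrightarrow> (\<integral>y. h y \<partial>M)"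
  proof (rule LIMSEQ_I)
    fix r :: real assume r: "0 < r"
    \<comment> \<open>With e \<le> 1 and tail mass at most e, the bound e + (2 B + e) e of
      \<open>err\<close> is at most e (2 + 2 B + 1) \<le> r / 4.\<close>
    define e where "e = min 1 (r / (4 * (2 + (2 * B + 1))))"
    have e: "0 < e" "e \<le> 1" "e * (2 + (2 * B + 1)) \<le> r / 4"
    proof -
      show "0 < e" "e \<le> 1" using r B0 by (auto simp: e_def)
      have "e \<le> r / (4 * (2 + (2 * B + 1)))" by (simp add: e_def)
      then show "e * (2 + (2 * B + 1)) \<le> r / 4" using B0 by (simp add: field_simps)
    qed
    obtain R1 where R1: "\<forall>\<^sub>F n in sequentially. measure (Ms n) {y. R1 < norm y} \<le> e"
      using tight[OF e(1)] by blast
    interpret M: prob_space M by fact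
    have "(\<lambda>k. measure M {y. real k < norm y}) \<longlonglongrightarrow> measure M (\<Inter>k. {y. real k < norm y})"
    proof (rule M.finite_Lim_measure_decseq)
      show "range (\<lambda>k. {y. real k < norm y}) \<subseteq> sets M"
        unfolding Ms(4) by (intro image_subsetI, measurable)
      show "decseq (\<lambda>k. {y :: real^'n. real k < norm y})"
        by (auto simp: decseq_def)
    qed
    moreover have "(\<Inter>k. {y :: real^'n. real k < norm y}) = {}"
    proof -
      have "\<exists>k. \<not> real k < norm y" for y :: "real^'n"
        using reals_Archimedean2[of "norm y"] by (metis less_asym)
      then show ?thesis by blast
    qed
    ultimately have "(\<lambda>k. measure M {y. real k < norm y}) \<longlonglongrightarrow> 0" by simp
    then have "\<forall>\<^sub>F k in sequentially. measure M {y. real k < norm y} < e"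
      using e(1) by (rule order_tendstoD)
    then obtain k where k: "measure M {y. real k < norm y} < e"
      by (auto simp: eventually_sequentially)
    define R where "R = max 1 (max R1 (real k))"
    have R: "0 < R" by (simp add: R_def)
    have mono: "measure N {y. R < norm y} \<le> measure N {y. R' < norm y}"
      if "prob_space N" "sets N = sets borel" "R' \<le> R" for N :: "(real^'n) measure" and R'
    proof -
      interpret prob_space N by fact
      show ?thesis
      proof (rule finite_measure_mono)
        show "{y. R < norm y} \<subseteq> {y. R' < norm y}"
          using that(3) by auto
        show "{y. R' < norm y} \<in> sets N"
          unfolding that(2) by measurable
      qed
    qed
    have RM: "measure M {y. R < norm y} \<le> e"
      using mono[OF Ms(3,4), of "real k"] k unfolding R_def by linarith
    obtain T where T: "(\<lambda>y. complex_of_real (T y)) \<in> trig_polys"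
        "\<And>y. norm y \<le> R \<Longrightarrow> \<bar>h y - T y\<bar> < e" "\<And>y. \<bar>T y\<bar> < B + e"
      using trig_approx[OF conjunct1[OF h] B R e(1)] by blast
    have Tint: "integrable (Ms n) T" "integrable M T"
        "(\<lambda>n. \<integral>y. T y \<partial>Ms n) \<longlonglongrightarrow> (\<integral>y. T y \<partial>M)" for n
    proof -
      note * = trig_integral_tendsto[OF Ms char T(1)]
      show "integrable (Ms n) T" "integrable M T"
        using conjunct1[OF *, rule_format, of n] conjunct1[OF conjunct2[OF *]]
        by (simp_all only: complex_of_real_integrable_eq)
      have "(\<lambda>n. complex_of_real (\<integral>y. T y \<partial>Ms n)) \<longlonglongrightarrow> complex_of_real (\<integral>y. T y \<partial>M)"
        using conjunct2[OF conjunct2[OF *]] by simp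
      then show "(\<lambda>n. \<integral>y. T y \<partial>Ms n) \<longlonglongrightarrow> (\<integral>y. T y \<partial>M)"
        using tendsto_of_real_iff by blast
    qed
    have "\<forall>\<^sub>F n in sequentially. \<bar>(\<integral>y. T y \<partial>Ms n) - (\<integral>y. T y \<partial>M)\<bar> < r / 4"
      using tendstoD[OF Tint(3), of "r / 4"] r by (simp add: dist_real_def)
    with R1 have "\<forall>\<^sub>F n in sequentially. norm ((\<integral>y. h y \<partial>Ms n) - (\<integral>y. h y \<partial>M)) < r"
    proof eventually_elim
      case (elim n)
      have c: "e + (2 * B + e) * m \<le> r / 4" if "m \<le> e" "0 \<le> m" for m
      proof -
        have "(2 * B + e) * m \<le> (2 * B + 1) * e"
          using that e B0 by (intro mult_mono) auto
        then have "e + (2 * B + e) * m \<le> e * (2 + (2 * B + 1))"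
          using e(1) by (simp add: algebra_simps)
        then show ?thesis using e(3) by linarith
      qed
      have "measure (Ms n) {y. R < norm y} \<le> e"
        using mono[OF Ms(1,2), of R1 n] elim(1) unfolding R_def by linarith
      then have 1: "\<bar>(\<integral>y. h y \<partial>Ms n) - (\<integral>y. T y \<partial>Ms n)\<bar> \<le> r / 4"
        using err[OF Ms(1,2) Tint(1) e(1) T(2,3)] c by (meson measure_nonneg order_trans)
      have 2: "\<bar>(\<integral>y. h y \<partial>M) - (\<integral>y. T y \<partial>M)\<bar> \<le> r / 4"
        using err[OF Ms(3,4) Tint(2) e(1) T(2,3)] c[OF RM] by (meson measure_nonneg order_trans)
      show ?case using 1 2 elim(2) r unfolding real_norm_def by linarith
    qed
    then show "\<exists>no. \<forall>n\<ge>no. norm ((\<integral>y. h y \<partial>Ms n) - (\<integral>y. h y \<partial>M)) < r"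
      by (simp add: eventually_sequentially)
  qed
qed

text \<open>\<open>mvn\<close> takes a square factor of its covariance, while the covariance arises
  as a Gram matrix with many columns. The t rows of \<open>K\<close> span a space of dimension at
  most t, which embeds isometrically into R^t with all inner products preserved.\<close>

lemma gram_square_root:
  fixes K :: "real^'n::finite^'t::finite"
  shows "\<exists>L :: real^'t^'t. L ** transpose L = K ** transpose K"
proof -
  let ?S = "span (range (\<lambda>i. K $ i))"
  have "dim ?S \<le> dim (UNIV :: (real^'t) set)"
  proof -
    have "dim ?S = dim (range (\<lambda>i. K $ i))" by simp
    also have "\<dots> \<le> card (range (\<lambda>i. K $ i))" by (intro dim_le_card') auto
    also have "\<dots> \<le> CARD('t)" by (rule card_image_le) auto
    finally show ?thesis by (simp add: dim_UNIV)
  qed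
  then obtain F where F: "linear F" "\<And>x. x \<in> ?S \<Longrightarrow> norm (F x :: real^'t) = norm x"
    using isometry_subset_subspace[of ?S "UNIV :: (real^'t) set"] by auto
  have inner: "F x \<bullet> F y = x \<bullet> y" if "x \<in> ?S" "y \<in> ?S" for x y
  proof -
    have "norm (F (x + y)) = norm (x + y)" "norm (F x) = norm x" "norm (F y) = norm y"
      using that F(2) span_add by blast+
    then show ?thesis
      using F(1) by (simp add: linear_add norm_eq inner_add inner_commute)
  qed
  have "(\<chi> i. F (K $ i)) ** transpose (\<chi> i. F (K $ i)) = K ** transpose K"
  proof (simp add: vec_eq_iff matrix_matrix_mult_def transpose_def, intro allI)
    fix i j
    have "F (K $ i) \<bullet> F (K $ j) = K $ i \<bullet> K $ j"
      by (intro inner span_base) auto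
    then show "(\<Sum>k\<in>UNIV. F (K $ i) $ k * F (K $ j) $ k) = (\<Sum>k\<in>UNIV. K $ i $ k * K $ j $ k)"
      by (simp add: inner_vec_def)
  qed
  then show ?thesis by blast
qed

section \<open>The normal law \<open>mvn\<close>\<close>

lemma measurable_mvn_map:
  "(\<lambda>w. L *v vec_lambda w) \<in> measurable (PiM UNIV (\<lambda>_::'t::finite. std_normal_distribution)) (borel :: (real^'t) measure)"
proof -
  have "(\<lambda>w. \<Sum>i\<in>UNIV. w i *\<^sub>R column i L) \<in> measurable (PiM UNIV (\<lambda>_::'t. std_normal_distribution)) (borel :: (real^'t) measure)"
    by measurable
  also have "(\<lambda>w. \<Sum>i\<in>UNIV. w i *\<^sub>R column i L) = (\<lambda>w. L *v vec_lambda w)"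
    by (auto simp: fun_eq_iff vec_eq_iff matrix_vector_mult_def column_def mult.commute)
  finally show ?thesis .
qed

lemma prob_space_mvn: "prob_space (mvn S)"
  unfolding mvn_def
  by (intro prob_space.prob_space_distr prob_space_PiM measurable_mvn_map) (auto simp: prob_space_normal_density)

lemma sets_mvn: "sets (mvn S) = sets borel"
  by (simp add: mvn_def)

text \<open>The existence assumption gives the choice \<open>SOME L\<close> its meaning; the
  characteristic function depends on L only through \<open>L ** transpose L\<close>, so the factor
  chosen is immaterial.\<close>

lemma char_mvn:
  assumes "\<exists>L :: real^'t^'t. L ** transpose L = (S :: real^'t::finite^'t)"
  shows "(\<integral>y. cis (b \<bullet> y) \<partial>mvn S) = complex_of_real (exp (- (b \<bullet> (S *v b)) / 2))"
proof -
  define L where "L = (SOME L :: real^'t^'t. L ** transpose L = S)"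
  have L: "L ** transpose L = S"
    unfolding L_def using assms by (rule someI_ex)
  define c where "c = transpose L *v b"
  interpret product_sigma_finite "\<lambda>_::'t. std_normal_distribution"
    by (intro product_sigma_finite.intro prob_space_imp_sigma_finite prob_space_normal_density) auto
  have cis_meas: "(\<lambda>y. cis (a \<bullet> y)) \<in> borel_measurable borel" for a :: "'e::euclidean_space"
    by (intro borel_measurable_continuous_onI continuous_intros)
  have int: "integrable std_normal_distribution (\<lambda>x. cis (a * x))" for a
  proof -
    interpret prob_space std_normal_distribution
      by (intro prob_space_normal_density) auto
    show ?thesis
      using cis_meas[of a] by (intro integrable_const_bound[where B=1]) (auto cong: measurable_cong_sets)
  qed
  have "(\<integral>y. cis (b \<bullet> y) \<partial>mvn S) = (\<integral>w. cis (b \<bullet> (L *v vec_lambda w)) \<partial>PiM UNIV (\<lambda>_. std_normal_distribution))"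
    unfolding mvn_def L_def[symmetric] by (rule integral_distr[OF measurable_mvn_map cis_meas])
  also have "\<dots> = (\<integral>w. (\<Prod>i\<in>UNIV. cis (c $ i * w i)) \<partial>PiM UNIV (\<lambda>_. std_normal_distribution))"
  proof (rule Bochner_Integration.integral_cong[OF refl])
    fix w :: "'t \<Rightarrow> real"
    have "b \<bullet> (L *v vec_lambda w) = c \<bullet> vec_lambda w"
      by (simp add: dot_lmul_matrix[symmetric] c_def)
    then have "b \<bullet> (L *v vec_lambda w) = (\<Sum>i\<in>UNIV. c $ i * w i)"
      by (simp add: inner_vec_def)
    moreover have "cis (\<Sum>i\<in>I. c $ i * w i) = (\<Prod>i\<in>I. cis (c $ i * w i))" if "finite I" for I
      using that by (induction I rule: finite_induct) (auto simp: cis_mult[symmetric])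
    ultimately show "cis (b \<bullet> (L *v vec_lambda w)) = (\<Prod>i\<in>UNIV. cis (c $ i * w i))" by simp
  qed
  also have "\<dots> = (\<Prod>i\<in>UNIV. \<integral>x. cis (c $ i * x) \<partial>std_normal_distribution)"
    by (rule product_integral_prod) (auto intro: int)
  also have "\<dots> = (\<Prod>i\<in>UNIV. complex_of_real (exp (- ((c $ i)\<^sup>2) / 2)))"
  proof (rule prod.cong[OF refl])
    fix i
    show "(\<integral>x. cis (c $ i * x) \<partial>std_normal_distribution) = complex_of_real (exp (- ((c $ i)\<^sup>2) / 2))"
      using fun_cong[OF char_std_normal_distribution, of "c $ i"] by (simp add: char_def cis_conv_exp mult.assoc)
  qed
  also have "\<dots> = complex_of_real (exp (\<Sum>i\<in>UNIV. - ((c $ i)\<^sup>2) / 2))"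
    by (simp add: exp_sum)
  also have "(\<Sum>i\<in>UNIV. - ((c $ i)\<^sup>2) / 2) = - (c \<bullet> c) / 2"
    by (simp add: inner_vec_def power2_eq_square sum_divide_distrib[symmetric] sum_negf)
  also have "c \<bullet> c = b \<bullet> (S *v b)"
    unfolding L[symmetric] c_def
    by (metis dot_lmul_matrix matrix_vector_mul_assoc transpose_matrix_vector)
  finally show ?thesis .
qed

section \<open>Independent draws under a product \<open>pmf\<close>, and Slutsky's lemma\<close>

lemma expectation_prod_Pi_pmf_finite:
  fixes F :: "'i \<Rightarrow> 'a::finite \<Rightarrow> 'b::{real_normed_field,banach,second_countable_topology}"
  assumes "finite I"
  shows "(\<integral>\<omega>. (\<Prod>i\<in>I. F i (\<omega> i)) \<partial>measure_pmf (Pi_pmf I d p)) = (\<Prod>i\<in>I. \<integral>a. F i a \<partial>measure_pmf (p i))"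
proof -
  have "prob_space.indep_vars (measure_pmf (Pi_pmf I d p)) (\<lambda>_. borel) (\<lambda>i \<omega>. F i (\<omega> i)) I"
    by (rule prob_space.indep_vars_compose2[OF prob_space_measure_pmf indep_vars_Pi_pmf[OF assms]]) auto
  moreover have "integrable (measure_pmf (Pi_pmf I d p)) (\<lambda>\<omega>. F i (\<omega> i))" for i
    by (rule measure_pmf.integrable_const_bound[where B="Max (range (\<lambda>a. norm (F i a)))"]) auto
  ultimately have "(\<integral>\<omega>. (\<Prod>i\<in>I. F i (\<omega> i)) \<partial>measure_pmf (Pi_pmf I d p)) = (\<Prod>i\<in>I. \<integral>\<omega>. F i (\<omega> i) \<partial>measure_pmf (Pi_pmf I d p))"
    using assms by (intro prob_space.indep_vars_lebesgue_integral[OF prob_space_measure_pmf])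
  also have "\<dots> = (\<Prod>i\<in>I. \<integral>a. F i a \<partial>measure_pmf (p i))"
  proof (rule prod.cong[OF refl])
    fix i assume "i \<in> I"
    have "(\<integral>\<omega>. F i (\<omega> i) \<partial>measure_pmf (Pi_pmf I d p)) = (\<integral>a. F i a \<partial>measure_pmf (map_pmf (\<lambda>\<omega>. \<omega> i) (Pi_pmf I d p)))"
      by simp
    then show "(\<integral>\<omega>. F i (\<omega> i) \<partial>measure_pmf (Pi_pmf I d p)) = (\<integral>a. F i a \<partial>measure_pmf (p i))"
      using \<open>i \<in> I\<close> assms by (simp add: Pi_pmf_component del: integral_map_pmf)
  qed
  finally show ?thesis .
qed

lemma expectation_square_sum_Pi_pmf:
  fixes F :: "'i \<Rightarrow> 'a::finite \<Rightarrow> real"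
  assumes I: "finite I" and mean: "\<And>i. i \<in> I \<Longrightarrow> (\<integral>a. F i a \<partial>measure_pmf (p i)) = 0"
  shows "(\<integral>\<omega>. (\<Sum>i\<in>I. F i (\<omega> i))\<^sup>2 \<partial>measure_pmf (Pi_pmf I d p)) = (\<Sum>i\<in>I. \<integral>a. (F i a)\<^sup>2 \<partial>measure_pmf (p i))"
proof -
  let ?M = "measure_pmf (Pi_pmf I d p)"
  have int: "integrable ?M (\<lambda>\<omega>. F i (\<omega> i) * F j (\<omega> j))" for i j
  proof (rule measure_pmf.integrable_const_bound[where B="Max (range (\<lambda>(a, b). norm (F i a * F j b)))"])
    have "norm (F i a * F j b) \<in> range (\<lambda>(a, b). norm (F i a * F j b))" for a b
      by (rule image_eqI[of _ _ "(a, b)"]) auto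
    then show "AE \<omega> in ?M. norm (F i (\<omega> i) * F j (\<omega> j)) \<le> Max (range (\<lambda>(a, b). norm (F i a * F j b)))"
      by (intro AE_I2 Max_ge) auto
  qed auto
  have cross: "(\<integral>\<omega>. F i (\<omega> i) * F j (\<omega> j) \<partial>?M) = (if i = j then \<integral>a. (F i a)\<^sup>2 \<partial>measure_pmf (p i) else 0)"
    if ij: "i \<in> I" "j \<in> I" for i j
  proof (cases "i = j")
    case True
    \<comment> \<open>Padding with the factor 1 at all other indices turns the square, and below the
      mixed product, into a full product over \<open>I\<close>, to which independence
      applies.\<close>
    have "F i (\<omega> i) * F j (\<omega> j) = (\<Prod>k\<in>I. if k = i then (F i (\<omega> k))\<^sup>2 else 1)" for \<omega>
      using ij I True by (simp add: power2_eq_square)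
    then have "(\<integral>\<omega>. F i (\<omega> i) * F j (\<omega> j) \<partial>?M) = (\<integral>\<omega>. (\<Prod>k\<in>I. if k = i then (F i (\<omega> k))\<^sup>2 else 1) \<partial>?M)"
      by simp
    also have "\<dots> = (\<Prod>k\<in>I. \<integral>a. (if k = i then (F i a)\<^sup>2 else 1) \<partial>measure_pmf (p k))"
      by (rule expectation_prod_Pi_pmf_finite[OF I])
    also have "\<dots> = (\<Prod>k\<in>I. if k = i then \<integral>a. (F i a)\<^sup>2 \<partial>measure_pmf (p i) else 1)"
      by (rule prod.cong) auto
    also have "\<dots> = (\<integral>a. (F i a)\<^sup>2 \<partial>measure_pmf (p i))"
      using ij I by simp
    finally show ?thesis using True by simp
  next
    case False
    have "F i (\<omega> i) * F j (\<omega> j) = (\<Prod>k\<in>I. (if k = i then F i (\<omega> k) else 1) * (if k = j then F j (\<omega> k) else 1))" for \<omega>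
      using ij I by (simp add: prod.distrib)
    then have "(\<integral>\<omega>. F i (\<omega> i) * F j (\<omega> j) \<partial>?M) =
        (\<integral>\<omega>. (\<Prod>k\<in>I. (if k = i then F i (\<omega> k) else 1) * (if k = j then F j (\<omega> k) else 1)) \<partial>?M)"
      by simp
    also have "\<dots> = (\<Prod>k\<in>I. \<integral>a. (if k = i then F i a else 1) * (if k = j then F j a else 1) \<partial>measure_pmf (p k))"
      by (rule expectation_prod_Pi_pmf_finite[OF I])
    also have "\<dots> = 0"
      using ij I False mean by (intro prod_zero) (auto intro!: bexI[of _ i])
    finally show ?thesis using False by simp
  qed
  have "(\<integral>\<omega>. (\<Sum>i\<in>I. F i (\<omega> i))\<^sup>2 \<partial>?M) = (\<integral>\<omega>. (\<Sum>i\<in>I. \<Sum>j\<in>I. F i (\<omega> i) * F j (\<omega> j)) \<partial>?M)"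
    by (simp add: power2_eq_square sum_product)
  also have "\<dots> = (\<Sum>i\<in>I. \<Sum>j\<in>I. \<integral>\<omega>. F i (\<omega> i) * F j (\<omega> j) \<partial>?M)"
    by (simp add: int)
  also have "\<dots> = (\<Sum>i\<in>I. \<integral>a. (F i a)\<^sup>2 \<partial>measure_pmf (p i))"
    using I by (intro sum.cong) (simp_all add: cross)
  finally show ?thesis .
qed

text \<open>\<open>h\<close> is only continuous, so tightness of \<open>W\<close> confines the
  comparison to a ball on which \<open>h\<close> is uniformly continuous. The sample space carries a
  \<open>pmf\<close>, so \<open>T\<close> can be any function, in particular an estimator chosen
  with no regard to measurability.\<close>

lemma conv_distr_slutsky:
  fixes p :: "nat \<Rightarrow> 'w pmf" and W T :: "nat \<Rightarrow> 'w \<Rightarrow> 'e::euclidean_space"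
  assumes conv: "conv_distr (\<lambda>k. distr (measure_pmf (p k)) borel (W k)) M"
    and tight: "\<And>e. 0 < e \<Longrightarrow> \<exists>R. \<forall>\<^sub>F k in sequentially. measure_pmf.prob (p k) {\<omega>. R < norm (W k \<omega>)} \<le> e"
    and close: "\<And>e. 0 < e \<Longrightarrow> (\<lambda>k. measure_pmf.prob (p k) {\<omega>. e < dist (T k \<omega>) (W k \<omega>)}) \<longlonglongrightarrow> 0"
  shows "conv_distr (\<lambda>k. distr (measure_pmf (p k)) borel (T k)) M"
  unfolding conv_distr_def
proof (intro allI impI)
  fix h :: "'e \<Rightarrow> real"
  assume h: "continuous_on UNIV h \<and> bounded (range h)"
  then obtain B where B: "\<And>y. \<bar>h y\<bar> \<le> B"
    by (auto simp: bounded_iff)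
  then have B0: "0 \<le> B" using abs_ge_zero order_trans by blast
  have hm[measurable]: "h \<in> borel_measurable borel"
    using h by (intro borel_measurable_continuous_onI) auto
  have int: "integrable (measure_pmf (p k)) (\<lambda>\<omega>. h (X \<omega>))" for k and X :: "'w \<Rightarrow> 'e"
    by (rule measure_pmf.integrable_const_bound[where B=B]) (auto simp: B)
  have "(\<lambda>k. (\<integral>\<omega>. h (T k \<omega>) \<partial>p k) - (\<integral>\<omega>. h (W k \<omega>) \<partial>p k)) \<longlonglongrightarrow> 0"
  proof (rule LIMSEQ_I)
    fix r :: real assume r: "0 < r"
    define e where "e = r / (4 * (2 * B + 1))"
    have e: "0 < e" "2 * B * e \<le> r / 4"
    proof -
      show "0 < e" using r B0 by (auto simp: e_def)
      have "r * (2 * B) \<le> r * (2 * B + 1)" using r by (intro mult_left_mono) auto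
      then show "2 * B * e \<le> r / 4" using B0 by (simp add: e_def field_simps)
    qed
    obtain R where R: "\<forall>\<^sub>F k in sequentially. measure_pmf.prob (p k) {\<omega>. R < norm (W k \<omega>)} \<le> e"
      using tight[OF e(1)] by blast
    have "uniformly_continuous_on (cball 0 (R + 1)) h"
      using h by (intro compact_uniformly_continuous) (auto intro: continuous_on_subset)
    then obtain d where d: "0 < d" "\<And>x y. x \<in> cball 0 (R + 1) \<Longrightarrow> y \<in> cball 0 (R + 1) \<Longrightarrow> dist x y < d \<Longrightarrow> dist (h x) (h y) < r / 4"
      unfolding uniformly_continuous_on_def using r by (metis divide_pos_pos zero_less_numeral)
    \<comment> \<open>The cap at 1 keeps \<open>T k \<omega>\<close> in the ball of radius R + 1 on
      which \<open>d\<close> was chosen.\<close>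
    define d' where "d' = min 1 (d / 2)"
    have d': "0 < d'" "d' \<le> 1" "d' < d" using d(1) by (auto simp: d'_def)
    have "\<forall>\<^sub>F k in sequentially. measure_pmf.prob (p k) {\<omega>. d' < dist (T k \<omega>) (W k \<omega>)} < e"
      using close[OF d'(1)] e(1) by (rule order_tendstoD)
    with R have "\<forall>\<^sub>F k in sequentially. norm ((\<integral>\<omega>. h (T k \<omega>) \<partial>p k) - (\<integral>\<omega>. h (W k \<omega>) \<partial>p k) - 0) < r"
    proof eventually_elim
      case (elim k)
      let ?A = "{\<omega>. R < norm (W k \<omega>)}" and ?C = "{\<omega>. d' < dist (T k \<omega>) (W k \<omega>)}"
      have ind: "integrable (measure_pmf (p k)) (\<lambda>\<omega>. indicator S \<omega> :: real)" for S
        by (rule integrable_real_indicator) (auto simp: measure_pmf.emeasure_eq_measure)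
      have "\<bar>(\<integral>\<omega>. h (T k \<omega>) \<partial>p k) - (\<integral>\<omega>. h (W k \<omega>) \<partial>p k)\<bar> = \<bar>\<integral>\<omega>. h (T k \<omega>) - h (W k \<omega>) \<partial>p k\<bar>"
        by (simp add: int)
      also have "\<dots> \<le> (\<integral>\<omega>. \<bar>h (T k \<omega>) - h (W k \<omega>)\<bar> \<partial>p k)"
        by (rule integral_abs_bound)
      also have "\<dots> \<le> (\<integral>\<omega>. r / 4 + 2 * B * indicator ?A \<omega> + 2 * B * indicator ?C \<omega> \<partial>p k)"
      proof (rule integral_mono)
        fix \<omega>
        show "\<bar>h (T k \<omega>) - h (W k \<omega>)\<bar> \<le> r / 4 + 2 * B * indicator ?A \<omega> + 2 * B * indicator ?C \<omega>"
        proof (cases "\<omega> \<in> ?A \<or> \<omega> \<in> ?C")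
          case True
          then have "2 * B \<le> 2 * B * indicator ?A \<omega> + 2 * B * indicator ?C \<omega>"
            using B0 by (auto simp: indicator_def)
          then show ?thesis using B[of "T k \<omega>"] B[of "W k \<omega>"] r by linarith
        next
          case False
          then have *: "norm (W k \<omega>) \<le> R" "dist (T k \<omega>) (W k \<omega>) \<le> d'" by auto
          have "norm (T k \<omega>) \<le> norm (W k \<omega>) + dist (T k \<omega>) (W k \<omega>)"
            by (metis dist_norm norm_triangle_sub)
          then have "dist (h (T k \<omega>)) (h (W k \<omega>)) < r / 4"
            using * d' by (intro d(2)) auto
          then show ?thesis using B0 by (simp add: dist_real_def indicator_def)
        qed
      qed (auto simp: int ind)
      also have "\<dots> = r / 4 + 2 * B * measure_pmf.prob (p k) ?A + 2 * B * measure_pmf.prob (p k) ?C"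
        by (simp add: ind)
      also have "\<dots> \<le> r / 4 + 2 * B * e + 2 * B * e"
        using elim B0 by (intro add_mono mult_left_mono) auto
      also have "\<dots> < r" using e(2) r by linarith
      finally show ?case by simp
    qed
    then show "\<exists>no. \<forall>k\<ge>no. norm ((\<integral>\<omega>. h (T k \<omega>) \<partial>p k) - (\<integral>\<omega>. h (W k \<omega>) \<partial>p k) - 0) < r"
      by (simp add: eventually_sequentially)
  qed
  moreover have "(\<lambda>k. \<integral>\<omega>. h (W k \<omega>) \<partial>p k) \<longlonglongrightarrow> (\<integral>y. h y \<partial>M)"
  proof -
    have "(\<lambda>k. \<integral>y. h y \<partial>distr (measure_pmf (p k)) borel (W k)) \<longlonglongrightarrow> (\<integral>y. h y \<partial>M)"
      using conv h unfolding conv_distr_def by blast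
    then show ?thesis by (simp add: integral_distr)
  qed
  ultimately have "(\<lambda>k. \<integral>\<omega>. h (T k \<omega>) \<partial>p k) \<longlonglongrightarrow> (\<integral>y. h y \<partial>M)"
    using Lim_transform by fastforce
  then show "(\<lambda>k. \<integral>y. h y \<partial>distr (measure_pmf (p k)) borel (T k)) \<longlonglongrightarrow> (\<integral>y. h y \<partial>M)"
    by (simp add: integral_distr)
qed

section \<open>The sample averages\<close>

lemma abs_exp_minus_linear:
  assumes "0 \<le> (x::real)" shows "\<bar>exp (- x) - (1 - x)\<bar> \<le> x\<^sup>2"
proof -
  have "1 - x \<le> exp (- x)" using exp_ge_add_one_self[of "- x"] by simp
  moreover have "exp (- x) \<le> 1 - x + x\<^sup>2"
  proof -
    have "exp (- x) \<le> 1 / (1 + x)"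
      using exp_ge_add_one_self[of x] assms by (simp add: exp_minus divide_simps)
    also have "\<dots> \<le> 1 - x + x\<^sup>2"
    proof -
      have "1 \<le> (1 - x + x\<^sup>2) * (1 + x)"
        using assms by (simp add: algebra_simps power2_eq_square)
      then show ?thesis using assms by (simp add: divide_simps)
    qed
    finally show ?thesis .
  qed
  ultimately show ?thesis by linarith
qed

text \<open>Comparison with the Gaussian factor \<open>y k\<close> of the same variance. Both
  factors lie in the unit disc, so their n-th powers differ by at most n |z - y| = O(n |s|^3 + n
  s^4), and n s^2 \<rightarrow> v with n \<rightarrow> \<infinity> forces s \<rightarrow> 0.\<close>

lemma char_power_limit:
  fixes w c :: "'a::finite \<Rightarrow> real" and n :: "nat \<Rightarrow> nat" and s :: "nat \<Rightarrow> real"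
  assumes w: "\<And>a. 0 \<le> w a" "(\<Sum>a\<in>UNIV. w a) = 1" and mean: "(\<Sum>a\<in>UNIV. w a * c a) = 0"
    and n: "filterlim n at_top sequentially" and v: "(\<lambda>k. real (n k) * (s k)\<^sup>2) \<longlonglongrightarrow> v"
  shows "(\<lambda>k. (\<Sum>a\<in>UNIV. complex_of_real (w a) * cis (s k * c a)) ^ n k) \<longlonglongrightarrow>
     complex_of_real (exp (- (v * (\<Sum>a\<in>UNIV. w a * (c a)\<^sup>2)) / 2))"
proof -
  define \<sigma> where "\<sigma> = (\<Sum>a\<in>UNIV. w a * (c a)\<^sup>2)"
  have \<sigma>0: "0 \<le> \<sigma>" unfolding \<sigma>_def by (intro sum_nonneg mult_nonneg_nonneg w) auto
  define C where "C = (\<Sum>a\<in>UNIV. w a * \<bar>c a\<bar> ^ 3)"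
  have C0: "0 \<le> C" unfolding C_def by (intro sum_nonneg mult_nonneg_nonneg w) auto
  define z where "z k = (\<Sum>a\<in>UNIV. complex_of_real (w a) * cis (s k * c a))" for k
  define y where "y k = complex_of_real (exp (- ((s k)\<^sup>2 * \<sigma> / 2)))" for k
  have nz: "cmod (z k) \<le> 1" for k
  proof -
    have "cmod (z k) \<le> (\<Sum>a\<in>UNIV. cmod (complex_of_real (w a) * cis (s k * c a)))"
      unfolding z_def by (rule norm_sum)
    also have "\<dots> = 1" using w by (simp add: norm_mult)
    finally show ?thesis .
  qed
  have ny: "cmod (y k) \<le> 1" for k
    using \<sigma>0 by (simp add: y_def)
  have zy: "cmod (z k - y k) \<le> C * \<bar>s k\<bar> ^ 3 + \<sigma>\<^sup>2 * (s k) ^ 4" for k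
  proof -
    define q where "q a = 1 + \<i> * (s k * c a) - (s k * c a)\<^sup>2 / 2" for a
    have "complex_of_real (w a) * q a
        = complex_of_real (w a) + (\<i> * s k) * complex_of_real (w a * c a) - complex_of_real ((s k)\<^sup>2 / 2) * complex_of_real (w a * (c a)\<^sup>2)" for a
      by (simp add: q_def field_simps power2_eq_square)
    then have "(\<Sum>a\<in>UNIV. complex_of_real (w a) * q a)
       = complex_of_real (\<Sum>a\<in>UNIV. w a) + (\<i> * s k) * complex_of_real (\<Sum>a\<in>UNIV. w a * c a) - complex_of_real ((s k)\<^sup>2 / 2) * complex_of_real \<sigma>"
      unfolding \<sigma>_def of_real_sum sum_distrib_left by (simp only: sum.distrib sum_subtractf)
    also have "\<dots> = complex_of_real (1 - (s k)\<^sup>2 * \<sigma> / 2)"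
      unfolding w mean by simp
    finally have "z k - complex_of_real (1 - (s k)\<^sup>2 * \<sigma> / 2)
        = (\<Sum>a\<in>UNIV. complex_of_real (w a) * (cis (s k * c a) - q a))"
      by (simp add: z_def right_diff_distrib sum_subtractf)
    also have "cmod \<dots> \<le> (\<Sum>a\<in>UNIV. w a * (\<bar>s k\<bar> ^ 3 * \<bar>c a\<bar> ^ 3))"
    proof (rule sum_norm_le)
      fix a
      let ?x = "s k * c a"
      have "cmod (iexp ?x - (\<Sum>j\<le>2. (\<i> * ?x) ^ j / fact j)) \<le> \<bar>?x\<bar> ^ 3 / fact 3"
        using iexp_approx1[of ?x 2] by (simp add: numeral_3_eq_3)
      also have "\<dots> \<le> \<bar>?x\<bar> ^ 3" by (simp add: fact_numeral)
      also have "(\<Sum>j\<le>2. (\<i> * ?x) ^ j / fact j) = 1 + \<i> * ?x - (?x)\<^sup>2 / 2"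
        by (simp add: numeral_2_eq_2) (simp add: power2_eq_square complex_eq_iff)
      finally have "cmod (cis ?x - q a) \<le> \<bar>?x\<bar> ^ 3"
        by (simp add: cis_conv_exp q_def)
      then have "w a * cmod (cis ?x - q a) \<le> w a * \<bar>?x\<bar> ^ 3"
        using w by (intro mult_left_mono)
      then show "cmod (complex_of_real (w a) * (cis ?x - q a)) \<le> w a * (\<bar>s k\<bar> ^ 3 * \<bar>c a\<bar> ^ 3)"
        using w by (simp add: norm_mult abs_mult power_mult_distrib)
    qed
    also have "\<dots> = C * \<bar>s k\<bar> ^ 3"
      by (simp add: C_def sum_distrib_left mult_ac)
    finally have 1: "cmod (z k - complex_of_real (1 - (s k)\<^sup>2 * \<sigma> / 2)) \<le> C * \<bar>s k\<bar> ^ 3" .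
    have "cmod (complex_of_real (1 - (s k)\<^sup>2 * \<sigma> / 2) - y k) = \<bar>exp (- ((s k)\<^sup>2 * \<sigma> / 2)) - (1 - (s k)\<^sup>2 * \<sigma> / 2)\<bar>"
      unfolding y_def of_real_diff[symmetric] norm_of_real by linarith
    also have "\<dots> \<le> ((s k)\<^sup>2 * \<sigma> / 2)\<^sup>2"
      using \<sigma>0 by (intro abs_exp_minus_linear) auto
    also have "\<dots> \<le> \<sigma>\<^sup>2 * (s k) ^ 4"
      by (simp add: power_mult_distrib power_divide power_even_abs_numeral flip: power_mult)
    finally have 2: "cmod (complex_of_real (1 - (s k)\<^sup>2 * \<sigma> / 2) - y k) \<le> \<sigma>\<^sup>2 * (s k) ^ 4" .
    show ?thesis
      using norm_triangle_ineq[of "z k - complex_of_real (1 - (s k)\<^sup>2 * \<sigma> / 2)" "complex_of_real (1 - (s k)\<^sup>2 * \<sigma> / 2) - y k"] 1 2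
      by simp
  qed
  have rn: "filterlim (\<lambda>k. real (n k)) at_top sequentially"
    by (rule filterlim_compose[OF filterlim_real_sequentially n])
  have "(\<lambda>k. real (n k) * (s k)\<^sup>2 * inverse (real (n k))) \<longlonglongrightarrow> v * 0"
    by (intro tendsto_mult v tendsto_inverse_0_at_top rn)
  moreover have "\<forall>\<^sub>F k in sequentially. real (n k) * (s k)\<^sup>2 * inverse (real (n k)) = (s k)\<^sup>2"
    using filterlim_at_top_dense[THEN iffD1, OF rn, rule_format, of 0] by eventually_elim (simp add: field_simps)
  ultimately have "(\<lambda>k. (s k)\<^sup>2) \<longlonglongrightarrow> 0"
    by (simp add: tendsto_cong)
  then have s0: "(\<lambda>k. \<bar>s k\<bar>) \<longlonglongrightarrow> 0"
    using tendsto_real_sqrt[of "\<lambda>k. (s k)\<^sup>2" 0] by simp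
  have "(\<lambda>k. (real (n k) * (s k)\<^sup>2) * (C * \<bar>s k\<bar>) + \<sigma>\<^sup>2 * ((real (n k) * (s k)\<^sup>2) * \<bar>s k\<bar>\<^sup>2)) \<longlonglongrightarrow> v * (C * 0) + \<sigma>\<^sup>2 * (v * 0\<^sup>2)"
    by (intro tendsto_intros v s0)
  then have lim0: "(\<lambda>k. (real (n k) * (s k)\<^sup>2) * (C * \<bar>s k\<bar>) + \<sigma>\<^sup>2 * ((real (n k) * (s k)\<^sup>2) * \<bar>s k\<bar>\<^sup>2)) \<longlonglongrightarrow> 0"
    by simp
  have "(\<lambda>k. z k ^ n k - y k ^ n k) \<longlonglongrightarrow> 0"
  proof (rule Lim_null_comparison[OF _ lim0])
    have "cmod (z k ^ n k - y k ^ n k) \<le> (real (n k) * (s k)\<^sup>2) * (C * \<bar>s k\<bar>) + \<sigma>\<^sup>2 * ((real (n k) * (s k)\<^sup>2) * \<bar>s k\<bar>\<^sup>2)" for k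
    proof -
      have "cmod (z k ^ n k - y k ^ n k) \<le> real (n k) * cmod (z k - y k)"
        by (rule norm_power_diff[OF nz ny])
      also have "\<dots> \<le> real (n k) * (C * \<bar>s k\<bar> ^ 3 + \<sigma>\<^sup>2 * (s k) ^ 4)"
        by (intro mult_left_mono zy) auto
      also have "\<dots> = (real (n k) * (s k)\<^sup>2) * (C * \<bar>s k\<bar>) + \<sigma>\<^sup>2 * ((real (n k) * (s k)\<^sup>2) * \<bar>s k\<bar>\<^sup>2)"
        by (simp add: algebra_simps power2_eq_square power3_eq_cube power4_eq_xxxx)
      finally show ?thesis .
    qed
    then show "\<forall>\<^sub>F k in sequentially. cmod (z k ^ n k - y k ^ n k) \<le> (real (n k) * (s k)\<^sup>2) * (C * \<bar>s k\<bar>) + \<sigma>\<^sup>2 * ((real (n k) * (s k)\<^sup>2) * \<bar>s k\<bar>\<^sup>2)"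
      by simp
  qed
  moreover have "(\<lambda>k. y k ^ n k) \<longlonglongrightarrow> complex_of_real (exp (- (v * \<sigma>) / 2))"
  proof -
    have "y k ^ n k = complex_of_real (exp (- ((real (n k) * (s k)\<^sup>2) * \<sigma>) / 2))" for k
      by (simp add: y_def exp_of_nat_mult[symmetric] flip: of_real_power)
    then show ?thesis
      by (simp only:) (auto intro!: tendsto_intros v)
  qed
  ultimately have "(\<lambda>k. z k ^ n k) \<longlonglongrightarrow> complex_of_real (exp (- (v * \<sigma>) / 2))"
    using tendsto_add[of "\<lambda>k. z k ^ n k - y k ^ n k" 0 sequentially "\<lambda>k. y k ^ n k"] by simp
  then show ?thesis unfolding z_def \<sigma>_def .
qed

text \<open>The form of sqrt(N) times a linear statistic of the frequencies. Its weights satisfy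
  N(x) (sqrt(N) / N(x))^2 = N / N(x) \<rightarrow> 1 / \<eta>(x), the source of the factors 1 /
  \<eta>(x) in the limit.\<close>

definition scaled_sum :: "(nat \<Rightarrow> 'x::finite \<Rightarrow> nat) \<Rightarrow> ('x \<Rightarrow> 'a \<Rightarrow> 'e::real_vector) \<Rightarrow> nat \<Rightarrow> ('x \<times> nat \<Rightarrow> 'a) \<Rightarrow> 'e" where
  "scaled_sum Ns \<xi> k \<omega> = (\<Sum>x\<in>UNIV. (sqrt (real (\<Sum>y\<in>UNIV. Ns k y)) / real (Ns k x)) *\<^sub>R (\<Sum>j<Ns k x. \<xi> x (\<omega> (x, j))))"

context
  fixes P :: "'x::finite \<Rightarrow> real^('d::finite option)" and Ns :: "nat \<Rightarrow> 'x \<Rightarrow> nat" and \<eta> :: "'x \<Rightarrow> real"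
  assumes P: "\<And>x. P x \<in> prob_simplex"
    and N_infty: "filterlim (\<lambda>k. \<Sum>x\<in>UNIV. Ns k x) at_top sequentially"
    and eta_lim: "\<And>x. (\<lambda>k. real (Ns k x) / real (\<Sum>y\<in>UNIV. Ns k y)) \<longlonglongrightarrow> \<eta> x"
    and eta_pos: "\<And>x. 0 < \<eta> x"
begin

lemma Ns_at_top: "filterlim (\<lambda>k. Ns k x) at_top sequentially"
proof -
  have "filterlim (\<lambda>k. real (\<Sum>y\<in>UNIV. Ns k y)) at_top sequentially"
    by (rule filterlim_compose[OF filterlim_real_sequentially N_infty])
  then have "filterlim (\<lambda>k. (real (Ns k x) / real (\<Sum>y\<in>UNIV. Ns k y)) * real (\<Sum>y\<in>UNIV. Ns k y)) at_top sequentially"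
    using filterlim_tendsto_pos_mult_at_top[OF eta_lim eta_pos] by blast
  then have "filterlim (\<lambda>k. real (Ns k x)) at_top sequentially"
  proof (rule filterlim_mono_eventually)
    have "\<forall>\<^sub>F k in sequentially. 0 < (\<Sum>y\<in>UNIV. Ns k y)"
      using N_infty[unfolded filterlim_at_top, rule_format, of 1] by eventually_elim simp
    then show "\<forall>\<^sub>F k in sequentially. real (Ns k x) / real (\<Sum>y\<in>UNIV. Ns k y) * real (\<Sum>y\<in>UNIV. Ns k y) = real (Ns k x)"
      by eventually_elim (simp del: of_nat_sum)
  qed auto
  then show ?thesis
    by (simp add: filterlim_sequentially_iff_filterlim_real)
qed

lemma ratio_lim: "(\<lambda>k. real (\<Sum>y\<in>UNIV. Ns k y) / real (Ns k x)) \<longlonglongrightarrow> 1 / \<eta> x"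
  using tendsto_divide[OF tendsto_const[of 1] eta_lim[of x]] eta_pos[of x] by simp

lemma sample_pmf_alt: "sample_pmf (Ns k) P = Pi_pmf (SIGMA x:UNIV. {..<Ns k x}) None (\<lambda>(x, j). act_pmf (P x))"
proof -
  have "{(x, j). j < Ns k x} = (SIGMA x:UNIV. {..<Ns k x})" by auto
  then show ?thesis by (simp add: sample_pmf_def)
qed

lemma pmf_act: "pmf (act_pmf (P x)) a = P x $ a"
  unfolding act_pmf_def
proof (rule pmf_embed_pmf)
  show "0 \<le> P x $ a" for a using P[of x] by (simp add: prob_simplex_def)
  show "(\<integral>\<^sup>+a. ennreal (P x $ a) \<partial>count_space UNIV) = 1"
    using P[of x] by (simp add: nn_integral_count_space_finite prob_simplex_def)
qed

lemma expectation_act: "(\<integral>a. F a \<partial>measure_pmf (act_pmf (P x))) = (\<Sum>a\<in>UNIV. P x $ a *\<^sub>R F a)"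
  for F :: "'d option \<Rightarrow> 'b::{banach,second_countable_topology}"
  by (subst integral_measure_pmf[of UNIV]) (auto simp: pmf_act)

lemma scaled_sum_Sigma:
  "scaled_sum Ns \<xi> k \<omega> = (\<Sum>(x, j)\<in>(SIGMA x:UNIV. {..<Ns k x}). (sqrt (real (\<Sum>y\<in>UNIV. Ns k y)) / real (Ns k x)) *\<^sub>R \<xi> x (\<omega> (x, j)))"
  unfolding scaled_sum_def by (subst sum.Sigma[symmetric]) (auto simp: scaleR_sum_right)

text \<open>Independence splits the characteristic function into one power per state, and
  \<open>char_power_limit\<close> applies to each with v = 1 / \<eta> x.\<close>

lemma char_scaled_sum:
  fixes \<xi> :: "'x \<Rightarrow> 'd option \<Rightarrow> 'e::euclidean_space"
  assumes mean: "\<And>x. (\<Sum>a\<in>UNIV. P x $ a *\<^sub>R \<xi> x a) = 0"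
  shows "(\<lambda>k. \<integral>\<omega>. cis (b \<bullet> scaled_sum Ns \<xi> k \<omega>) \<partial>measure_pmf (sample_pmf (Ns k) P)) \<longlonglongrightarrow>
     complex_of_real (exp (- (\<Sum>x\<in>UNIV. (1 / \<eta> x) * (\<Sum>a\<in>UNIV. P x $ a * (b \<bullet> \<xi> x a)\<^sup>2)) / 2))"
proof -
  define s where "s k x = sqrt (real (\<Sum>y\<in>UNIV. Ns k y)) / real (Ns k x)" for k x
  have "(\<integral>\<omega>. cis (b \<bullet> scaled_sum Ns \<xi> k \<omega>) \<partial>measure_pmf (sample_pmf (Ns k) P)) =
     (\<Prod>x\<in>UNIV. (\<Sum>a\<in>UNIV. complex_of_real (P x $ a) * cis (s k x * (b \<bullet> \<xi> x a))) ^ Ns k x)" for k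
  proof -
    let ?I = "SIGMA x:UNIV. {..<Ns k x}"
    have "cis (b \<bullet> scaled_sum Ns \<xi> k \<omega>) = (\<Prod>i\<in>?I. cis (s k (fst i) * (b \<bullet> \<xi> (fst i) (\<omega> i))))" for \<omega>
    proof -
      have "b \<bullet> scaled_sum Ns \<xi> k \<omega> = (\<Sum>i\<in>?I. s k (fst i) * (b \<bullet> \<xi> (fst i) (\<omega> i)))"
        by (simp add: scaled_sum_Sigma inner_sum_right s_def case_prod_unfold)
      moreover have "cis (\<Sum>i\<in>J. g i) = (\<Prod>i\<in>J. cis (g i))" if "finite J" for J and g :: "'x \<times> nat \<Rightarrow> real"
        using that by (induction J rule: finite_induct) (auto simp: cis_mult[symmetric])
      ultimately show ?thesis by simp
    qed
    then have "(\<integral>\<omega>. cis (b \<bullet> scaled_sum Ns \<xi> k \<omega>) \<partial>measure_pmf (sample_pmf (Ns k) P)) =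
        (\<Prod>i\<in>?I. \<integral>a. cis (s k (fst i) * (b \<bullet> \<xi> (fst i) a)) \<partial>measure_pmf ((\<lambda>(x, j). act_pmf (P x)) i))"
      unfolding sample_pmf_alt by (simp only:) (rule expectation_prod_Pi_pmf_finite, simp)
    also have "\<dots> = (\<Prod>i\<in>?I. (\<Sum>a\<in>UNIV. complex_of_real (P (fst i) $ a) * cis (s k (fst i) * (b \<bullet> \<xi> (fst i) a))))"
      by (intro prod.cong refl) (auto simp: expectation_act scaleR_conv_of_real)
    also have "\<dots> = (\<Prod>x\<in>UNIV. \<Prod>j<Ns k x. (\<Sum>a\<in>UNIV. complex_of_real (P x $ a) * cis (s k x * (b \<bullet> \<xi> x a))))"
      by (subst prod.Sigma) (auto simp: case_prod_unfold)
    finally show ?thesis by simp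
  qed
  moreover have "(\<lambda>k. \<Prod>x\<in>UNIV. (\<Sum>a\<in>UNIV. complex_of_real (P x $ a) * cis (s k x * (b \<bullet> \<xi> x a))) ^ Ns k x) \<longlonglongrightarrow>
      (\<Prod>x\<in>UNIV. complex_of_real (exp (- ((1 / \<eta> x) * (\<Sum>a\<in>UNIV. P x $ a * (b \<bullet> \<xi> x a)\<^sup>2)) / 2)))"
  proof (rule tendsto_prod, rule char_power_limit)
    fix x
    show "0 \<le> P x $ a" "(\<Sum>a\<in>UNIV. P x $ a) = 1" for a
      using P[of x] by (auto simp: prob_simplex_def)
    have "(\<Sum>a\<in>UNIV. P x $ a * (b \<bullet> \<xi> x a)) = b \<bullet> (\<Sum>a\<in>UNIV. P x $ a *\<^sub>R \<xi> x a)"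
      by (simp add: inner_sum_right)
    then show "(\<Sum>a\<in>UNIV. P x $ a * (b \<bullet> \<xi> x a)) = 0" by (simp add: mean)
    show "filterlim (\<lambda>k. Ns k x) at_top sequentially" by (rule Ns_at_top)
    have "real (Ns k x) * (s k x)\<^sup>2 = real (\<Sum>y\<in>UNIV. Ns k y) / real (Ns k x)" for k
      by (simp add: s_def power_divide power2_eq_square del: of_nat_sum)
    then show "(\<lambda>k. real (Ns k x) * (s k x)\<^sup>2) \<longlonglongrightarrow> 1 / \<eta> x"
      using ratio_lim by simp
  qed
  ultimately show ?thesis
    by (simp add: exp_sum[symmetric] sum_negf sum_divide_distrib flip: of_real_prod)
qed

lemma expectation_norm_scaled_sum:
  fixes \<xi> :: "'x \<Rightarrow> 'd option \<Rightarrow> 'e::euclidean_space"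
  assumes mean: "\<And>x. (\<Sum>a\<in>UNIV. P x $ a *\<^sub>R \<xi> x a) = 0"
  shows "(\<integral>\<omega>. (norm (scaled_sum Ns \<xi> k \<omega>))\<^sup>2 \<partial>measure_pmf (sample_pmf (Ns k) P)) =
     (\<Sum>x\<in>UNIV. real (\<Sum>y\<in>UNIV. Ns k y) / real (Ns k x) * (\<Sum>a\<in>UNIV. P x $ a * (norm (\<xi> x a))\<^sup>2))"
proof -
  let ?I = "SIGMA x:UNIV. {..<Ns k x}"
  define s where "s x = sqrt (real (\<Sum>y\<in>UNIV. Ns k y)) / real (Ns k x)" for x
  have norm2: "(norm v)\<^sup>2 = (\<Sum>b\<in>Basis. (v \<bullet> b)\<^sup>2)" for v :: 'e
    unfolding power2_norm_eq_inner by (subst euclidean_inner) (simp add: power2_eq_square)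
  have inner: "scaled_sum Ns \<xi> k \<omega> \<bullet> b = (\<Sum>i\<in>?I. s (fst i) * (\<xi> (fst i) (\<omega> i) \<bullet> b))" for \<omega> b
    by (simp add: scaled_sum_Sigma inner_sum_left s_def case_prod_unfold)
  have int: "integrable (measure_pmf (sample_pmf (Ns k) P)) (\<lambda>\<omega>. (scaled_sum Ns \<xi> k \<omega> \<bullet> b)\<^sup>2)" for b
  proof (rule measure_pmf.integrable_const_bound)
    have "\<bar>scaled_sum Ns \<xi> k \<omega> \<bullet> b\<bar> \<le> (\<Sum>i\<in>?I. Max (range (\<lambda>a. \<bar>s (fst i) * (\<xi> (fst i) a \<bullet> b)\<bar>)))" for \<omega>
      unfolding inner by (intro order_trans[OF sum_abs] sum_mono Max_ge) auto
    then show "AE \<omega> in measure_pmf (sample_pmf (Ns k) P). norm ((scaled_sum Ns \<xi> k \<omega> \<bullet> b)\<^sup>2) \<le>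
        (\<Sum>i\<in>?I. Max (range (\<lambda>a. \<bar>s (fst i) * (\<xi> (fst i) a \<bullet> b)\<bar>)))\<^sup>2"
      by (simp add: abs_le_square_iff[symmetric] order_trans[OF _ abs_ge_self])
  qed auto
  have "(\<integral>\<omega>. (scaled_sum Ns \<xi> k \<omega> \<bullet> b)\<^sup>2 \<partial>measure_pmf (sample_pmf (Ns k) P)) =
     (\<Sum>x\<in>UNIV. real (\<Sum>y\<in>UNIV. Ns k y) / real (Ns k x) * (\<Sum>a\<in>UNIV. P x $ a * (\<xi> x a \<bullet> b)\<^sup>2))" for b
  proof -
    have "(\<integral>a. s (fst i) * (\<xi> (fst i) a \<bullet> b) \<partial>measure_pmf ((\<lambda>(x, j). act_pmf (P x)) i)) = 0" for i
    proof -
      have "(\<Sum>a\<in>UNIV. P x $ a * (\<xi> x a \<bullet> b)) = (\<Sum>a\<in>UNIV. P x $ a *\<^sub>R \<xi> x a) \<bullet> b" for x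
        by (simp add: inner_sum_left)
      then have "(\<Sum>a\<in>UNIV. P x $ a * (\<xi> x a \<bullet> b)) = 0" for x by (simp add: mean)
      then have "(\<Sum>a\<in>UNIV. P x $ a * (s x * (\<xi> x a \<bullet> b))) = 0" for x
        by (simp add: mult.left_commute[of _ "s x"] sum_distrib_left[symmetric])
      then show ?thesis by (simp only: case_prod_unfold expectation_act real_scaleR_def)
    qed
    then have "(\<integral>\<omega>. (scaled_sum Ns \<xi> k \<omega> \<bullet> b)\<^sup>2 \<partial>measure_pmf (sample_pmf (Ns k) P)) =
       (\<Sum>i\<in>?I. \<integral>a. (s (fst i) * (\<xi> (fst i) a \<bullet> b))\<^sup>2 \<partial>measure_pmf ((\<lambda>(x, j). act_pmf (P x)) i))"
      unfolding inner sample_pmf_alt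
      by (rule expectation_square_sum_Pi_pmf[where F="\<lambda>i a. s (fst i) * (\<xi> (fst i) a \<bullet> b)", rotated]) auto
    also have "\<dots> = (\<Sum>x\<in>UNIV. \<Sum>j<Ns k x. \<Sum>a\<in>UNIV. P x $ a * (s x * (\<xi> x a \<bullet> b))\<^sup>2)"
      by (subst sum.Sigma) (auto simp: case_prod_unfold expectation_act)
    also have "\<dots> = (\<Sum>x\<in>UNIV. (real (Ns k x) * (s x)\<^sup>2) * (\<Sum>a\<in>UNIV. P x $ a * (\<xi> x a \<bullet> b)\<^sup>2))"
      by (simp add: power_mult_distrib sum_distrib_left mult_ac)
    also have "\<dots> = (\<Sum>x\<in>UNIV. real (\<Sum>y\<in>UNIV. Ns k y) / real (Ns k x) * (\<Sum>a\<in>UNIV. P x $ a * (\<xi> x a \<bullet> b)\<^sup>2))"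
    proof (rule sum.cong[OF refl])
      fix x
      have "real (Ns k x) * (s x)\<^sup>2 = real (\<Sum>y\<in>UNIV. Ns k y) / real (Ns k x)"
        by (simp add: s_def power_divide power2_eq_square del: of_nat_sum)
      then show "(real (Ns k x) * (s x)\<^sup>2) * (\<Sum>a\<in>UNIV. P x $ a * (\<xi> x a \<bullet> b)\<^sup>2) =
        real (\<Sum>y\<in>UNIV. Ns k y) / real (Ns k x) * (\<Sum>a\<in>UNIV. P x $ a * (\<xi> x a \<bullet> b)\<^sup>2)" by simp
    qed
    finally show ?thesis .
  qed
  then have "(\<integral>\<omega>. (norm (scaled_sum Ns \<xi> k \<omega>))\<^sup>2 \<partial>measure_pmf (sample_pmf (Ns k) P)) =
     (\<Sum>b\<in>Basis. \<Sum>x\<in>UNIV. real (\<Sum>y\<in>UNIV. Ns k y) / real (Ns k x) * (\<Sum>a\<in>UNIV. P x $ a * (\<xi> x a \<bullet> b)\<^sup>2))"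
    by (simp add: norm2 int del: of_nat_sum)
  also have "\<dots> = (\<Sum>x\<in>UNIV. \<Sum>b\<in>Basis. real (\<Sum>y\<in>UNIV. Ns k y) / real (Ns k x) * (\<Sum>a\<in>UNIV. P x $ a * (\<xi> x a \<bullet> b)\<^sup>2))"
    by (rule sum.swap)
  also have "\<dots> = (\<Sum>x\<in>UNIV. real (\<Sum>y\<in>UNIV. Ns k y) / real (Ns k x) * (\<Sum>a\<in>UNIV. P x $ a * (norm (\<xi> x a))\<^sup>2))"
  proof (rule sum.cong[OF refl])
    fix x
    have "(\<Sum>b\<in>Basis. \<Sum>a\<in>UNIV. P x $ a * (\<xi> x a \<bullet> b)\<^sup>2) = (\<Sum>a\<in>UNIV. P x $ a * (norm (\<xi> x a))\<^sup>2)"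
      by (subst sum.swap) (simp add: norm2 sum_distrib_left)
    then show "(\<Sum>b\<in>Basis. real (\<Sum>y\<in>UNIV. Ns k y) / real (Ns k x) * (\<Sum>a\<in>UNIV. P x $ a * (\<xi> x a \<bullet> b)\<^sup>2)) =
       real (\<Sum>y\<in>UNIV. Ns k y) / real (Ns k x) * (\<Sum>a\<in>UNIV. P x $ a * (norm (\<xi> x a))\<^sup>2)"
      by (simp only: sum_distrib_left[symmetric])
  qed
  finally show ?thesis .
qed

text \<open>Chebyshev: by independence and centring, the second moment of the scaled sum converges
  along with the ratios N / N(x).\<close>

lemma tight_scaled_sum:
  fixes \<xi> :: "'x \<Rightarrow> 'd option \<Rightarrow> 'e::euclidean_space"
  assumes mean: "\<And>x. (\<Sum>a\<in>UNIV. P x $ a *\<^sub>R \<xi> x a) = 0" and e: "0 < e"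
  shows "\<exists>R>0. \<forall>\<^sub>F k in sequentially. measure_pmf.prob (sample_pmf (Ns k) P) {\<omega>. R < norm (scaled_sum Ns \<xi> k \<omega>)} \<le> e"
proof -
  let ?m = "\<lambda>k. \<Sum>x\<in>UNIV. real (\<Sum>y\<in>UNIV. Ns k y) / real (Ns k x) * (\<Sum>a\<in>UNIV. P x $ a * (norm (\<xi> x a))\<^sup>2)"
  \<comment> \<open>The summand 1 makes \<open>m\<close> positive and strictly larger than the
    limit, hence an eventual bound of the second moments.\<close>
  define m where "m = (\<Sum>x\<in>UNIV. 1 / \<eta> x * (\<Sum>a\<in>UNIV. P x $ a * (norm (\<xi> x a))\<^sup>2)) + 1"
  have m: "0 < m"
    unfolding m_def using P eta_pos
    by (intro add_nonneg_pos sum_nonneg mult_nonneg_nonneg) (auto simp: prob_simplex_def less_imp_le)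
  have "?m \<longlonglongrightarrow> (\<Sum>x\<in>UNIV. 1 / \<eta> x * (\<Sum>a\<in>UNIV. P x $ a * (norm (\<xi> x a))\<^sup>2))"
    by (intro tendsto_intros ratio_lim)
  then have ev: "\<forall>\<^sub>F k in sequentially. ?m k < m"
    by (rule order_tendstoD) (simp add: m_def)
  define R where "R = sqrt (m / e)"
  have R: "0 < R" "R\<^sup>2 = m / e" using m e by (auto simp: R_def)
  from ev have "\<forall>\<^sub>F k in sequentially. measure_pmf.prob (sample_pmf (Ns k) P) {\<omega>. R < norm (scaled_sum Ns \<xi> k \<omega>)} \<le> e"
  proof eventually_elim
    case (elim k)
    have bound: "norm (scaled_sum Ns \<xi> k \<omega>) \<le> (\<Sum>(x, j)\<in>(SIGMA x:UNIV. {..<Ns k x}). Max (range (\<lambda>a. norm ((sqrt (real (\<Sum>y\<in>UNIV. Ns k y)) / real (Ns k x)) *\<^sub>R \<xi> x a))))" for \<omega>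
      unfolding scaled_sum_Sigma by (intro order_trans[OF norm_sum] sum_mono) (auto intro!: Max_ge)
    have int: "integrable (measure_pmf (sample_pmf (Ns k) P)) (\<lambda>\<omega>. (norm (scaled_sum Ns \<xi> k \<omega>))\<^sup>2)"
    proof (rule measure_pmf.integrable_const_bound[OF AE_I2])
      fix \<omega>
      show "norm ((norm (scaled_sum Ns \<xi> k \<omega>))\<^sup>2) \<le> (\<Sum>(x, j)\<in>(SIGMA x:UNIV. {..<Ns k x}). Max (range (\<lambda>a. norm ((sqrt (real (\<Sum>y\<in>UNIV. Ns k y)) / real (Ns k x)) *\<^sub>R \<xi> x a))))\<^sup>2"
        unfolding real_norm_def abs_power2 by (rule power_mono[OF bound norm_ge_zero])
    qed simp
    have "measure_pmf.prob (sample_pmf (Ns k) P) {\<omega>. R < norm (scaled_sum Ns \<xi> k \<omega>)} \<le>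
       measure_pmf.prob (sample_pmf (Ns k) P) {\<omega>\<in>space (measure_pmf (sample_pmf (Ns k) P)). R\<^sup>2 \<le> (norm (scaled_sum Ns \<xi> k \<omega>))\<^sup>2}"
      using R(1) by (intro measure_pmf.finite_measure_mono) (auto intro: power_mono)
    also have "\<dots> \<le> (\<integral>\<omega>. (norm (scaled_sum Ns \<xi> k \<omega>))\<^sup>2 \<partial>measure_pmf (sample_pmf (Ns k) P)) / R\<^sup>2"
      using R(1) by (intro integral_Markov_inequality_measure[OF int, where A="{}"]) auto
    also have "\<dots> \<le> m / R\<^sup>2"
      using elim unfolding expectation_norm_scaled_sum[OF mean] by (intro divide_right_mono) auto
    also have "\<dots> = e" using m e R by simp
    finally show ?case .
  qed
  then show ?thesis using R(1) by blast
qed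

end

section \<open>The surplus function and the choice probabilities\<close>

lemma integral_translate:
  fixes f :: "'a::euclidean_space \<Rightarrow> 'b::{banach,second_countable_topology}"
  assumes "f \<in> borel_measurable borel"
  shows "(\<integral>y. f (y + c) \<partial>lborel) = (\<integral>y. f y \<partial>lborel)"
proof -
  have "(\<integral>y. f y \<partial>lborel) = (\<integral>y. f y \<partial>distr lborel borel ((+) c))"
    by (simp add: lborel_distr_plus)
  also have "\<dots> = (\<integral>y. f (c + y) \<partial>lborel)"
    using assms by (intro integral_distr) auto
  finally show ?thesis by (simp add: add.commute)
qed

lemma integrable_translate:
  fixes f :: "'a::euclidean_space \<Rightarrow> 'b::{banach,second_countable_topology}"
  assumes "integrable lborel f"
  shows "integrable lborel (\<lambda>y. f (y + c))"
proof -
  have "integrable (distr lborel borel ((+) c)) f"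
    using assms by (simp add: lborel_distr_plus)
  then have "integrable lborel (\<lambda>y. f (c + y))"
    using assms by (subst (asm) integrable_distr_eq) auto
  then show ?thesis by (simp add: add.commute)
qed

lemma nn_integral_translate:
  fixes f :: "'a::euclidean_space \<Rightarrow> ennreal"
  assumes "f \<in> borel_measurable borel"
  shows "(\<integral>\<^sup>+y. f (y + c) \<partial>lborel) = (\<integral>\<^sup>+y. f y \<partial>lborel)"
proof -
  have "(\<integral>\<^sup>+y. f y \<partial>lborel) = (\<integral>\<^sup>+y. f y \<partial>distr lborel borel ((+) c))"
    by (simp add: lborel_distr_plus)
  also have "\<dots> = (\<integral>\<^sup>+y. f (c + y) \<partial>lborel)"
    using assms by (intro nn_integral_distr) auto
  finally show ?thesis by (simp add: add.commute)
qed

lemma AE_translate: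
  fixes N :: "'a::euclidean_space set"
  assumes "negligible N" "N \<in> sets borel"
  shows "AE e in lborel. e + c \<notin> N"
proof -
  have "emeasure lborel N = 0"
    using assms null_sets_completion_iff[of N lborel] by (auto simp: negligible_iff_null_sets)
  then have "(\<integral>\<^sup>+y. indicator N y \<partial>lborel) = 0"
    using assms by simp
  then have "(\<integral>\<^sup>+y. indicator N (y + c) \<partial>lborel) = 0"
    using assms nn_integral_translate[of "indicator N" c] by simp
  then have "AE y in lborel. (indicator N (y + c) :: ennreal) = 0"
    using assms by (subst (asm) nn_integral_0_iff_AE) auto
  then show ?thesis
    by eventually_elim (auto simp: indicator_def split: if_splits)
qed

section \<open>Maximum, maximisers and ties\<close>

definition vmax :: "real^'n::finite \<Rightarrow> real" where
  "vmax e = Max (range (\<lambda>a. e $ a))"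

definition argmax :: "'n::finite \<Rightarrow> (real^'n) set" where
  "argmax a = {y. \<forall>b. y $ b \<le> y $ a}"

text \<open>All coincidences of coordinates count, also those below the maximum. The set is still
  closed and null, and off it the maximiser is unique and locally constant.\<close>

definition ties :: "(real^'n::finite) set" where
  "ties = {y. \<exists>a b. a \<noteq> b \<and> y $ a = y $ b}"

lemma vmax_ge: "e $ a \<le> vmax e"
  unfolding vmax_def by (rule Max_ge) auto

lemma vmax_le: "(\<And>a. e $ a \<le> M) \<Longrightarrow> vmax e \<le> M"
  unfolding vmax_def by (subst Max_le_iff) auto

lemma vmax_argmax: "e \<in> argmax a \<Longrightarrow> vmax e = e $ a"
  by (intro antisym vmax_le vmax_ge) (auto simp: argmax_def)

lemma vmax_attained: "\<exists>a. e \<in> argmax a"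
proof -
  have "vmax e \<in> range (\<lambda>a. e $ a)"
    unfolding vmax_def by (rule Max_in) auto
  then obtain a where "vmax e = e $ a" by auto
  then have "e \<in> argmax a"
    using vmax_ge[of e] by (auto simp: argmax_def)
  then show ?thesis by blast
qed

lemma vmax_diff_le: "\<bar>vmax (e + h) - vmax e\<bar> \<le> norm h"
proof -
  have "vmax (e + h) \<le> vmax e + norm h"
  proof (rule vmax_le)
    fix a show "(e + h) $ a \<le> vmax e + norm h"
      using vmax_ge[of e a] component_le_norm_cart[of h a] by simp
  qed
  moreover have "vmax e \<le> vmax (e + h) + norm h"
  proof (rule vmax_le)
    fix a show "e $ a \<le> vmax (e + h) + norm h"
      using vmax_ge[of "e + h" a] component_le_norm_cart[of h a] by simp
  qed
  ultimately show ?thesis by linarith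
qed

lemma abs_vmax_le: "\<bar>vmax e\<bar> \<le> norm (e :: real^'n::finite)"
proof -
  have "vmax (0 :: real^'n) = 0" by (simp add: vmax_def)
  then show ?thesis using vmax_diff_le[of 0 e] by simp
qed

lemma continuous_on_vmax: "continuous_on S (vmax :: real^'n::finite \<Rightarrow> real)"
  unfolding continuous_on_iff
proof (intro ballI allI impI)
  fix x :: "real^'n" and e :: real assume e: "0 < e"
  show "\<exists>d>0. \<forall>x'\<in>S. dist x' x < d \<longrightarrow> dist (vmax x') (vmax x) < e"
  proof (intro exI[of _ e] conjI e ballI impI)
    fix x' assume "dist x' x < e"
    then show "dist (vmax x') (vmax x) < e"
      using vmax_diff_le[of x "x' - x"] by (simp add: dist_norm)
  qed
qed

lemma borel_measurable_vmax [measurable]: "vmax \<in> borel_measurable borel"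
  by (intro borel_measurable_continuous_onI continuous_on_vmax)

lemma closed_argmax: "closed (argmax a)"
  unfolding argmax_def by (intro closed_Collect_all closed_Collect_le continuous_intros)

lemma borel_argmax [measurable]: "argmax a \<in> sets borel"
  by (intro borel_closed closed_argmax)

lemma closed_ties: "closed (ties :: (real^'n::finite) set)"
proof -
  have "ties = (\<Union>a. \<Union>b\<in>-{a}. {y :: real^'n. y $ a = y $ b})"
    unfolding ties_def by fastforce
  also have "closed \<dots>"
    by (intro closed_UN ballI closed_Collect_eq continuous_intros) auto
  finally show ?thesis .
qed

lemma negligible_ties: "negligible (ties :: (real^'n::finite) set)"
proof -
  have "ties = (\<Union>(a, b)\<in>{(a, b). a \<noteq> b}. {y :: real^'n. (axis a 1 - axis b 1) \<bullet> y = 0})"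
    by (auto simp: ties_def inner_diff_left inner_axis')
  also have "negligible \<dots>"
  proof (rule negligible_Union, simp, clarify)
    fix a b :: 'n assume "a \<noteq> b"
    then have "axis a (1::real) - axis b 1 \<noteq> 0"
      by (simp add: axis_eq_axis)
    then show "negligible {y :: real^'n. (axis a 1 - axis b 1) \<bullet> y = 0}"
      by (intro negligible_hyperplane) auto
  qed
  finally show ?thesis .
qed

lemma AE_not_ties: "AE e in lborel. e + c \<notin> (ties :: (real^'n::finite) set)"
  by (intro AE_translate negligible_ties borel_closed closed_ties)

lemma argmax_unique: "y \<notin> ties \<Longrightarrow> y \<in> argmax a \<Longrightarrow> y \<in> argmax b \<longleftrightarrow> a = b"
  unfolding ties_def argmax_def mem_Collect_eq by (metis antisym)

lemma argmax_indicator: "y \<notin> ties \<Longrightarrow> y \<in> argmax a \<Longrightarrow> indicator (argmax b) y = (if a = b then 1 else 0 :: real)"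
  using argmax_unique by (auto simp: indicator_def)

lemma eventually_argmax:
  assumes "y \<notin> ties" "y \<in> argmax a" "X \<longlonglongrightarrow> 0"
  shows "\<forall>\<^sub>F n in sequentially. y + X n \<in> argmax a"
proof -
  have "\<forall>\<^sub>F n in sequentially. (y + X n) $ b \<le> (y + X n) $ a" for b
  proof (cases "b = a")
    case False
    have lim: "(\<lambda>n. (y + X n) $ a - (y + X n) $ b) \<longlonglongrightarrow> (y + 0) $ a - (y + 0) $ b"
      by (intro tendsto_intros assms)
    have "y $ b < y $ a"
      using assms False unfolding ties_def argmax_def by (auto simp: less_le)
    then have "0 < (y + 0) $ a - (y + 0) $ b" by simp
    from order_tendstoD(1)[OF lim this] show ?thesis
      by eventually_elim auto
  qed auto
  then show ?thesis
    unfolding argmax_def by (simp add: eventually_all_finite)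
qed

section \<open>Expected maximum and choice probabilities\<close>

locale shock_density =
  fixes g :: "real^'n::finite \<Rightarrow> real" and g' :: "real^'n \<Rightarrow> real^'n"
  assumes g_pos: "\<And>e. 0 < g e"
    and g_density: "integrable lborel g" "(\<integral>e. g e \<partial>lborel) = 1"
    and g_C1: "\<And>e. (g has_derivative (\<lambda>h. g' e \<bullet> h)) (at e)" "continuous_on UNIV g'"
    and g_moment: "integrable lborel (\<lambda>e. norm e * g e)"
    and g_grad: "integrable lborel (\<lambda>e. norm (g' e))"
begin

lemma continuous_g: "continuous_on S g"
  using g_C1(1) by (meson continuous_at_imp_continuous_on has_derivative_continuous)

lemma borel_g [measurable]: "g \<in> borel_measurable borel"
  by (intro borel_measurable_continuous_onI continuous_g)

lemma borel_g' [measurable]: "g' \<in> borel_measurable borel"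
  by (intro borel_measurable_continuous_onI g_C1)

lemma integrable_g': "integrable lborel g'"
  using g_grad by (subst integrable_norm_iff[symmetric]) auto

lemma integrable_bounded_g:
  assumes "\<phi> \<in> borel_measurable borel" "AE e in lborel. \<bar>\<phi> e\<bar> \<le> B"
  shows "integrable lborel (\<lambda>e. \<phi> e * g e)"
proof (rule Bochner_Integration.integrable_bound)
  show "integrable lborel (\<lambda>e. B * g e)" using g_density by simp
  show "AE e in lborel. norm (\<phi> e * g e) \<le> norm (B * g e)"
    using assms(2)
  proof eventually_elim
    case (elim e)
    then have "\<bar>\<phi> e\<bar> * g e \<le> B * g e" using g_pos[of e] by (intro mult_right_mono) auto
    also have "\<dots> \<le> \<bar>B * g e\<bar>" by simp
    finally show ?case using g_pos[of e] by (simp add: abs_mult)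
  qed
qed (use assms in measurable)

declare sum_mult_indicator [simp del] sum_indicator_mult [simp del] sum_indicator_scaleR [simp del]

definition emax :: "real^'n \<Rightarrow> real" where
  "emax c = (\<integral>e. vmax (e + c) * g e \<partial>lborel)"

definition cprob :: "real^'n \<Rightarrow> 'n \<Rightarrow> real" where
  "cprob c a = (\<integral>e. indicator (argmax a) (e + c) * g e \<partial>lborel)"

lemma integrable_indicator_g: "integrable lborel (\<lambda>e. indicator (argmax a) (e + c) * g e)"
  by (rule integrable_bounded_g[where B=1]) (auto simp: indicator_def)

lemma integrable_vmax: "integrable lborel (\<lambda>e. vmax (e + c) * g e)"
proof (rule Bochner_Integration.integrable_bound)
  show "integrable lborel (\<lambda>e. norm e * g e + norm c * g e)"
    using g_density g_moment by simp
  show "AE e in lborel. norm (vmax (e + c) * g e) \<le> norm (norm e * g e + norm c * g e)"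
  proof (rule AE_I2)
    fix e
    have "\<bar>vmax (e + c)\<bar> * g e \<le> (norm e + norm c) * g e"
      using g_pos[of e] abs_vmax_le[of "e + c"] norm_triangle_ineq[of e c]
      by (intro mult_right_mono) auto
    then show "norm (vmax (e + c) * g e) \<le> norm (norm e * g e + norm c * g e)"
      using g_pos[of e] by (simp add: abs_mult distrib_right)
  qed
qed measurable

lemma cprob_sum: "(\<Sum>a\<in>UNIV. cprob c a) = 1"
proof -
  have "(\<Sum>a\<in>UNIV. cprob c a) = (\<integral>e. (\<Sum>a\<in>UNIV. indicator (argmax a) (e + c) * g e) \<partial>lborel)"
    unfolding cprob_def by (simp add: integrable_indicator_g)
  also have "\<dots> = (\<integral>e. g e \<partial>lborel)"
  proof (rule integral_cong_AE)
    show "AE e in lborel. (\<Sum>a\<in>UNIV. indicator (argmax a) (e + c) * g e) = g e"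
      using AE_not_ties[of c]
    proof eventually_elim
      case (elim e)
      obtain a where "e + c \<in> argmax a" using vmax_attained by blast
      then show ?case
        by (simp add: argmax_indicator[OF elim] if_distrib[of "\<lambda>x. x * _"] cong: if_cong)
    qed
  qed measurable
  finally show ?thesis by (simp add: g_density)
qed

lemma cprob_pos: "0 < cprob c a"
proof -
  have nn: "0 \<le> cprob c a"
    unfolding cprob_def using less_imp_le[OF g_pos] by (intro Bochner_Integration.integral_nonneg mult_nonneg_nonneg) auto
  have "cprob c a \<noteq> 0"
  proof
    assume "cprob c a = 0"
    moreover have "AE e in lborel. 0 \<le> indicator (argmax a) (e + c) * g e"
      using less_imp_le[OF g_pos] by (intro AE_I2 mult_nonneg_nonneg) auto
    ultimately have "AE e in lborel. indicator (argmax a) (e + c) * g e = 0"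
      unfolding cprob_def
      by (subst (asm) integral_nonneg_eq_0_iff_AE) (auto simp: integrable_indicator_g)
    then have "AE e in lborel. e + c \<notin> argmax a"
      using g_pos by (elim AE_mp, intro AE_I2) (auto simp: indicator_def less_imp_neq[symmetric])
    then have "{e. e + c \<in> argmax a} \<in> null_sets lborel"
      by (subst AE_iff_null_sets) auto
    then have "negligible {e. e + c \<in> argmax a}"
      unfolding negligible_iff_null_sets by (rule null_sets_completionI)
    \<comment> \<open>On this box coordinate \<open>a\<close> of \<open>e + c\<close> exceeds 2 and
      every other coordinate is below 1, so \<open>a\<close> wins on a set of positive
      measure.\<close>
    moreover have "box (axis a 3 - c - 1) (axis a 3 - c + 1) \<subseteq> {e. e + c \<in> argmax a}"
    proof clarify
      fix e assume e: "e \<in> box (axis a 3 - c - 1) (axis a 3 - c + 1)"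
      have "e $ b + c $ b \<le> e $ a + c $ a" for b
        using e[unfolded mem_box_cart, rule_format, of a] e[unfolded mem_box_cart, rule_format, of b]
        by (cases "b = a") (auto simp: axis_def)
      then show "e + c \<in> argmax a" by (simp add: argmax_def)
    qed
    ultimately have "negligible (box (axis a 3 - c - 1) (axis a 3 - c + 1))"
      by (rule negligible_subset)
    moreover have "axis a 3 - c \<in> box (axis a 3 - c - 1) (axis a 3 - c + 1)"
      by (simp add: mem_box_cart)
    ultimately show False
      using open_not_negligible[OF open_box] by blast
  qed
  then show ?thesis using nn by linarith
qed

text \<open>The Williams-Daly-Zachary identity. Off ties the maximiser is locally constant, so the
  pointwise remainder is eventually exactly 0; since \<open>vmax\<close> is 1-Lipschitz it is
  dominated by \<open>2 * g e\<close>, and dominated convergence finishes.\<close>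

lemma emax_has_derivative: "(emax has_derivative (\<lambda>h. \<Sum>a\<in>UNIV. h $ a * cprob c a)) (at c)"
  unfolding has_derivative_at
proof (intro conjI)
  show "bounded_linear (\<lambda>h. \<Sum>a\<in>UNIV. h $ a * cprob c a)"
    by (intro bounded_linear_sum bounded_linear_mult_left[THEN bounded_linear_compose, of _ "cprob c a" for a] bounded_linear_vec_nth)
  define r where "r h e = (vmax (e + c + h) - vmax (e + c) - (\<Sum>a\<in>UNIV. h $ a * indicator (argmax a) (e + c))) / norm h * g e" for h e
  have r: "(emax (c + h) - emax c - (\<Sum>a\<in>UNIV. h $ a * cprob c a)) / norm h = (\<integral>e. r h e \<partial>lborel)" for h
  proof -
    have i: "integrable lborel (\<lambda>e. vmax (e + c + h) * g e)"
      using integrable_vmax[of "c + h"] by (simp add: add.assoc)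
    have "(\<integral>e. r h e \<partial>lborel) = (\<integral>e. (vmax (e + c + h) * g e - vmax (e + c) * g e - (\<Sum>a\<in>UNIV. h $ a * (indicator (argmax a) (e + c) * g e))) / norm h \<partial>lborel)"
      by (rule Bochner_Integration.integral_cong[OF refl]) (simp add: r_def left_diff_distrib sum_distrib_right mult.assoc)
    also have "\<dots> = ((\<integral>e. vmax (e + c + h) * g e \<partial>lborel) - (\<integral>e. vmax (e + c) * g e \<partial>lborel) - (\<Sum>a\<in>UNIV. h $ a * cprob c a)) / norm h"
      unfolding cprob_def by (simp add: i integrable_vmax integrable_indicator_g)
    finally show ?thesis
      by (simp add: emax_def add.assoc)
  qed
  have "((\<lambda>h. \<integral>e. r h e \<partial>lborel) \<longlongrightarrow> 0) (at 0)"
    unfolding tendsto_at_iff_sequentially comp_def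
  proof (intro allI impI)
    fix X :: "nat \<Rightarrow> real^'n" assume X0: "\<forall>i. X i \<in> UNIV - {0}" and X: "X \<longlonglongrightarrow> 0"
    have "(\<lambda>n. \<integral>e. r (X n) e \<partial>lborel) \<longlonglongrightarrow> (\<integral>e. 0 \<partial>(lborel :: (real^'n) measure))"
    proof (rule integral_dominated_convergence)
      show "integrable lborel (\<lambda>e. 2 * g e)" using g_density by simp
      show "AE e in lborel. (\<lambda>n. r (X n) e) \<longlonglongrightarrow> 0"
        using AE_not_ties[of c]
      proof eventually_elim
        case (elim e)
        obtain a where a: "e + c \<in> argmax a" using vmax_attained by blast
        have "\<forall>\<^sub>F n in sequentially. r (X n) e = 0"
          using eventually_argmax[OF elim a X]
        proof eventually_elim
          case (elim n)
          then show ?case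
            using a \<open>e + c \<notin> ties\<close>
            by (simp add: r_def vmax_argmax argmax_indicator[OF \<open>e + c \<notin> ties\<close> a] if_distrib[of "\<lambda>x. _ * x"] cong: if_cong)
        qed
        then show ?case by (rule tendsto_eventually)
      qed
      show "AE e in lborel. norm (r (X n) e) \<le> 2 * g e" for n
        using AE_not_ties[of c]
      proof eventually_elim
        case (elim e)
        obtain a where a: "e + c \<in> argmax a" using vmax_attained by blast
        have nX: "0 < norm (X n)" using X0 by auto
        have "(\<Sum>a\<in>UNIV. X n $ a * indicator (argmax a) (e + c)) = X n $ a"
          by (simp add: argmax_indicator[OF elim a] if_distrib[of "\<lambda>x. _ * x"] cong: if_cong)
        then have "\<bar>vmax (e + c + X n) - vmax (e + c) - (\<Sum>a\<in>UNIV. X n $ a * indicator (argmax a) (e + c))\<bar> \<le> 2 * norm (X n)"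
          using vmax_diff_le[of "e + c" "X n"] component_le_norm_cart[of "X n" a] by linarith
        then have "\<bar>(vmax (e + c + X n) - vmax (e + c) - (\<Sum>a\<in>UNIV. X n $ a * indicator (argmax a) (e + c))) / norm (X n)\<bar> \<le> 2"
          using nX by (simp add: abs_divide divide_le_eq)
        then have "\<bar>(vmax (e + c + X n) - vmax (e + c) - (\<Sum>a\<in>UNIV. X n $ a * indicator (argmax a) (e + c))) / norm (X n)\<bar> * g e \<le> 2 * g e"
          using g_pos[of e] by (intro mult_right_mono) auto
        then show ?case
          using g_pos[of e] by (simp add: r_def abs_mult)
      qed
    qed (auto simp: r_def)
    then show "(\<lambda>n. \<integral>e. r (X n) e \<partial>lborel) \<longlonglongrightarrow> 0" by simp
  qed
  then have "((\<lambda>h. (emax (c + h) - emax c - (\<Sum>a\<in>UNIV. h $ a * cprob c a)) / norm h) \<longlongrightarrow> 0) (at 0)"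
    by (simp add: r)
  then show "(\<lambda>h. norm (emax (c + h) - emax c - (\<Sum>a\<in>UNIV. h $ a * cprob c a)) / norm h) \<midarrow>0\<rightarrow> 0"
    by (drule_tac tendsto_norm) (simp add: norm_divide)
qed

section \<open>Differentiability of translates of the density in L^1\<close>

definition omega :: "real^'n \<Rightarrow> ennreal" where
  "omega h = (\<integral>\<^sup>+y. norm (g' (y - h) - g' y) \<partial>lborel)"

text \<open>Continuity of translation in L^1 for the gradient: pointwise convergence comes from
  continuity, the norms agree by translation invariance, and Scheffe's lemma combines the
  two.\<close>

lemma omega_tendsto: "(omega \<longlongrightarrow> 0) (at 0)"
  unfolding tendsto_at_iff_sequentially comp_def
proof (intro allI impI)
  fix X :: "nat \<Rightarrow> real^'n" assume X: "X \<longlonglongrightarrow> 0"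
  show "(\<lambda>n. omega (X n)) \<longlonglongrightarrow> 0"
    unfolding omega_def
  proof (rule Scheffe_lemma2)
    show "integrable lborel g'" by (rule integrable_g')
    show "AE y in lborel. (\<lambda>n. g' (y - X n)) \<longlonglongrightarrow> g' y"
    proof (rule AE_I2)
      fix y
      have "isCont g' y" using g_C1(2) by (simp add: continuous_on_eq_continuous_at)
      moreover have "(\<lambda>n. y - X n) \<longlonglongrightarrow> y - 0" by (intro tendsto_intros X)
      ultimately show "(\<lambda>n. g' (y - X n)) \<longlonglongrightarrow> g' y"
        by (metis diff_zero isCont_tendsto_compose)
    qed
    show "(\<integral>\<^sup>+y. norm (g' (y - X n)) \<partial>lborel) \<le> (\<integral>\<^sup>+y. norm (g' y) \<partial>lborel)" for n
      using nn_integral_translate[of "\<lambda>y. ennreal (norm (g' y))" "- X n"] by simp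
  qed measurable
qed

lemma taylor_bound:
  "ennreal \<bar>g (z - h) - g z + g' z \<bullet> h\<bar> \<le> norm h * (\<integral>\<^sup>+s. norm (g' (z - s *\<^sub>R h) - g' z) * indicator {0..1} s \<partial>lborel)"
proof -
  let ?d = "\<lambda>s. - ((g' (z - s *\<^sub>R h) - g' z) \<bullet> h)"
  have cont: "continuous_on {0..1} (\<lambda>s. g' (z - s *\<^sub>R h))"
    by (rule continuous_on_compose2[OF g_C1(2)]) (auto intro!: continuous_intros)
  have "has_bochner_integral lborel (\<lambda>s. indicator {0..1} s *\<^sub>R ?d s) ((g (z - 1 *\<^sub>R h) + 1 * (g' z \<bullet> h)) - (g (z - 0 *\<^sub>R h) + 0 * (g' z \<bullet> h)))"
  proof (rule has_bochner_integral_FTC_Icc[of 0 1 "\<lambda>s. g (z - s *\<^sub>R h) + s * (g' z \<bullet> h)"])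
    show "((\<lambda>s. g (z - s *\<^sub>R h) + s * (g' z \<bullet> h)) has_vector_derivative ?d s) (at s within {0..1})" for s
    proof -
      have "((\<lambda>s. g (z - s *\<^sub>R h)) has_derivative (\<lambda>t. g' (z - s *\<^sub>R h) \<bullet> (0 - t *\<^sub>R h))) (at s within {0..1})"
        by (rule has_derivative_compose[OF _ g_C1(1)]) (auto intro!: derivative_eq_intros)
      then have "((\<lambda>s. g (z - s *\<^sub>R h) + s * (g' z \<bullet> h)) has_derivative (\<lambda>t. g' (z - s *\<^sub>R h) \<bullet> (0 - t *\<^sub>R h) + t * (g' z \<bullet> h))) (at s within {0..1})"
        by (auto intro!: derivative_eq_intros)
      then show ?thesis
        unfolding has_vector_derivative_def
        by (rule has_derivative_eq_rhs) (auto simp: fun_eq_iff inner_diff_left algebra_simps)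
    qed
    show "continuous_on {0..1} ?d"
      by (intro continuous_intros cont)
  qed auto
  then have int: "integrable lborel (\<lambda>s. indicator {0..1} s *\<^sub>R ?d s)"
    and eq: "g (z - h) - g z + g' z \<bullet> h = (\<integral>s. indicator {0..1} s *\<^sub>R ?d s \<partial>lborel)"
    by (auto simp: has_bochner_integral_iff)
  have "ennreal \<bar>g (z - h) - g z + g' z \<bullet> h\<bar> \<le> (\<integral>\<^sup>+s. norm (indicator {0..1} s *\<^sub>R ?d s) \<partial>lborel)"
    unfolding eq using integral_norm_bound_ennreal[OF int] by simp
  also have "\<dots> \<le> (\<integral>\<^sup>+s. norm h * (norm (g' (z - s *\<^sub>R h) - g' z) * indicator {0..1} s) \<partial>lborel)"
  proof (rule nn_integral_mono)
    fix s
    have "\<bar>?d s\<bar> \<le> norm h * norm (g' (z - s *\<^sub>R h) - g' z)"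
      using Cauchy_Schwarz_ineq2[of "g' (z - s *\<^sub>R h) - g' z" h] by (simp add: mult.commute)
    then show "ennreal (norm (indicator {0..1} s *\<^sub>R ?d s)) \<le> norm h * (norm (g' (z - s *\<^sub>R h) - g' z) * indicator {0..1} s)"
      by (auto simp: indicator_def ennreal_mult[symmetric] intro!: ennreal_leI)
  qed
  also have "\<dots> = norm h * (\<integral>\<^sup>+s. norm (g' (z - s *\<^sub>R h) - g' z) * indicator {0..1} s \<partial>lborel)"
    by (subst nn_integral_cmult[symmetric]) (auto simp: ennreal_mult)
  finally show ?thesis .
qed

text \<open>\<open>taylor_bound\<close> expresses the remainder through increments of the gradient
  along the segment from z to z - h; after integration in z and Tonelli only an average of
  \<open>omega (s *\<^sub>R h)\<close> over s in [0, 1] remains.\<close>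

lemma L1_derivative_bound:
  assumes "0 < \<epsilon>"
  shows "\<exists>d>0. \<forall>h. norm h < d \<longrightarrow> (\<integral>\<^sup>+z. \<bar>g (z - h) - g z + g' z \<bullet> h\<bar> \<partial>lborel) \<le> ennreal (\<epsilon> * norm h)"
proof -
  have "\<forall>\<^sub>F h in at 0. omega h < ennreal \<epsilon>"
    using omega_tendsto by (rule order_tendstoD) (simp add: assms)
  then obtain d where d: "0 < d" "\<And>h. h \<noteq> 0 \<Longrightarrow> norm h < d \<Longrightarrow> omega h < ennreal \<epsilon>"
    by (auto simp: eventually_at)
  have om0: "omega h \<le> ennreal \<epsilon>" if "norm h < d" for h
    using d(2)[OF _ that] by (cases "h = 0") (auto simp: omega_def less_imp_le)
  show ?thesis
  proof (intro exI[of _ d] conjI d(1) allI impI)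
    fix h :: "real^'n" assume h: "norm h < d"
    have [measurable]: "(\<lambda>(z, s). norm (g' (z - s *\<^sub>R h) - g' z)) \<in> borel_measurable (borel \<Otimes>\<^sub>M borel)"
      by measurable
    have "(\<integral>\<^sup>+z. \<bar>g (z - h) - g z + g' z \<bullet> h\<bar> \<partial>lborel)
        \<le> (\<integral>\<^sup>+z. norm h * (\<integral>\<^sup>+s. norm (g' (z - s *\<^sub>R h) - g' z) * indicator {0..1} s \<partial>lborel) \<partial>lborel)"
      by (intro nn_integral_mono taylor_bound)
    also have "\<dots> = norm h * (\<integral>\<^sup>+z. (\<integral>\<^sup>+s. norm (g' (z - s *\<^sub>R h) - g' z) * indicator {0..1} s \<partial>lborel) \<partial>lborel)"
      by (rule nn_integral_cmult) measurable
    also have "(\<integral>\<^sup>+z. (\<integral>\<^sup>+s. norm (g' (z - s *\<^sub>R h) - g' z) * indicator {0..1} s \<partial>lborel) \<partial>lborel)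
       = (\<integral>\<^sup>+s. (\<integral>\<^sup>+z. norm (g' (z - s *\<^sub>R h) - g' z) * indicator {0..1} s \<partial>lborel) \<partial>lborel)"
      by (rule lborel_pair.Fubini'[symmetric]) measurable
    also have "\<dots> \<le> (\<integral>\<^sup>+s. ennreal \<epsilon> * indicator {0..1} s \<partial>(lborel :: real measure))"
    proof (rule nn_integral_mono)
      fix s :: real
      show "(\<integral>\<^sup>+z. norm (g' (z - s *\<^sub>R h) - g' z) * indicator {0..1} s \<partial>lborel) \<le> ennreal \<epsilon> * indicator {0..1} s"
      proof (cases "s \<in> {0..1}")
        case True
        then have "norm (s *\<^sub>R h) \<le> norm h" by (simp add: mult_left_le_one_le)
        then have "omega (s *\<^sub>R h) \<le> ennreal \<epsilon>" using h by (intro om0) simp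
        then show ?thesis using True by (simp add: omega_def)
      qed simp
    qed
    also have "\<dots> = ennreal \<epsilon>"
      by (subst nn_integral_cmult_indicator) auto
    finally have "(\<integral>\<^sup>+z. \<bar>g (z - h) - g z + g' z \<bullet> h\<bar> \<partial>lborel) \<le> norm h * ennreal \<epsilon>"
      by (simp add: mult_left_mono)
    then show "(\<integral>\<^sup>+z. \<bar>g (z - h) - g z + g' z \<bullet> h\<bar> \<partial>lborel) \<le> ennreal (\<epsilon> * norm h)"
      using assms by (simp add: ennreal_mult[symmetric] mult.commute)
  qed
qed

end

text \<open>For l = 0 and u \<le> 1: shocks at which \<open>b\<close> is chosen, \<open>a\<close>
  trails by less than \<open>u\<close>, and every other action is hopeless, because a payoff change
  below 1 per coordinate cannot lift a value of at most -5 above one of at least -1. The gap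
  interval is half open so that shifted slabs tile.\<close>

definition slab :: "'n::finite \<Rightarrow> 'n \<Rightarrow> real \<Rightarrow> real \<Rightarrow> (real^'n) set" where
  "slab a b l u = {y. 0 \<le> y $ b \<and> y $ b \<le> 1 \<and> l \<le> y $ b - y $ a \<and> y $ b - y $ a < u \<and>
     (\<forall>j. j \<noteq> a \<and> j \<noteq> b \<longrightarrow> -6 \<le> y $ j \<and> y $ j \<le> -5)}"

lemma borel_slab [measurable]: "(slab a b l u :: (real^'n::finite) set) \<in> sets borel"
proof -
  have [measurable]: "(\<lambda>y :: real^'n. y $ j) \<in> borel_measurable borel" for j
    by (intro borel_measurable_continuous_onI continuous_intros)
  show ?thesis unfolding slab_def by measurable
qed

text \<open>The slab of width 1 splits into \<open>n\<close> translates of the slab of width \<open>1/n\<close>.\<close>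

lemma measure_slab:
  assumes ab: "a \<noteq> (b :: 'n::finite)"
  shows "\<exists>V>0. \<forall>n>0. measure lborel (slab a b 0 (1 / real n)) = V / real n"
proof (intro exI[of _ "measure lborel (slab a b 0 1)"] conjI allI impI)
  have sub: "slab a b l u \<subseteq> cbox (\<chi> j. -7) (\<chi> j. 7)" if "-1 \<le> l" "u \<le> 1" for l u
  proof
    fix y assume y: "y \<in> slab a b l u"
    have "-7 \<le> y $ j \<and> y $ j \<le> 7" for j
      using y that by (cases "j = a"; cases "j = b") (auto simp: slab_def; smt (verit))+
    then show "y \<in> cbox (\<chi> j. -7) (\<chi> j. 7)" by (simp add: mem_box_cart)
  qed
  have fin: "slab a b l u \<in> fmeasurable lborel" if "-1 \<le> l" "u \<le> 1" for l u
    by (rule fmeasurableI2[OF _ sub[OF that]]) (auto simp: fmeasurable_cbox)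
  \<comment> \<open>An interior point: gap 1/2, and the other coordinates in the middle of
    [-6, -5].\<close>
  define y0 :: "real^'n" where "y0 = (\<chi> j. if j = b then 1/2 else if j = a then 0 else -11/2)"
  have "box (y0 - (\<chi> j. 1/8)) (y0 + (\<chi> j. 1/8)) \<subseteq> slab a b 0 1"
  proof
    fix y assume y: "y \<in> box (y0 - (\<chi> j. 1/8)) (y0 + (\<chi> j. 1/8))"
    have "y0 $ j - 1/8 < y $ j \<and> y $ j < y0 $ j + 1/8" for j
      using y by (simp add: mem_box_cart)
    then have *: "y0 $ j - 1/8 < y $ j" "y $ j < y0 $ j + 1/8" for j by auto
    have "-6 \<le> y $ j \<and> y $ j \<le> -5" if "j \<noteq> a" "j \<noteq> b" for j
      using *[of j] that by (simp add: y0_def)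
    moreover have "0 \<le> y $ b \<and> y $ b \<le> 1 \<and> 0 \<le> y $ b - y $ a \<and> y $ b - y $ a < 1"
      using *[of a] *[of b] ab by (simp add: y0_def)
    ultimately show "y \<in> slab a b 0 1"
      unfolding slab_def by blast
  qed
  moreover have "y0 \<in> box (y0 - (\<chi> j. 1/8)) (y0 + (\<chi> j. 1/8))"
    by (simp add: mem_box_cart)
  ultimately have "\<not> negligible (slab a b 0 1)"
    using open_not_negligible[OF open_box] negligible_subset by blast
  then have "slab a b 0 1 \<notin> null_sets lborel"
    by (metis negligible_iff_null_sets null_sets_completionI)
  then have "emeasure lborel (slab a b 0 1) \<noteq> 0"
    by (simp add: null_sets_def)
  then show "0 < measure lborel (slab a b 0 1)"
    using emeasure_eq_measure2[OF fin[of 0 1]] by (simp add: zero_less_measure_iff less_le)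
  fix n :: nat assume n: "0 < n"
  define p where "p k = slab a b (real k / real n) (real (Suc k) / real n)" for k
  have "measure lborel (p k) = measure lborel (slab a b 0 (1 / real n))" for k
  proof -
    \<comment> \<open>Coordinate \<open>a\<close> is constrained only through the gap, so lowering
      it by k / n raises the gap to the level of \<open>p k\<close> and leaves the other conditions
      alone.\<close>
    have eq: "(\<lambda>y. y + axis a (- real k / real n)) -` p k = slab a b 0 (1 / real n)"
    proof (intro set_eqI)
      fix y
      have "real (Suc k) / real n = real k / real n + 1 / real n" by (simp add: add_divide_distrib)
      then show "y \<in> (\<lambda>y. y + axis a (- real k / real n)) -` p k \<longleftrightarrow> y \<in> slab a b 0 (1 / real n)"
        using ab by (auto simp: p_def slab_def axis_def)
    qed
    have "(\<integral>y. indicator (p k) (y + axis a (- real k / real n)) \<partial>lborel) = (\<integral>y. indicator (p k) y \<partial>(lborel :: (real^'n) measure) :: real)"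
      by (rule integral_translate) (auto simp: p_def)
    moreover have "indicator (p k) (y + axis a (- real k / real n)) = (indicator (slab a b 0 (1 / real n)) y :: real)" for y
      unfolding eq[symmetric] by (auto simp: indicator_def)
    then have "(\<integral>y. indicator (p k) (y + axis a (- real k / real n)) \<partial>lborel) = (\<integral>y. indicator (slab a b 0 (1 / real n)) y \<partial>lborel :: real)"
      by (intro Bochner_Integration.integral_cong[OF refl])
    ultimately have "(\<integral>y. indicator (slab a b 0 (1 / real n)) y \<partial>lborel) = (\<integral>y. indicator (p k) y \<partial>(lborel :: (real^'n) measure) :: real)"
      by simp
    then show ?thesis by (simp add: p_def)
  qed
  moreover have "slab a b 0 1 = (\<Union>k<n. p k)"
  proof (intro equalityI subsetI)
    fix y assume y: "y \<in> slab a b 0 1"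
    define k where "k = nat \<lfloor>(y $ b - y $ a) * real n\<rfloor>"
    have nn: "0 \<le> (y $ b - y $ a) * real n" using y by (simp add: slab_def)
    have k: "real k \<le> (y $ b - y $ a) * real n" "(y $ b - y $ a) * real n < real (Suc k)"
      using nn unfolding k_def by linarith+
    have "(y $ b - y $ a) * real n < 1 * real n"
      using y n by (intro mult_strict_right_mono) (auto simp: slab_def)
    then have "k < n" using k by linarith
    moreover have "y \<in> p k"
      using y k n unfolding p_def slab_def by (auto simp: divide_le_eq less_divide_eq)
    ultimately show "y \<in> (\<Union>k<n. p k)" by auto
  next
    fix y assume "y \<in> (\<Union>k<n. p k)"
    then obtain k where k: "k < n" "y \<in> p k" by auto
    have "real (Suc k) / real n \<le> 1" using k by simp
    moreover have "0 \<le> real k / real n" by simp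
    moreover have "real k / real n \<le> y $ b - y $ a" "y $ b - y $ a < real (Suc k) / real n"
      using k(2) by (auto simp: p_def slab_def simp del: of_nat_Suc)
    ultimately have "0 \<le> y $ b - y $ a" "y $ b - y $ a < 1" by linarith+
    then show "y \<in> slab a b 0 1"
      using k(2) unfolding p_def slab_def by blast
  qed
  moreover have "measure lborel (\<Union>k<n. p k) = (\<Sum>k<n. measure lborel (p k))"
  proof (rule measure_finite_Union)
    show "disjoint_family_on p {..<n}"
    proof (unfold disjoint_family_on_def, intro ballI impI)
      fix i j :: nat assume "i \<noteq> j"
      have False if "y \<in> p i" "y \<in> p j" for y
      proof -
        have 1: "real i / real n < real (Suc j) / real n" "real j / real n < real (Suc i) / real n"
          using that unfolding p_def slab_def by auto
        then have "i < Suc j" "j < Suc i" using n by (auto simp: divide_less_cancel simp del: of_nat_Suc)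
        then show False using \<open>i \<noteq> j\<close> by simp
      qed
      then show "p i \<inter> p j = {}" by blast
    qed
    show "emeasure lborel (p k) \<noteq> \<infinity>" if "k \<in> {..<n}" for k
    proof -
      have "-1 \<le> real k / real n" by (rule order_trans[of _ 0]) auto
      moreover have "real (Suc k) / real n \<le> 1" using that n by simp
      ultimately show ?thesis
        using fmeasurableD2[OF fin] by (simp add: p_def)
    qed
  qed (auto simp: p_def)
  ultimately show "measure lborel (slab a b 0 (1 / real n)) = measure lborel (slab a b 0 1) / real n"
    using n by simp
qed

section \<open>Derivative of the choice probabilities and its positivity\<close>

context shock_density
begin

text \<open>\<open>\<phi>\<close> may be an indicator, hence discontinuous; the translation is moved
  onto \<open>g\<close>, whose L^1 derivative then passes through the bounded factor.\<close>

lemma translate_has_derivative: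
  assumes \<phi>[measurable]: "\<phi> \<in> borel_measurable borel" and \<phi>1: "\<And>y. \<bar>\<phi> y\<bar> \<le> 1"
  shows "((\<lambda>c. \<integral>y. \<phi> (y + c) * g y \<partial>lborel) has_derivative (\<lambda>h. - (\<integral>y. \<phi> y * (g' (y - c) \<bullet> h) \<partial>lborel))) (at c)"
proof -
  have trans: "(\<integral>y. \<phi> (y + c) * g y \<partial>lborel) = (\<integral>y. \<phi> y * g (y - c) \<partial>lborel)" for c
    using integral_translate[of "\<lambda>y. \<phi> y * g (y - c)" c] by simp
  have intg: "integrable lborel (\<lambda>y. \<phi> y * g (y - c))" for c
  proof (rule Bochner_Integration.integrable_bound)
    show "integrable lborel (\<lambda>y. g (y - c))" using integrable_translate[OF g_density(1), of "- c"] by simp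
    show "AE y in lborel. norm (\<phi> y * g (y - c)) \<le> norm (g (y - c))"
      using \<phi>1 by (intro AE_I2) (simp add: abs_mult mult_left_le_one_le)
  qed measurable
  have intg': "integrable lborel (\<lambda>y. \<phi> y *\<^sub>R g' (y - c))" for c
  proof (rule Bochner_Integration.integrable_bound)
    show "integrable lborel (\<lambda>y. g' (y - c))" using integrable_translate[OF integrable_g', of "- c"] by simp
    show "AE y in lborel. norm (\<phi> y *\<^sub>R g' (y - c)) \<le> norm (g' (y - c))"
      using \<phi>1 by (intro AE_I2) (simp add: mult_left_le_one_le)
  qed measurable
  have inth: "integrable lborel (\<lambda>y. \<phi> y * (g' (y - c) \<bullet> h))"
    and linh: "(\<integral>y. \<phi> y * (g' (y - c) \<bullet> h) \<partial>lborel) = (\<integral>y. \<phi> y *\<^sub>R g' (y - c) \<partial>lborel) \<bullet> h" for c h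
  proof -
    have "(\<lambda>y. \<phi> y * (g' (y - c) \<bullet> h)) = (\<lambda>y. (\<phi> y *\<^sub>R g' (y - c)) \<bullet> h)" by simp
    then show "integrable lborel (\<lambda>y. \<phi> y * (g' (y - c) \<bullet> h))"
      "(\<integral>y. \<phi> y * (g' (y - c) \<bullet> h) \<partial>lborel) = (\<integral>y. \<phi> y *\<^sub>R g' (y - c) \<partial>lborel) \<bullet> h"
      using intg'[of c] by (simp_all only: integrable_inner_left integral_inner_left)
  qed
  show ?thesis
    unfolding trans has_derivative_within_alt[where s=UNIV, simplified]
  proof (intro conjI allI impI)
    show "bounded_linear (\<lambda>h. - (\<integral>y. \<phi> y * (g' (y - c) \<bullet> h) \<partial>lborel))"
      unfolding linh by (intro bounded_linear_minus bounded_linear_inner_right)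
    fix \<epsilon> :: real assume "0 < \<epsilon>"
    then obtain d where d: "0 < d" "\<And>h. norm h < d \<Longrightarrow> (\<integral>\<^sup>+z. \<bar>g (z - h) - g z + g' z \<bullet> h\<bar> \<partial>lborel) \<le> ennreal (\<epsilon> * norm h)"
      using L1_derivative_bound by blast
    show "\<exists>d>0. \<forall>c'. norm (c' - c) < d \<longrightarrow>
       norm ((\<integral>y. \<phi> y * g (y - c') \<partial>lborel) - (\<integral>y. \<phi> y * g (y - c) \<partial>lborel) - - (\<integral>y. \<phi> y * (g' (y - c) \<bullet> (c' - c)) \<partial>lborel)) \<le> \<epsilon> * norm (c' - c)"
    proof (intro exI[of _ d] conjI d(1) allI impI)
      fix c' assume c': "norm (c' - c) < d"
      define h where "h = c' - c"
      define r where "r y = \<phi> y * g (y - c') - \<phi> y * g (y - c) + \<phi> y * (g' (y - c) \<bullet> h)" for y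
      have r: "integrable lborel r" unfolding r_def by (intro Bochner_Integration.integrable_add Bochner_Integration.integrable_diff intg inth)
      have "(\<integral>y. \<phi> y * g (y - c') \<partial>lborel) - (\<integral>y. \<phi> y * g (y - c) \<partial>lborel) - - (\<integral>y. \<phi> y * (g' (y - c) \<bullet> h) \<partial>lborel) = (\<integral>y. r y \<partial>lborel)"
        unfolding r_def by (simp add: intg inth)
      moreover have "ennreal (norm (\<integral>y. r y \<partial>lborel)) \<le> ennreal (\<epsilon> * norm h)"
      proof -
        have "ennreal (norm (\<integral>y. r y \<partial>lborel)) \<le> (\<integral>\<^sup>+y. norm (r y) \<partial>lborel)"
          by (rule integral_norm_bound_ennreal[OF r])
        also have "\<dots> \<le> (\<integral>\<^sup>+y. \<bar>g (y - c - h) - g (y - c) + g' (y - c) \<bullet> h\<bar> \<partial>lborel)"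
        proof (intro nn_integral_mono ennreal_leI)
          fix y
          have "r y = \<phi> y * (g (y - c - h) - g (y - c) + g' (y - c) \<bullet> h)"
            by (simp add: r_def h_def algebra_simps)
          then show "norm (r y) \<le> \<bar>g (y - c - h) - g (y - c) + g' (y - c) \<bullet> h\<bar>"
            using \<phi>1[of y] by (simp add: abs_mult mult_left_le_one_le)
        qed
        also have "\<dots> = (\<integral>\<^sup>+z. \<bar>g (z - h) - g z + g' z \<bullet> h\<bar> \<partial>lborel)"
          using nn_integral_translate[of "\<lambda>z. ennreal \<bar>g (z - h) - g z + g' z \<bullet> h\<bar>" "- c"] by simp
        also have "\<dots> \<le> ennreal (\<epsilon> * norm h)"
          using c' by (intro d(2)) (simp add: h_def)
        finally show ?thesis .
      qed
      ultimately show "norm ((\<integral>y. \<phi> y * g (y - c') \<partial>lborel) - (\<integral>y. \<phi> y * g (y - c) \<partial>lborel) - - (\<integral>y. \<phi> y * (g' (y - c) \<bullet> (c' - c)) \<partial>lborel)) \<le> \<epsilon> * norm (c' - c)"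
        using \<open>0 < \<epsilon>\<close> by (simp add: h_def)
    qed
  qed
qed

definition Dcprob :: "real^'n \<Rightarrow> real^'n \<Rightarrow> 'n \<Rightarrow> real" where
  "Dcprob c h a = - (\<integral>y. indicator (argmax a) y * (g' (y - c) \<bullet> h) \<partial>lborel)"

lemma cprob_has_derivative: "((\<lambda>c. cprob c a) has_derivative (\<lambda>h. Dcprob c h a)) (at c)"
  unfolding cprob_def Dcprob_def by (rule translate_has_derivative) (auto simp: indicator_def)

text \<open>Revealed preference: shifting payoffs along \<open>h\<close> can only move the choice
  towards larger \<open>h\<close>, so the integrand never decreases, and on a slab the choice jumps
  from \<open>b\<close> to \<open>a\<close>, a gain of \<delta>. A density of at least
  \<open>g e0\<close> there makes the total gain at least \<kappa> / n.\<close>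

lemma cprob_increase:
  assumes ab: "h $ b < h $ a"
  shows "\<exists>\<kappa>>0. \<forall>\<^sub>F n in sequentially. \<kappa> / real n \<le>
    (\<Sum>i\<in>UNIV. h $ i * cprob (c + (1 / (real n * (h $ a - h $ b))) *\<^sub>R h) i) - (\<Sum>i\<in>UNIV. h $ i * cprob c i)"
proof -
  define \<delta> where "\<delta> = h $ a - h $ b"
  have \<delta>: "0 < \<delta>" using ab by (simp add: \<delta>_def)
  have "a \<noteq> b" using ab by auto
  then obtain V where V: "0 < V" "\<And>n. 0 < n \<Longrightarrow> measure lborel (slab a b 0 (1 / real n)) = V / real n"
    using measure_slab by blast
  define H where "H y = (\<Sum>i\<in>UNIV. h $ i * indicator (argmax i) y)" for y
  have H_meas[measurable]: "H \<in> borel_measurable borel" unfolding H_def by measurable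
  have H_eq: "H y = h $ i" if "y \<notin> ties" "y \<in> argmax i" for y i
    using that by (simp add: H_def argmax_indicator if_distrib[of "\<lambda>x. _ * x"] cong: if_cong)
  have psi: "(\<Sum>i\<in>UNIV. h $ i * cprob c i) = (\<integral>e. H (e + c) * g e \<partial>lborel)" for c
  proof -
    have "(\<integral>e. H (e + c) * g e \<partial>lborel) = (\<integral>e. (\<Sum>i\<in>UNIV. h $ i * (indicator (argmax i) (e + c) * g e)) \<partial>lborel)"
      by (simp add: H_def sum_distrib_right mult.assoc)
    also have "\<dots> = (\<Sum>i\<in>UNIV. h $ i * cprob c i)"
      by (simp add: integrable_indicator_g cprob_def)
    finally show ?thesis by simp
  qed
  have intH: "integrable lborel (\<lambda>e. H (e + c) * g e)" for c
    unfolding H_def sum_distrib_right mult.assoc by (intro Bochner_Integration.integrable_sum integrable_mult_right integrable_indicator_g)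
  \<comment> \<open>A compact set that contains every slab in shock coordinates; on it the positive
    continuous density has a positive minimum, uniform in n.\<close>
  define K where "K = (\<lambda>y. y - c) ` (cbox (\<chi> j. -7) (\<chi> j. 7) :: (real^'n) set)"
  have "compact K" unfolding K_def by (intro compact_continuous_image continuous_intros compact_cbox)
  moreover have "K \<noteq> {}" by (auto simp: K_def interval_ne_empty_cart)
  ultimately obtain e0 where e0: "e0 \<in> K" "\<And>e. e \<in> K \<Longrightarrow> g e0 \<le> g e"
    using continuous_attains_inf[OF _ _ continuous_g] by metis
  define \<kappa> where "\<kappa> = \<delta> * g e0 * V"
  have \<kappa>: "0 < \<kappa>" using \<delta> g_pos V by (simp add: \<kappa>_def)
  have "(\<lambda>n. inverse (real n) * (norm h / \<delta>)) \<longlonglongrightarrow> 0 * (norm h / \<delta>)"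
    by (intro tendsto_intros LIMSEQ_inverse_real_of_nat lim_inverse_n)
  then have "\<forall>\<^sub>F n in sequentially. inverse (real n) * (norm h / \<delta>) < 1"
    by (rule order_tendstoD) simp
  then have "\<forall>\<^sub>F n in sequentially. \<kappa> / real n \<le>
      (\<Sum>i\<in>UNIV. h $ i * cprob (c + (1 / (real n * \<delta>)) *\<^sub>R h) i) - (\<Sum>i\<in>UNIV. h $ i * cprob c i)"
    using eventually_gt_at_top[of 0]
  proof eventually_elim
    case (elim n)
    \<comment> \<open>The step is tuned so that the payoff of \<open>a\<close> gains exactly 1 / n
      on that of \<open>b\<close>, the width of the slab.\<close>
    define s where "s = 1 / (real n * \<delta>)"
    have s: "0 < s" "s * norm h < 1" "s * \<delta> = 1 / real n"
      using elim \<delta> by (auto simp: s_def field_simps)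
    have sh: "\<bar>s * h $ j\<bar> < 1" for j
    proof -
      have "\<bar>s * h $ j\<bar> \<le> s * norm h"
        using s component_le_norm_cart[of h j] by (simp add: abs_mult)
      then show ?thesis using s by linarith
    qed
    let ?S = "slab a b 0 (1 / real n)"
    have slabK: "y - c \<in> K" if "y \<in> ?S" for y
    proof -
      have n1: "1 / real n \<le> 1" using elim by simp
      have "-7 \<le> y $ j \<and> y $ j \<le> 7" for j
        using that n1 by (cases "j = a"; cases "j = b") (auto simp: slab_def; smt (verit))+
      then show ?thesis by (auto simp: K_def mem_box_cart)
    qed
    have slab: "y \<in> argmax b \<and> y + s *\<^sub>R h \<in> argmax a" if y: "y \<in> ?S" for y
    proof
      have 0: "0 \<le> y $ b" "y $ b \<le> 1" "0 \<le> y $ b - y $ a" "y $ b - y $ a < 1 / real n"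
          "\<And>j. j \<noteq> a \<Longrightarrow> j \<noteq> b \<Longrightarrow> y $ j \<le> -5"
        using y by (auto simp: slab_def)
      have "1 / real n \<le> 1" using elim by simp
      then have ya: "-1 \<le> y $ a" using 0 by linarith
      have "y $ j \<le> y $ b" for j
        using 0 by (cases "j = a"; cases "j = b") (auto; smt (verit))+
      then show "y \<in> argmax b" by (simp add: argmax_def)
      have "(y + s *\<^sub>R h) $ j \<le> (y + s *\<^sub>R h) $ a" for j
      proof -
        consider "j = a" | "j = b" | "j \<noteq> a" "j \<noteq> b" by blast
        then show ?thesis
        proof cases
          case 2
          have "s * h $ a - s * h $ b = 1 / real n"
            using s(3) by (simp add: \<delta>_def right_diff_distrib)
          then show ?thesis using 0 2 by simp
        next
          case 3
          then show ?thesis using 0(5)[of j] ya sh[of j] sh[of a] by (simp add: abs_less_iff)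
        qed simp
      qed
      then show "y + s *\<^sub>R h \<in> argmax a" by (simp add: argmax_def)
    qed
    have mono: "AE e in lborel. (\<delta> * g e0) * indicator ?S (e + c) \<le> H (e + (c + s *\<^sub>R h)) * g e - H (e + c) * g e"
      using AE_not_ties[of c] AE_not_ties[of "c + s *\<^sub>R h"]
    proof eventually_elim
      case (elim e)
      define y where "y = e + c"
      have ny: "y \<notin> ties" "y + s *\<^sub>R h \<notin> ties" using elim by (auto simp: y_def add.assoc)
      have eqs: "e + (c + s *\<^sub>R h) = y + s *\<^sub>R h" by (simp add: y_def)
      obtain i where i: "y \<in> argmax i" using vmax_attained by blast
      obtain j where j: "y + s *\<^sub>R h \<in> argmax j" using vmax_attained by blast
      \<comment> \<open>Adding the optimality of \<open>i\<close> before and of \<open>j\<close>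
        after the shift cancels \<open>y\<close> and leaves
        \<open>h $ i \<le> h $ j\<close>.\<close>
      have "y $ j \<le> y $ i" "(y + s *\<^sub>R h) $ i \<le> (y + s *\<^sub>R h) $ j"
        using i j by (auto simp: argmax_def)
      then have "s * h $ i \<le> s * h $ j" by simp
      then have hij: "h $ i \<le> h $ j" using s by simp
      show ?case
      proof (cases "y \<in> ?S")
        case True
        have "H y = h $ b" "H (y + s *\<^sub>R h) = h $ a"
          using slab[OF True] ny H_eq by auto
        moreover have "g e0 \<le> g e" using slabK[OF True] e0(2) by (simp add: y_def)
        then have "\<delta> * g e0 \<le> \<delta> * g e" using \<delta> by simp
        ultimately show ?thesis
          using True unfolding eqs y_def[symmetric] by (simp add: \<delta>_def left_diff_distrib)
      next
        case False
        have "H y * g e \<le> H (y + s *\<^sub>R h) * g e"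
          using hij ny i j H_eq g_pos[of e] by (intro mult_right_mono) auto
        then show ?thesis using False unfolding eqs y_def[symmetric] by simp
      qed
    qed
    have intS: "integrable lborel (indicator ?S :: real^'n \<Rightarrow> real)"
    proof (rule integrable_real_indicator)
      have "?S \<subseteq> cbox (\<chi> j. -7) (\<chi> j. 7)"
      proof
        fix y assume "y \<in> ?S"
        from slabK[OF this] show "y \<in> cbox (\<chi> j. -7) (\<chi> j. 7)" by (auto simp: K_def)
      qed
      then have "emeasure lborel ?S \<le> emeasure lborel (cbox (\<chi> j. -7) (\<chi> j. 7) :: (real^'n) set)"
        by (rule emeasure_mono) auto
      then show "emeasure lborel ?S < \<infinity>"
        using emeasure_lborel_cbox_finite order_le_less_trans by blast
    qed auto
    have "(\<integral>e. (\<delta> * g e0) * indicator ?S (e + c) \<partial>lborel) = (\<delta> * g e0) * measure lborel ?S"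
      using integral_translate[of "indicator ?S :: _ \<Rightarrow> real" c] by simp
    also have "\<dots> = \<kappa> / real n"
      using V(2)[of n] elim by (simp add: \<kappa>_def)
    finally have "\<kappa> / real n = (\<integral>e. (\<delta> * g e0) * indicator ?S (e + c) \<partial>lborel)" ..
    also have "\<dots> \<le> (\<integral>e. H (e + (c + s *\<^sub>R h)) * g e - H (e + c) * g e \<partial>lborel)"
      using integrable_translate[OF intS, of c]
      by (intro integral_mono_AE mono Bochner_Integration.integrable_diff intH integrable_mult_right)
    also have "\<dots> = (\<Sum>i\<in>UNIV. h $ i * cprob (c + s *\<^sub>R h) i) - (\<Sum>i\<in>UNIV. h $ i * cprob c i)"
      by (simp add: intH psi)
    finally show ?case by (simp add: s_def)
  qed
  then show ?thesis using \<kappa> unfolding \<delta>_def by blast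
qed

text \<open>The gain \<kappa> / n over a step 1 / (n \<delta>) is linear in the step, so the
  directional derivative is at least \<kappa> \<delta>; strict monotonicity alone would leave room
  for 0. Directions with all entries equal are excluded because a common shift of payoffs does not
  change the choice.\<close>

lemma Dcprob_positive:
  assumes ab: "h $ a \<noteq> h $ b"
  shows "0 < (\<Sum>i\<in>UNIV. h $ i * Dcprob c h i)"
proof -
  have main: "0 < (\<Sum>i\<in>UNIV. h $ i * Dcprob c h i)" if ab: "h $ b < h $ a" for a b
  proof -
    define \<delta> where "\<delta> = h $ a - h $ b"
    have \<delta>: "0 < \<delta>" using ab by (simp add: \<delta>_def)
    obtain \<kappa> where \<kappa>: "0 < \<kappa>" "\<forall>\<^sub>F n in sequentially. \<kappa> / real n \<le>
      (\<Sum>i\<in>UNIV. h $ i * cprob (c + (1 / (real n * \<delta>)) *\<^sub>R h) i) - (\<Sum>i\<in>UNIV. h $ i * cprob c i)"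
      using cprob_increase[OF ab] unfolding \<delta>_def by blast
    define \<psi> where "\<psi> s = (\<Sum>i\<in>UNIV. h $ i * cprob (c + s *\<^sub>R h) i)" for s
    have lin: "Dcprob c (t *\<^sub>R h) i = t * Dcprob c h i" for t i
      using linear_scale[OF bounded_linear.linear[OF has_derivative_bounded_linear[OF cprob_has_derivative]]] by simp
    have "((\<lambda>s. cprob (c + s *\<^sub>R h) i) has_derivative (\<lambda>t. Dcprob c (t *\<^sub>R h) i)) (at 0)" for i
    proof (rule has_derivative_compose[where g="\<lambda>c. cprob c i"])
      show "((\<lambda>s. c + s *\<^sub>R h) has_derivative (\<lambda>t. t *\<^sub>R h)) (at 0)"
        by (auto intro!: derivative_eq_intros)
      show "((\<lambda>c. cprob c i) has_derivative (\<lambda>h. Dcprob c h i)) (at (c + 0 *\<^sub>R h))"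
        using cprob_has_derivative by simp
    qed
    then have "(\<psi> has_derivative (\<lambda>t. \<Sum>i\<in>UNIV. h $ i * Dcprob c (t *\<^sub>R h) i)) (at 0)"
      unfolding \<psi>_def by (intro has_derivative_sum has_derivative_mult_right)
    then have "(\<psi> has_real_derivative (\<Sum>i\<in>UNIV. h $ i * Dcprob c h i)) (at 0)"
      unfolding has_field_derivative_def by (rule has_derivative_eq_rhs) (auto simp: lin fun_eq_iff sum_distrib_left mult_ac)
    then have "((\<lambda>s. (\<psi> (0 + s) - \<psi> 0) / s) \<longlongrightarrow> (\<Sum>i\<in>UNIV. h $ i * Dcprob c h i)) (at 0)"
      by (simp add: DERIV_def)
    moreover have "filterlim (\<lambda>n. 1 / (real n * \<delta>)) (at 0) sequentially"
    proof (rule filterlim_atI)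
      have "(\<lambda>n. inverse (real n) * inverse \<delta>) \<longlonglongrightarrow> 0 * inverse \<delta>"
        by (intro tendsto_intros lim_inverse_n)
      then show "(\<lambda>n. 1 / (real n * \<delta>)) \<longlonglongrightarrow> 0" by (simp add: field_simps)
      show "\<forall>\<^sub>F n in sequentially. 1 / (real n * \<delta>) \<noteq> 0"
        using eventually_gt_at_top[of "0::nat"] by eventually_elim (use \<delta> in auto)
    qed
    ultimately have "(\<lambda>n. (\<psi> (0 + 1 / (real n * \<delta>)) - \<psi> 0) / (1 / (real n * \<delta>))) \<longlonglongrightarrow> (\<Sum>i\<in>UNIV. h $ i * Dcprob c h i)"
      by (rule filterlim_compose)
    moreover have "\<forall>\<^sub>F n in sequentially. \<kappa> * \<delta> \<le> (\<psi> (0 + 1 / (real n * \<delta>)) - \<psi> 0) / (1 / (real n * \<delta>))"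
      using \<kappa>(2) eventually_gt_at_top[of 0]
    proof eventually_elim
      case (elim n)
      then have "\<kappa> / real n * (real n * \<delta>) \<le> (\<psi> (1 / (real n * \<delta>)) - \<psi> 0) * (real n * \<delta>)"
        using \<delta> by (intro mult_right_mono) (auto simp: \<psi>_def)
      then show ?case using elim(2) by simp
    qed
    ultimately have "\<kappa> * \<delta> \<le> (\<Sum>i\<in>UNIV. h $ i * Dcprob c h i)"
      by (rule tendsto_lowerbound) simp
    moreover have "0 < \<kappa> * \<delta>" using \<kappa> \<delta> by simp
    ultimately show ?thesis by linarith
  qed
  show ?thesis
    using ab main[of a b] main[of b a] by (meson linorder_neqE_linordered_idom)
qed

end

text \<open>Coordinates on the simplex. Forgetting the last probability makes it full-dimensional,
  as invariance of domain and the inverse function theorem require.\<close>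

definition drop_last :: "real^('d::finite option) \<Rightarrow> real^'d" where
  "drop_last p = (\<chi> d. p $ Some d)"

lemma linear_drop_last: "linear drop_last"
  by (rule linearI) (auto simp: drop_last_def vec_eq_iff)

lemma linear_Iplus: "linear Iplus"
  by (rule linearI) (auto simp: Iplus_def vec_eq_iff split: option.split)

lemma linear_Delta: "linear Delta"
  by (rule linearI) (auto simp: Delta_def vec_eq_iff algebra_simps)

lemma Iplus_nth [simp]: "Iplus v $ Some d = v $ d" "Iplus v $ None = 0"
  by (auto simp: Iplus_def)

lemma Iplus_Delta: "Iplus (Delta c) = c - c $ None *\<^sub>R 1"
  by (auto simp: Iplus_def Delta_def vec_eq_iff split: option.split)

lemma drop_last_inj:
  assumes "p \<in> prob_simplex" "q \<in> prob_simplex" "drop_last p = drop_last q"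
  shows "p = q"
proof -
  have *: "r $ None = 1 - (\<Sum>d\<in>UNIV. drop_last r $ d)" if "r \<in> prob_simplex" for r :: "real^'a option"
    using that by (simp add: prob_simplex_def drop_last_def UNIV_option_conv sum.reindex)
  have "p $ a = q $ a" for a
    using *[OF assms(1)] *[OF assms(2)] assms(3) by (cases a) (auto simp: drop_last_def vec_eq_iff)
  then show ?thesis by (simp add: vec_eq_iff)
qed

section \<open>Inverting the choice probabilities\<close>

locale choice_shock = shock_density g g'
  for g :: "real^('d::finite option) \<Rightarrow> real" and g' :: "real^('d option) \<Rightarrow> real^('d option)"
begin

lemma nu_eq: "nu g = emax"
  by (simp add: fun_eq_iff nu_def emax_def vmax_def)

lemma nu_has_derivative: "(nu g has_derivative (\<lambda>h. \<Sum>a\<in>UNIV. h $ a * cprob c a)) (at c)"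
  unfolding nu_eq by (rule emax_has_derivative)

lemma grad_nu: "grad (nu g) c = (\<chi> a. cprob c a)"
proof -
  have "frechet_derivative (nu g) (at c) = (\<lambda>h. \<Sum>a\<in>UNIV. h $ a * cprob c a)"
    using frechet_derivative_at[OF nu_has_derivative] by simp
  then show ?thesis
    by (simp add: grad_def axis_def vec_eq_iff if_distrib[of "\<lambda>x. x * _"] cong: if_cong)
qed

lemma rho_nth: "rho g v $ a = cprob (Iplus v) a"
  by (simp add: rho_def grad_nu)

lemma rho_in_simplex: "rho g v \<in> prob_simplex"
  unfolding prob_simplex_def using cprob_pos cprob_sum by (auto simp: rho_nth less_imp_le)

lemma rho_pos: "0 < rho g v $ a"
  by (simp add: rho_nth cprob_pos)

definition Drho :: "real^'d \<Rightarrow> real^'d \<Rightarrow> real^('d option)" where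
  "Drho v h = (\<chi> a. Dcprob (Iplus v) (Iplus h) a)"

lemma rho_has_derivative: "(rho g has_derivative Drho v) (at v)"
proof -
  have "((\<lambda>v. cprob (Iplus v) a) has_derivative (\<lambda>h. Dcprob (Iplus v) (Iplus h) a)) (at v)" for a
    by (rule has_derivative_compose[where g="\<lambda>c. cprob c a", OF linear_imp_has_derivative[OF linear_Iplus] cprob_has_derivative])
  then have "((\<lambda>v. rho g v \<bullet> b) has_derivative (\<lambda>h. Drho v h \<bullet> b)) (at v)" if "b \<in> Basis" for b
    using that by (auto simp: Basis_vec_def inner_axis rho_nth Drho_def)
  then show ?thesis
    using has_derivative_componentwise_within[of "rho g" "Drho v" v UNIV] by simp
qed

lemma linear_Drho: "linear (Drho v)"
  using rho_has_derivative has_derivative_linear by blast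

lemma Drho_positive: "h \<noteq> 0 \<Longrightarrow> 0 < Iplus h \<bullet> Drho v h"
proof -
  assume "h \<noteq> 0"
  then obtain d where "h $ d \<noteq> 0" by (auto simp: vec_eq_iff)
  then have "Iplus h $ Some d \<noteq> Iplus h $ None" by simp
  then show ?thesis
    using Dcprob_positive[of "Iplus h" "Some d" None "Iplus v"] by (simp add: inner_vec_def Drho_def)
qed

lemma Iplus_inner: "Iplus h \<bullet> p = h \<bullet> drop_last p"
  by (simp add: inner_vec_def drop_last_def UNIV_option_conv sum.reindex)

text \<open>Positive definiteness of the derivative on a convex domain: along the segment from
  \<open>v\<close> to \<open>w\<close> the pairing of \<open>rho\<close> with the direction
  increases strictly.\<close>

lemma rho_inj: "rho g v = rho g w \<Longrightarrow> v = w"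
proof (rule ccontr)
  assume eq: "rho g v = rho g w" and ne: "v \<noteq> w"
  define h where "h = w - v"
  have h: "h \<noteq> 0" using ne by (simp add: h_def)
  define \<psi> where "\<psi> s = Iplus h \<bullet> rho g (v + s *\<^sub>R h)" for s
  have deriv: "(\<psi> has_real_derivative Iplus h \<bullet> Drho (v + s *\<^sub>R h) h) (at s)" for s
  proof -
    have "((\<lambda>s. rho g (v + s *\<^sub>R h)) has_derivative (\<lambda>t. Drho (v + s *\<^sub>R h) (t *\<^sub>R h))) (at s)"
      by (rule has_derivative_compose[OF _ rho_has_derivative]) (auto intro!: derivative_eq_intros)
    then have "(\<psi> has_derivative (\<lambda>t. Iplus h \<bullet> Drho (v + s *\<^sub>R h) (t *\<^sub>R h))) (at s)"
      unfolding \<psi>_def by (rule has_derivative_inner_right)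
    then show ?thesis
      unfolding has_field_derivative_def
      by (rule has_derivative_eq_rhs) (auto simp: linear_scale[OF linear_Drho] fun_eq_iff)
  qed
  have "\<psi> 0 < \<psi> 1"
  proof (rule DERIV_pos_imp_increasing[where f=\<psi>])
    show "(0::real) < 1" by simp
    show "\<exists>y. (\<psi> has_real_derivative y) (at s) \<and> 0 < y" for s
      using deriv[of s] Drho_positive[OF h] by blast
  qed
  then show False using eq by (simp add: \<psi>_def h_def)
qed

lemma rho_inv_rho [simp]: "rho_inv g (rho g v) = v"
  unfolding rho_inv_def using rho_inj by (intro the_equality) auto

lemma drop_rho_inj: "drop_last (rho g v) = drop_last (rho g w) \<Longrightarrow> v = w"
  using drop_last_inj[OF rho_in_simplex rho_in_simplex] rho_inj by blast

lemma open_drop_rho: "open (range (\<lambda>v. drop_last (rho g v)))"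
proof (rule invariance_of_domain)
  show "continuous_on UNIV (\<lambda>v. drop_last (rho g v))"
    by (intro linear_continuous_on_compose[OF _ linear_drop_last] has_derivative_continuous_on[OF has_derivative_at_withinI[OF rho_has_derivative]])
  show "inj (\<lambda>v. drop_last (rho g v))"
    using drop_rho_inj by (auto simp: inj_on_def)
qed auto

text \<open>\<open>rho_inv\<close> is a definite description and says nothing off the range of
  \<open>rho\<close>; openness of the range in reduced coordinates makes it a genuine inverse at all
  simplex points near \<open>rho g v\<close>.\<close>

lemma eventually_rho_rho_inv:
  "\<forall>\<^sub>F p in at (rho g v) within prob_simplex. rho g (rho_inv g p) = p"
proof -
  have "open (drop_last -` range (\<lambda>v. drop_last (rho g v)))"
    by (intro open_vimage open_drop_rho linear_continuous_on linear_conv_bounded_linear[THEN iffD1] linear_drop_last)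
  then have "\<forall>\<^sub>F p in at (rho g v) within prob_simplex. p \<in> drop_last -` range (\<lambda>v. drop_last (rho g v))"
    by (rule eventually_at_in_open'[THEN filter_leD[OF at_le[OF subset_UNIV]]]) auto
  moreover have "\<forall>\<^sub>F p in at (rho g v) within prob_simplex. p \<in> prob_simplex"
    by (simp add: eventually_at_filter)
  ultimately show ?thesis
  proof eventually_elim
    case (elim p)
    then obtain w where "drop_last p = drop_last (rho g w)" by auto
    then have "p = rho g w"
      using drop_last_inj[OF elim(2) rho_in_simplex] by blast
    then show ?case by simp
  qed
qed

definition Drho_inv :: "real^'d \<Rightarrow> real^('d option) \<Rightarrow> real^'d" where
  "Drho_inv v = inv (\<lambda>h. drop_last (Drho v h)) \<circ> drop_last"

text \<open>\<open>Iplus h\<close> vanishes in the last coordinate, so its pairing with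
  \<open>Drho v h\<close> sees only the dropped vector, and \<open>Drho_positive\<close> still rules
  out a kernel.\<close>

lemma drop_Drho: "linear (\<lambda>h. drop_last (Drho v h))" "inj (\<lambda>h. drop_last (Drho v h))" "surj (\<lambda>h. drop_last (Drho v h))"
proof -
  show 1: "linear (\<lambda>h. drop_last (Drho v h))"
    using linear_compose[OF linear_Drho linear_drop_last] by (simp add: comp_def)
  have "h = 0" if "drop_last (Drho v h) = 0" for h
  proof (rule ccontr)
    assume "h \<noteq> 0"
    then show False using Drho_positive[of h v] that by (simp add: Iplus_inner)
  qed
  then show 2: "inj (\<lambda>h. drop_last (Drho v h))"
    using linear_injective_0[OF 1] by blast
  show "surj (\<lambda>h. drop_last (Drho v h))"
    using linear_injective_imp_surjective[OF 1 2] by simp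
qed

text \<open>The derivative is obtained for the inverse in reduced coordinates, between spaces of
  equal dimension, and pulled back along \<open>drop_last\<close>; the two inverses agree near the
  point.\<close>

lemma rho_inv_has_derivative: "(rho_inv g has_derivative Drho_inv v) (at (rho g v) within prob_simplex)"
proof -
  define r where "r v = drop_last (rho g v)" for v
  define s where "s = inv r"
  have r: "inj r" using drop_rho_inj by (auto simp: inj_on_def r_def)
  have "(s has_derivative inv (\<lambda>h. drop_last (Drho v h))) (at (r v))"
  proof (rule has_derivative_inverse_strong[where S=UNIV and f=r and x=v and g=s and f'="\<lambda>h. drop_last (Drho v h)"])
    show "continuous_on UNIV r"
      unfolding r_def
      by (intro linear_continuous_on_compose[OF _ linear_drop_last] has_derivative_continuous_on[OF has_derivative_at_withinI[OF rho_has_derivative]])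
    show "s (r x) = x" for x using r by (simp add: s_def)
    show "(r has_derivative (\<lambda>h. drop_last (Drho v h))) (at v)"
      unfolding r_def by (rule has_derivative_compose[OF rho_has_derivative linear_imp_has_derivative[OF linear_drop_last]])
    show "(\<lambda>h. drop_last (Drho v h)) \<circ> inv (\<lambda>h. drop_last (Drho v h)) = id"
      using surj_f_inv_f[OF drop_Drho(3)[of v]] by (simp only: fun_eq_iff comp_def id_def) blast
  qed auto
  then have "((\<lambda>p. s (drop_last p)) has_derivative (\<lambda>h. inv (\<lambda>h. drop_last (Drho v h)) (drop_last h))) (at (rho g v) within prob_simplex)"
    by (intro has_derivative_compose[where g=s, OF has_derivative_at_withinI[OF linear_imp_has_derivative[OF linear_drop_last]]]) (simp add: r_def)
  then have "((\<lambda>p. s (drop_last p)) has_derivative Drho_inv v) (at (rho g v) within prob_simplex)"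
    by (simp add: Drho_inv_def comp_def)
  moreover have "\<forall>\<^sub>F p in at (rho g v) within prob_simplex. s (drop_last p) = rho_inv g p"
    using eventually_rho_rho_inv[of v]
  proof eventually_elim
    case (elim p)
    have "s (r (rho_inv g p)) = rho_inv g p" using r by (simp add: s_def)
    then show ?case by (simp add: r_def elim)
  qed
  ultimately show ?thesis
    by (rule has_derivative_transform_eventually) (use r in \<open>auto simp: rho_in_simplex s_def r_def[symmetric]\<close>)
qed

lemma nu_shift: "nu g (c + t *\<^sub>R 1) = nu g c + t"
proof -
  have v: "vmax (e + t *\<^sub>R 1) = vmax e + t" for e :: "real^('d option)"
  proof -
    obtain a where "e \<in> argmax a" using vmax_attained by blast
    moreover then have "e + t *\<^sub>R 1 \<in> argmax a" by (simp add: argmax_def)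
    ultimately show ?thesis by (simp add: vmax_argmax)
  qed
  have "nu g (c + t *\<^sub>R 1) = (\<integral>e. vmax (e + c) * g e + t * g e \<partial>lborel)"
    unfolding nu_eq emax_def by (intro Bochner_Integration.integral_cong) (auto simp: add.assoc[symmetric] v distrib_right)
  also have "\<dots> = nu g c + t"
    unfolding nu_eq emax_def using g_density by (simp add: integrable_vmax)
  finally show ?thesis .
qed

lemma nu_mono_bound:
  assumes "\<And>a. \<bar>c $ a - c' $ a\<bar> \<le> K"
  shows "\<bar>nu g c - nu g c'\<bar> \<le> K"
proof -
  have K: "\<bar>vmax (e + c) - vmax (e + c')\<bar> \<le> K" for e
  proof -
    have "vmax (e + c) \<le> vmax (e + c') + K"
    proof (rule vmax_le)
      fix a show "(e + c) $ a \<le> vmax (e + c') + K"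
        using vmax_ge[of "e + c'" a] assms[of a] by simp
    qed
    moreover have "vmax (e + c') \<le> vmax (e + c) + K"
    proof (rule vmax_le)
      fix a show "(e + c') $ a \<le> vmax (e + c) + K"
        using vmax_ge[of "e + c" a] assms[of a] by simp
    qed
    ultimately show ?thesis by linarith
  qed
  have "\<bar>nu g c - nu g c'\<bar> = \<bar>\<integral>e. vmax (e + c) * g e - vmax (e + c') * g e \<partial>lborel\<bar>"
    unfolding nu_eq emax_def by (simp add: integrable_vmax)
  also have "\<dots> \<le> (\<integral>e. \<bar>vmax (e + c) * g e - vmax (e + c') * g e\<bar> \<partial>lborel)"
    by (rule integral_abs_bound)
  also have "\<dots> \<le> (\<integral>e. K * g e \<partial>lborel)"
  proof (rule integral_mono)
    fix e
    have "\<bar>vmax (e + c) - vmax (e + c')\<bar> * g e \<le> K * g e"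
      using K g_pos[of e] by (intro mult_right_mono) auto
    then show "\<bar>vmax (e + c) * g e - vmax (e + c') * g e\<bar> \<le> K * g e"
      using g_pos[of e] by (simp add: left_diff_distrib[symmetric] abs_mult)
  qed (use integrable_vmax g_density in auto)
  also have "\<dots> = K" using g_density by simp
  finally show ?thesis .
qed

end

section \<open>Expansion of a minimiser\<close>

lemma linear_injective_lower_bound:
  fixes D :: "'a::euclidean_space \<Rightarrow> 'b::euclidean_space"
  assumes "linear D" "\<And>x. D x = 0 \<Longrightarrow> x = 0"
  obtains b where "0 < b" "\<And>x. b * norm x \<le> norm (D x)"
  using linear_inj_bounded_below_pos[of D] assms linear_injective_0[of D] by metis

text \<open>Near \<theta> the injective derivative dominates its remainder; away from \<theta>,
  |\<psi>| is bounded below by compactness while |s - \<theta>| is bounded above. One linear bound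
  on all of \<Theta> gives localisation and rate together.\<close>

lemma lower_bound_compact:
  fixes \<psi> :: "'a::euclidean_space \<Rightarrow> 'b::euclidean_space"
  assumes \<Theta>: "compact \<Theta>" and cont: "continuous_on \<Theta> \<psi>"
    and zero: "\<psi> \<theta> = 0" "\<And>s. s \<in> \<Theta> \<Longrightarrow> \<psi> s = 0 \<Longrightarrow> s = \<theta>"
    and deriv: "(\<psi> has_derivative D) (at \<theta>)" and inj: "\<And>x. D x = 0 \<Longrightarrow> x = 0"
  obtains c where "0 < c" "\<And>s. s \<in> \<Theta> \<Longrightarrow> c * norm (s - \<theta>) \<le> norm (\<psi> s)"
proof -
  obtain b where b: "0 < b" "\<And>x. b * norm x \<le> norm (D x)"
    using linear_injective_lower_bound[OF has_derivative_linear[OF deriv] inj] by blast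
  have "\<forall>e>0. \<exists>d>0. \<forall>s. norm (s - \<theta>) < d \<longrightarrow> norm (\<psi> s - \<psi> \<theta> - D (s - \<theta>)) \<le> e * norm (s - \<theta>)"
    using deriv[unfolded has_derivative_within_alt[where s=UNIV, simplified]] by simp
  then obtain d where d: "0 < d" "\<And>s. norm (s - \<theta>) < d \<Longrightarrow> norm (\<psi> s - D (s - \<theta>)) \<le> b / 2 * norm (s - \<theta>)"
    using b(1) zero(1) by (metis diff_zero half_gt_zero)
  have near: "b / 2 * norm (s - \<theta>) \<le> norm (\<psi> s)" if "norm (s - \<theta>) < d" for s
  proof -
    have "b * norm (s - \<theta>) \<le> norm (D (s - \<theta>))" by (rule b)
    also have "\<dots> \<le> norm (\<psi> s) + norm (\<psi> s - D (s - \<theta>))"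
      by (metis norm_minus_commute norm_triangle_sub)
    finally show ?thesis using d(2)[OF that] by linarith
  qed
  let ?K = "\<Theta> - ball \<theta> d"
  have K: "compact ?K" using \<Theta> by (simp add: compact_diff)
  obtain B where B: "0 < B" "\<And>s. s \<in> \<Theta> \<Longrightarrow> norm (s - \<theta>) \<le> B"
  proof -
    have "bounded ((\<lambda>s. s - \<theta>) ` \<Theta>)"
      using \<Theta> by (intro compact_imp_bounded compact_continuous_image continuous_intros)
    then show ?thesis using that by (auto simp: bounded_pos)
  qed
  have "\<exists>c>0. \<forall>s\<in>?K. c \<le> norm (\<psi> s)"
  proof (cases "?K = {}")
    case False
    obtain s0 where s0: "s0 \<in> ?K" "\<And>s. s \<in> ?K \<Longrightarrow> norm (\<psi> s0) \<le> norm (\<psi> s)"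
      using continuous_attains_inf[OF K False, of "\<lambda>s. norm (\<psi> s)"] cont
      by (metis continuous_on_norm continuous_on_subset Diff_subset)
    have "\<psi> s0 \<noteq> 0" using s0(1) zero(2)[of s0] d(1) by auto
    then show ?thesis using s0 by (intro exI[of _ "norm (\<psi> s0)"]) auto
  qed (auto intro: exI[of _ 1])
  then obtain c where c: "0 < c" "\<And>s. s \<in> ?K \<Longrightarrow> c \<le> norm (\<psi> s)" by blast
  show ?thesis
  proof
    show "0 < min (b / 2) (c / B)" using b c B by simp
    fix s assume s: "s \<in> \<Theta>"
    show "min (b / 2) (c / B) * norm (s - \<theta>) \<le> norm (\<psi> s)"
    proof (cases "norm (s - \<theta>) < d")
      case True
      have "min (b / 2) (c / B) * norm (s - \<theta>) \<le> b / 2 * norm (s - \<theta>)"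
        by (intro mult_right_mono min.cobounded1) auto
      then show ?thesis using near[OF True] by linarith
    next
      case False
      then have "c \<le> norm (\<psi> s)"
        using s by (intro c) (auto simp: dist_norm norm_minus_commute)
      moreover have "min (b / 2) (c / B) * norm (s - \<theta>) \<le> c / B * B"
        using B(1) c(1) by (intro mult_mono min.cobounded2 B(2) s) auto
      ultimately show ?thesis using B(1) by simp
    qed
  qed
qed

text \<open>\<delta> is uniform in \<open>F\<close>, which may be any perturbation of y - \<psi>
  that is exact at \<theta>; the projected residual of each sample is such an \<open>F\<close>. The
  minimiser and the least-squares point \<theta> + Dp y are compared by Pythagoras: a residual
  almost as short as the least-squares residual has only a small extra component in the range of
  \<open>D\<close>.\<close>

lemma minimizer_expansion:
  fixes \<psi> :: "'a::euclidean_space \<Rightarrow> 'b::euclidean_space" and Dp :: "'b \<Rightarrow> 'a"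
  assumes \<Theta>: "compact \<Theta>" and int: "\<theta> \<in> interior \<Theta>" and cont: "continuous_on \<Theta> \<psi>"
    and zero: "\<psi> \<theta> = 0" "\<And>s. s \<in> \<Theta> \<Longrightarrow> \<psi> s = 0 \<Longrightarrow> s = \<theta>"
    and deriv: "(\<psi> has_derivative D) (at \<theta>)" and inj: "\<And>x. D x = 0 \<Longrightarrow> x = 0"
    and Dp: "linear Dp" and orth: "\<And>y x. (y - D (Dp y)) \<bullet> D x = 0"
    and \<epsilon>: "0 < \<epsilon>"
  shows "\<exists>\<delta>>0. \<forall>y \<tau> F s. norm y < \<delta> \<longrightarrow> \<tau> < \<delta> \<longrightarrow> (\<forall>s\<in>\<Theta>. norm (F s - (y - \<psi> s)) \<le> \<tau> * norm (s - \<theta>)) \<longrightarrow>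
     s \<in> \<Theta> \<longrightarrow> (\<forall>s'\<in>\<Theta>. norm (F s) \<le> norm (F s')) \<longrightarrow> norm (s - \<theta> - Dp y) \<le> \<epsilon> * norm y"
proof -
  have D: "linear D" by (rule has_derivative_linear[OF deriv])
  obtain b where b: "0 < b" "\<And>x. b * norm x \<le> norm (D x)"
    using linear_injective_lower_bound[OF D inj] by blast
  obtain c where c: "0 < c" "\<And>s. s \<in> \<Theta> \<Longrightarrow> c * norm (s - \<theta>) \<le> norm (\<psi> s)"
    using lower_bound_compact[OF \<Theta> cont zero deriv inj] by blast
  obtain M where M: "0 < M" "\<And>y. norm (Dp y) \<le> M * norm y"
    using linear_bounded_pos[OF Dp] by (metis mult.commute)
  \<comment> \<open>Both competitors stay within C |y| of \<theta>: \<open>M\<close> bounds the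
    least-squares step, 4 / c the minimiser.\<close>
  define C where "C = max M (4 / c)"
  have C: "0 < C" "M \<le> C" "4 / c \<le> C" using M by (auto simp: C_def)
  \<comment> \<open>Anticipates the final estimate |q|^2 \<le> 8 e |y|^2, which has to be at most (b
    \<epsilon> |y|)^2.\<close>
  define e where "e = min 1 ((b * \<epsilon>)\<^sup>2 / 8)"
  have e: "0 < e" "e \<le> 1" "8 * e \<le> (b * \<epsilon>)\<^sup>2" using b(1) \<epsilon> by (auto simp: e_def)
  define e' where "e' = e / (2 * C)"
  have e': "0 < e'" "e' * C = e / 2" using e C by (auto simp: e'_def)
  have "\<forall>e>0. \<exists>d>0. \<forall>s. norm (s - \<theta>) < d \<longrightarrow> norm (\<psi> s - \<psi> \<theta> - D (s - \<theta>)) \<le> e * norm (s - \<theta>)"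
    using deriv[unfolded has_derivative_within_alt[where s=UNIV, simplified]] by simp
  then obtain d where d: "0 < d" "\<And>s. norm (s - \<theta>) < d \<Longrightarrow> norm (\<psi> s - D (s - \<theta>)) \<le> e' * norm (s - \<theta>)"
    using e'(1) zero(1) by (metis diff_zero)
  obtain r where r: "0 < r" "ball \<theta> r \<subseteq> \<Theta>"
    using int by (auto simp: mem_interior)
  \<comment> \<open>c / 2 lets the perturbation be absorbed by the lower bound on \<psi>, and e'
    makes it small against the linear term; d / C keeps both competitors where the derivative
    estimate holds, r / C keeps the least-squares point inside \<Theta>.\<close>
  define \<delta> where "\<delta> = min (min (c / 2) e') (min d r / C)"
  show ?thesis
  proof (intro exI[of _ \<delta>] conjI allI impI)
    show "0 < \<delta>" using c e' d r C by (simp add: \<delta>_def)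
    fix y :: 'b and \<tau> :: real and F :: "'a \<Rightarrow> 'b" and s :: 'a
    assume y: "norm y < \<delta>" and \<tau>: "\<tau> < \<delta>" and F: "\<forall>s\<in>\<Theta>. norm (F s - (y - \<psi> s)) \<le> \<tau> * norm (s - \<theta>)"
      and s: "s \<in> \<Theta>" and min: "\<forall>s'\<in>\<Theta>. norm (F s) \<le> norm (F s')"
    have \<tau>': "\<tau> \<le> c / 2" "\<tau> \<le> e'" using \<tau> by (auto simp: \<delta>_def)
    have "norm y < min d r / C" using y by (simp add: \<delta>_def)
    then have Cy: "C * norm y < d" "C * norm y < r" using C by (auto simp: field_simps)
    have \<theta>: "\<theta> \<in> \<Theta>" using int interior_subset by blast
    have "norm (F \<theta>) = norm y"
      using F[rule_format, OF \<theta>] zero(1) by simp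
    then have Fs: "norm (F s) \<le> norm y" using min \<theta> by fastforce
    \<comment> \<open>A priori rate: \<open>F s\<close> is no longer than \<open>F \<theta>\<close>,
      whose norm is |y|, so the lower bound on \<psi> yields |s - \<theta>| \<le> (4 / c)
      |y|.\<close>
    have "c * norm (s - \<theta>) \<le> norm (\<psi> s)" by (rule c(2)[OF s])
    also have "\<dots> \<le> norm (F s) + norm y + norm (F s - (y - \<psi> s))"
      using norm_triangle_ineq4[of "F s - (y - \<psi> s)" "F s - y"] norm_triangle_ineq4[of "F s" y] by simp
    also have "\<dots> \<le> norm y + norm y + c / 2 * norm (s - \<theta>)"
      using Fs F[rule_format, OF s] mult_right_mono[OF \<tau>'(1), of "norm (s - \<theta>)"] by simp
    finally have "norm (s - \<theta>) \<le> 4 / c * norm y" using c(1) by (simp add: field_simps)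
    also have "\<dots> \<le> C * norm y" using C by (intro mult_right_mono) auto
    finally have sC: "norm (s - \<theta>) \<le> C * norm y" .
    have approx: "norm (F s' - (y - D (s' - \<theta>))) \<le> e * norm y" if s': "s' \<in> \<Theta>" "norm (s' - \<theta>) \<le> C * norm y" for s'
    proof -
      have "norm (F s' - (y - D (s' - \<theta>))) \<le> norm (F s' - (y - \<psi> s')) + norm (\<psi> s' - D (s' - \<theta>))"
        using norm_triangle_ineq4[of "F s' - (y - \<psi> s')" "\<psi> s' - D (s' - \<theta>)"] by (simp add: algebra_simps)
      also have "\<dots> \<le> \<tau> * norm (s' - \<theta>) + e' * norm (s' - \<theta>)"
        using F s' d(2)[of s'] Cy by (intro add_mono) auto
      also have "\<dots> \<le> e' * norm (s' - \<theta>) + e' * norm (s' - \<theta>)"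
        using \<tau>' by (intro add_mono mult_right_mono) auto
      also have "\<dots> \<le> 2 * (e' * (C * norm y))"
        using s' e' by (simp add: mult_left_mono)
      also have "\<dots> = 2 * (e' * C) * norm y" by simp
      also have "\<dots> = e * norm y" by (simp add: e')
      finally show ?thesis .
    qed
    define t where "t = \<theta> + Dp y"
    have tn: "norm (t - \<theta>) \<le> C * norm y"
      using M(2)[of y] mult_right_mono[OF C(2), of "norm y"] by (simp add: t_def)
    have t: "t \<in> \<Theta>"
      using tn Cy r(2) by (auto simp: dist_norm norm_minus_commute)
    \<comment> \<open>\<open>p\<close> is the least-squares residual, orthogonal to the range of
      \<open>D\<close>, and \<open>q\<close> the excess of the minimiser inside that range.\<close>
    define p where "p = y - D (Dp y)"
    define q where "q = D (s - \<theta> - Dp y)"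
    have yD: "y - D (s - \<theta>) = p - q"
      by (simp add: p_def q_def linear_diff[OF D])
    have pq: "p \<bullet> q = 0" unfolding p_def q_def by (rule orth)
    have py: "norm p \<le> norm y"
    proof -
      have "p \<bullet> D (Dp y) = 0" unfolding p_def by (rule orth)
      then have "p \<bullet> p = p \<bullet> y" by (simp add: p_def inner_diff_right)
      then have "norm p * norm p \<le> norm p * norm y"
        using norm_cauchy_schwarz[of p y] by (simp add: power2_norm_eq_inner[symmetric] power2_eq_square)
      then show ?thesis by (cases "p = 0") auto
    qed
    have 1: "norm (F t) \<le> norm p + e * norm y"
      using approx[OF t tn] norm_triangle_sub[of "F t" p] by (simp add: t_def p_def)
    have "norm (p - q) \<le> norm (F s) + e * norm y"
      using approx[OF s sC] norm_triangle_sub[of "y - D (s - \<theta>)" "F s"] by (simp add: yD norm_minus_commute)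
    also have "\<dots> \<le> norm p + 2 * e * norm y" using 1 min[rule_format, OF t] by linarith
    finally have "norm (p - q) \<le> norm p + 2 * e * norm y" .
    then have "(norm (p - q))\<^sup>2 \<le> (norm p + 2 * e * norm y)\<^sup>2"
      by (intro power_mono) auto
    moreover have "(norm (p - q))\<^sup>2 = (norm p)\<^sup>2 + (norm q)\<^sup>2"
      using pq by (simp add: power2_norm_eq_inner inner_diff_left inner_diff_right inner_commute)
    ultimately have "(norm q)\<^sup>2 \<le> 4 * e * norm y * norm p + 4 * e\<^sup>2 * (norm y)\<^sup>2"
      by (simp add: power2_sum power_mult_distrib algebra_simps)
    also have "\<dots> \<le> 4 * e * norm y * norm y + 4 * (e * 1) * (norm y)\<^sup>2"
    proof (rule add_mono)
      show "4 * e * norm y * norm p \<le> 4 * e * norm y * norm y"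
        using e(1) by (intro mult_left_mono py) simp
      have "e\<^sup>2 \<le> e * 1"
        using e unfolding power2_eq_square by (intro mult_left_mono) simp_all
      then have "4 * e\<^sup>2 \<le> 4 * (e * 1)" by simp
      then show "4 * e\<^sup>2 * (norm y)\<^sup>2 \<le> 4 * (e * 1) * (norm y)\<^sup>2"
        by (rule mult_right_mono) simp
    qed
    also have "\<dots> = 8 * e * (norm y)\<^sup>2" by (simp add: power2_eq_square)
    also have "\<dots> \<le> (b * \<epsilon>)\<^sup>2 * (norm y)\<^sup>2" using e(3) by (intro mult_right_mono) auto
    finally have "(norm q)\<^sup>2 \<le> (b * \<epsilon> * norm y)\<^sup>2" by (simp add: power_mult_distrib)
    then have "norm q \<le> b * \<epsilon> * norm y"
      by (rule power2_le_imp_le) (use b(1) \<epsilon> in simp)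
    then have "b * norm (s - \<theta> - Dp y) \<le> b * (\<epsilon> * norm y)"
      using b(2)[of "s - \<theta> - Dp y"] unfolding q_def by (simp add: mult.assoc)
    then show "norm (s - \<theta> - Dp y) \<le> \<epsilon> * norm y" using b(1) by simp
  qed
qed

section \<open>The dynamic model\<close>

locale choice_model = choice_shock g g'
  for g :: "real^('d::finite option) \<Rightarrow> real" and g' :: "real^('d option) \<Rightarrow> real^('d option)" +
  fixes f :: "'d option \<Rightarrow> 'x::finite \<Rightarrow> 'x \<Rightarrow> real" and \<beta> :: real
    and u :: "real^'t::finite \<Rightarrow> 'x \<Rightarrow> real^('d option)"
  assumes beta: "0 \<le> \<beta>" "\<beta> < 1"
    and trans_nonneg: "\<And>a x x'. 0 \<le> f a x x'"
    and trans_sum: "\<And>a x. (\<Sum>x'\<in>UNIV. f a x x') = 1"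
begin

section \<open>Policy evaluation\<close>

abbreviation policy :: "('x \<Rightarrow> real^('d option)) \<Rightarrow> bool" where
  "policy P \<equiv> (\<forall>x. P x \<in> prob_simplex)"

definition cval :: "real^'t \<Rightarrow> real^'x \<Rightarrow> 'x \<Rightarrow> real^('d option)" where
  "cval s V x = (\<chi> a. Cmat u f \<beta> s V x a)"

lemma CD_nth: "CD u f \<beta> s V $ x = Delta (cval s V x)"
  by (simp add: CD_def cval_def)

lemma policy_simps:
  assumes "policy P"
  shows "0 \<le> P x $ a" "(\<Sum>a\<in>UNIV. P x $ a) = 1"
  using assms by (auto simp: prob_simplex_def)

lemma FP_nonneg: "policy P \<Longrightarrow> 0 \<le> FP f P $ x $ x'"
  unfolding FP_def by (auto intro!: sum_nonneg mult_nonneg_nonneg policy_simps trans_nonneg)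

lemma FP_row_sum: "policy P \<Longrightarrow> (\<Sum>x'\<in>UNIV. FP f P $ x $ x') = 1"
proof -
  assume P: "policy P"
  have "(\<Sum>x'\<in>UNIV. FP f P $ x $ x') = (\<Sum>a\<in>UNIV. \<Sum>x'\<in>UNIV. P x $ a * f a x x')"
    unfolding FP_def by (simp, subst sum.swap) simp
  also have "\<dots> = 1"
    using P by (simp add: sum_distrib_left[symmetric] trans_sum policy_simps)
  finally show ?thesis .
qed

lemma sup_norm_contraction:
  fixes w :: "real^'x"
  assumes q: "0 \<le> q" "q < 1" and w: "\<And>x M. (\<And>x'. \<bar>w $ x'\<bar> \<le> M) \<Longrightarrow> \<bar>w $ x\<bar> \<le> K + q * M"
  shows "\<bar>w $ x\<bar> \<le> K / (1 - q)"
proof -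
  define M where "M = Max (range (\<lambda>x. \<bar>w $ x\<bar>))"
  have M: "\<bar>w $ x\<bar> \<le> M" for x unfolding M_def by (rule Max_ge) auto
  have "M \<in> range (\<lambda>x. \<bar>w $ x\<bar>)" unfolding M_def by (rule Max_in) auto
  then obtain x0 where "M = \<bar>w $ x0\<bar>" by auto
  then have "M \<le> K + q * M" using w[OF M, of x0] by simp
  then have "M \<le> K / (1 - q)" using q by (simp add: field_simps)
  then show ?thesis using M[of x] by simp
qed

text \<open>The rows of \<open>FP f P\<close> are probability vectors, so it does not increase the
  sup norm and |w| \<le> K + \<beta> |w|. With K = 0 this also gives invertibility.\<close>

lemma resolvent_bound:
  assumes P: "policy P" and w: "(mat 1 - \<beta> *\<^sub>R FP f P) *v w = r" and r: "\<And>x. \<bar>r $ x\<bar> \<le> K"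
  shows "\<bar>w $ x\<bar> \<le> K / (1 - \<beta>)"
proof (rule sup_norm_contraction[OF beta])
  fix x M assume M: "\<And>x'. \<bar>w $ x'\<bar> \<le> M"
  have "w - \<beta> *\<^sub>R (FP f P *v w) = r"
    using w by (simp add: matrix_vector_mult_diff_rdistrib scaleR_matrix_vector_assoc)
  then have "w = r + \<beta> *\<^sub>R (FP f P *v w)"
    by (simp add: diff_eq_eq)
  then have "w $ x = (r + \<beta> *\<^sub>R (FP f P *v w)) $ x"
    by (rule arg_cong)
  then have "w $ x = r $ x + \<beta> * (\<Sum>x'\<in>UNIV. FP f P $ x $ x' * w $ x')"
    unfolding matrix_vector_mult_def by simp
  moreover have "\<bar>\<Sum>x'\<in>UNIV. FP f P $ x $ x' * w $ x'\<bar> \<le> (\<Sum>x'\<in>UNIV. FP f P $ x $ x' * M)"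
    using P by (intro order_trans[OF sum_abs] sum_mono) (auto simp: abs_mult FP_nonneg M intro!: mult_left_mono)
  then have "\<bar>\<Sum>x'\<in>UNIV. FP f P $ x $ x' * w $ x'\<bar> \<le> M"
    using P by (simp add: sum_distrib_right[symmetric] FP_row_sum)
  then have "\<beta> * \<bar>\<Sum>x'\<in>UNIV. FP f P $ x $ x' * w $ x'\<bar> \<le> \<beta> * M"
    using beta by (intro mult_left_mono)
  then have "\<bar>\<beta> * (\<Sum>x'\<in>UNIV. FP f P $ x $ x' * w $ x')\<bar> \<le> \<beta> * M"
    using beta by (simp add: abs_mult)
  ultimately show "\<bar>w $ x\<bar> \<le> K + \<beta> * M"
    using r[of x] by linarith
qed

lemma resolvent_invertible: "policy P \<Longrightarrow> invertible (mat 1 - \<beta> *\<^sub>R FP f P)"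
proof -
  assume P: "policy P"
  have "w = 0" if "(mat 1 - \<beta> *\<^sub>R FP f P) *v w = 0" for w
    using resolvent_bound[OF P that, of 0] by (auto simp: vec_eq_iff)
  then show ?thesis
    by (simp add: invertible_left_inverse matrix_left_invertible_ker)
qed

definition res :: "('x \<Rightarrow> real^('d option)) \<Rightarrow> real^'x \<Rightarrow> real^'x" where
  "res P r = matrix_inv (mat 1 - \<beta> *\<^sub>R FP f P) *v r"

lemma resolvent_inverse:
  assumes "policy P"
  shows "(mat 1 - \<beta> *\<^sub>R FP f P) ** matrix_inv (mat 1 - \<beta> *\<^sub>R FP f P) = mat 1"
    "matrix_inv (mat 1 - \<beta> *\<^sub>R FP f P) ** (mat 1 - \<beta> *\<^sub>R FP f P) = mat 1"
  using someI_ex[OF resolvent_invertible[OF assms, unfolded invertible_def]] unfolding matrix_inv_def by auto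

lemma res_solves: "policy P \<Longrightarrow> (mat 1 - \<beta> *\<^sub>R FP f P) *v res P r = r"
  unfolding res_def by (simp add: matrix_vector_mul_assoc resolvent_inverse)

lemma res_unique: "policy P \<Longrightarrow> (mat 1 - \<beta> *\<^sub>R FP f P) *v w = r \<Longrightarrow> w = res P r"
  unfolding res_def by (auto simp: matrix_vector_mul_assoc resolvent_inverse)

lemma linear_res: "linear (res P)"
  unfolding res_def by (rule matrix_vector_mul_linear)

lemma VP_res: "VP g u f \<beta> s P = res P (UP g u s P)"
  by (simp add: VP_def res_def)

lemma resolvent_cval:
  assumes "policy P"
  shows "((mat 1 - \<beta> *\<^sub>R FP f P) *v V) $ x = V $ x - (P x \<bullet> cval s V x - P x \<bullet> u s x)"
proof -
  have "P x \<bullet> cval s V x - P x \<bullet> u s x = (\<Sum>a\<in>UNIV. \<Sum>x'\<in>UNIV. \<beta> * (P x $ a * f a x x' * V $ x'))"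
    by (simp add: inner_vec_def cval_def Cmat_def distrib_left sum.distrib sum_distrib_left mult_ac)
  also have "\<dots> = (\<Sum>x'\<in>UNIV. \<beta> * (FP f P $ x $ x' * V $ x'))"
    by (subst sum.swap) (simp add: FP_def sum_distrib_left sum_distrib_right)
  also have "\<dots> = (\<beta> *\<^sub>R (FP f P *v V)) $ x"
    by (simp add: matrix_vector_mult_def sum_distrib_left)
  finally show ?thesis
    by (simp add: matrix_vector_mult_diff_rdistrib scaleR_matrix_vector_assoc)
qed

lemma VP_iff:
  assumes P: "policy P"
  shows "V = VP g u f \<beta> s P \<longleftrightarrow> (\<forall>x. V $ x = eps g (P x) + P x \<bullet> cval s V x)"
proof -
  have "V = VP g u f \<beta> s P \<longleftrightarrow> (mat 1 - \<beta> *\<^sub>R FP f P) *v V = UP g u s P"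
    using res_unique[OF P] res_solves[OF P] VP_res by metis
  also have "\<dots> \<longleftrightarrow> (\<forall>x. V $ x = eps g (P x) + P x \<bullet> cval s V x)"
    unfolding vec_eq_iff resolvent_cval[OF P, of _ _ s] by (auto simp: UP_def inner_vec_def algebra_simps)
  finally show ?thesis .
qed

lemma simplex_one: "p \<in> prob_simplex \<Longrightarrow> p \<bullet> 1 = 1"
  by (simp add: inner_vec_def prob_simplex_def)

lemma nu_Delta: "nu g c = nu g (Iplus (Delta c)) + c $ None"
proof -
  have "c = Iplus (Delta c) + c $ None *\<^sub>R 1" by (simp add: Iplus_Delta)
  then show ?thesis using nu_shift by metis
qed

text \<open>\<open>eps\<close> is the surplus net of expected payoff, normalised by a zero last
  payoff. The general case follows because a constant added to all payoffs raises both sides by that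
  constant, the probabilities summing to 1.\<close>

lemma nu_eps:
  "nu g c = eps g (rho g (Delta c)) + rho g (Delta c) \<bullet> c"
proof -
  have "rho g (Delta c) \<bullet> c = rho g (Delta c) \<bullet> Iplus (Delta c) + c $ None"
    using simplex_one[OF rho_in_simplex, of "Delta c"] by (simp add: Iplus_Delta inner_diff_right)
  then show ?thesis by (simp add: eps_def nu_Delta[of c])
qed

section \<open>The Bellman operator and the value function\<close>

definition bellman :: "real^'t \<Rightarrow> real^'x \<Rightarrow> real^'x" where
  "bellman s V = (\<chi> x. nu g (cval s V x))"

lemma bellman_diff:
  assumes "\<And>x. \<bar>V $ x - W $ x\<bar> \<le> K"
  shows "\<bar>bellman s V $ x - bellman s W $ x\<bar> \<le> \<beta> * K"
  unfolding bellman_def vec_lambda_beta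
proof (rule nu_mono_bound)
  fix a
  have "\<bar>\<Sum>x'\<in>UNIV. f a x x' * (V $ x' - W $ x')\<bar> \<le> (\<Sum>x'\<in>UNIV. f a x x' * K)"
    by (intro order_trans[OF sum_abs] sum_mono) (auto simp: abs_mult trans_nonneg assms intro!: mult_left_mono)
  then have "\<bar>\<Sum>x'\<in>UNIV. f a x x' * (V $ x' - W $ x')\<bar> \<le> K"
    by (simp add: sum_distrib_right[symmetric] trans_sum)
  then have "\<beta> * \<bar>\<Sum>x'\<in>UNIV. f a x x' * (V $ x' - W $ x')\<bar> \<le> \<beta> * K"
    using beta by (intro mult_left_mono)
  moreover have "cval s V x $ a - cval s W x $ a = \<beta> * (\<Sum>x'\<in>UNIV. f a x x' * (V $ x' - W $ x'))"
    by (simp add: cval_def Cmat_def right_diff_distrib sum_subtractf)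
  ultimately show "\<bar>cval s V x $ a - cval s W x $ a\<bar> \<le> \<beta> * K"
    using beta by (simp add: abs_mult)
qed

lemma bellman_unique: "bellman s V = V \<Longrightarrow> bellman s W = W \<Longrightarrow> V = W"
proof -
  assume VW: "bellman s V = V" "bellman s W = W"
  have "\<bar>(V - W) $ x\<bar> \<le> 0 / (1 - \<beta>)" for x
  proof (rule sup_norm_contraction[OF beta])
    fix x M assume "\<And>x'. \<bar>(V - W) $ x'\<bar> \<le> M"
    then show "\<bar>(V - W) $ x\<bar> \<le> 0 + \<beta> * M"
      using bellman_diff[of V W M s x] VW by simp
  qed
  then show ?thesis by (simp add: vec_eq_iff)
qed

text \<open>Brouwer on a cube: the radius solves M0 + \<beta> M = M, so the contraction estimate
  around 0 maps the cube into itself. The same estimate supplies continuity here and, separately,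
  uniqueness.\<close>

lemma bellman_exists: "\<exists>V. bellman s V = V"
proof -
  define M0 where "M0 = Max (range (\<lambda>x. \<bar>bellman s 0 $ x\<bar>))"
  have M0: "\<bar>bellman s 0 $ x\<bar> \<le> M0" for x unfolding M0_def by (rule Max_ge) auto
  then have M0': "0 \<le> M0" using order_trans[OF abs_ge_zero] by blast
  define M where "M = M0 / (1 - \<beta>)"
  have M: "0 \<le> M" "M0 + \<beta> * M = M" using beta M0' by (auto simp: M_def field_simps)
  let ?S = "cbox (\<chi> x. - M) (\<chi> x. M) :: (real^'x) set"
  have "continuous_on ?S (bellman s)"
    unfolding continuous_on_iff
  proof (intro ballI allI impI)
    fix W :: "real^'x" and e :: real assume e: "0 < e"
    define n where "n = real CARD('x)"
    have n: "0 < n" by (simp add: n_def)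
    show "\<exists>d>0. \<forall>V\<in>?S. dist V W < d \<longrightarrow> dist (bellman s V) (bellman s W) < e"
    proof (intro exI[of _ "e / (n + 1)"] conjI ballI impI)
      show "0 < e / (n + 1)" using e n by simp
      fix V assume d: "dist V W < e / (n + 1)"
      have "\<bar>V $ x - W $ x\<bar> \<le> dist V W" for x
        using component_le_norm_cart[of "V - W" x] by (simp add: dist_norm)
      then have b: "\<bar>bellman s V $ x - bellman s W $ x\<bar> \<le> \<beta> * dist V W" for x
        by (rule bellman_diff)
      have "dist (bellman s V) (bellman s W) \<le> (\<Sum>x\<in>UNIV. \<bar>(bellman s V - bellman s W) $ x\<bar>)"
        unfolding dist_norm by (rule norm_le_l1_cart)
      also have "\<dots> \<le> (\<Sum>x\<in>(UNIV :: 'x set). dist V W)"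
      proof (rule sum_mono)
        fix x
        have "\<beta> * dist V W \<le> 1 * dist V W" using beta by (intro mult_right_mono) auto
        then show "\<bar>(bellman s V - bellman s W) $ x\<bar> \<le> dist V W" using b[of x] by simp
      qed
      also have "\<dots> = n * dist V W" by (simp add: n_def)
      also have "\<dots> \<le> (n + 1) * dist V W" by (intro mult_right_mono) auto
      also have "\<dots> < e" using d n by (simp add: field_simps)
      finally show "dist (bellman s V) (bellman s W) < e" .
    qed
  qed
  moreover have "bellman s ` ?S \<subseteq> ?S"
  proof clarify
    fix V assume V: "V \<in> ?S"
    then have "- M \<le> V $ x" "V $ x \<le> M" for x by (auto simp: mem_box_cart)
    then have "\<bar>V $ x - 0 $ x\<bar> \<le> M" for x by (simp add: abs_le_iff minus_le_iff)
    then have bd: "\<bar>bellman s V $ x - bellman s 0 $ x\<bar> \<le> \<beta> * M" for x by (rule bellman_diff)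
    have "\<bar>bellman s V $ x\<bar> \<le> M" for x
      using bd[of x] M0[of x] M(2) by linarith
    then have "- M \<le> bellman s V $ x" "bellman s V $ x \<le> M" for x by (simp_all add: abs_le_iff minus_le_iff)
    then show "bellman s V \<in> ?S" by (auto simp: mem_box_cart)
  qed
  moreover have "?S \<noteq> {}" using M by (auto simp: interval_ne_empty_cart)
  ultimately show ?thesis
    using brouwer[OF compact_cbox convex_box(1), of "\<chi> x. - M" "\<chi> x. M" "bellman s"] by blast
qed

lemma Vstar_eq: "bellman s (Vstar g u f \<beta> s) = Vstar g u f \<beta> s"
  and Vstar_unique: "bellman s V = V \<Longrightarrow> V = Vstar g u f \<beta> s"
proof -
  have form: "(\<forall>x. V $ x = nu g (u s x + \<beta> *\<^sub>R (\<Sum>x'\<in>UNIV. V $ x' *\<^sub>R (\<chi> a. f a x x')))) \<longleftrightarrow> bellman s V = V" for V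
  proof -
    have eq: "u s x + \<beta> *\<^sub>R (\<Sum>x'\<in>UNIV. V $ x' *\<^sub>R (\<chi> a. f a x x')) = cval s V x" for x
      by (simp add: cval_def Cmat_def vec_eq_iff mult.commute)
    show ?thesis
      by (simp only: eq bellman_def vec_eq_iff vec_lambda_beta) (rule iff_allI, rule eq_commute)
  qed
  have ex1: "\<exists>!V. bellman s V = V"
    using bellman_exists bellman_unique by blast
  show "bellman s (Vstar g u f \<beta> s) = Vstar g u f \<beta> s"
    unfolding Vstar_def form by (rule theI'[OF ex1])
  then show "bellman s V = V \<Longrightarrow> V = Vstar g u f \<beta> s"
    using bellman_unique by blast
qed

lemma Pstar_eq: "Pstar g u f \<beta> s x = rho g (Delta (cval s (Vstar g u f \<beta> s) x))"
  by (simp add: Pstar_def CD_nth)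

lemma policy_Pstar: "policy (Pstar g u f \<beta> s)"
  by (simp add: Pstar_eq rho_in_simplex)

lemma VP_Pstar: "VP g u f \<beta> s (Pstar g u f \<beta> s) = Vstar g u f \<beta> s"
proof -
  have "Vstar g u f \<beta> s $ x = eps g (Pstar g u f \<beta> s x) + Pstar g u f \<beta> s x \<bullet> cval s (Vstar g u f \<beta> s) x" for x
  proof -
    have "Vstar g u f \<beta> s $ x = bellman s (Vstar g u f \<beta> s) $ x" by (simp add: Vstar_eq)
    also have "\<dots> = nu g (cval s (Vstar g u f \<beta> s) x)" by (simp add: bellman_def)
    also have "\<dots> = eps g (Pstar g u f \<beta> s x) + Pstar g u f \<beta> s x \<bullet> cval s (Vstar g u f \<beta> s) x"
      unfolding Pstar_eq by (rule nu_eps)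
    finally show ?thesis .
  qed
  then show ?thesis using VP_iff[OF policy_Pstar] by metis
qed

text \<open>Equal utility differences at \<open>s\<close> and \<theta> make \<open>P\<close> the
  \<open>rho\<close>-response to the payoffs at \<open>s\<close> under \<open>V\<close>.
  \<open>nu_eps\<close> then turns the entropy form of policy evaluation into the Bellman equation
  at \<open>s\<close>.\<close>

lemma identification:
  assumes P: "P = Pstar g u f \<beta> \<theta>" and eq: "CD u f \<beta> s (VP g u f \<beta> s P) = CD u f \<beta> \<theta> (VP g u f \<beta> \<theta> P)"
  shows "Pstar g u f \<beta> s = P"
proof -
  define V where "V = VP g u f \<beta> s P"
  have pol: "policy P" using P policy_Pstar by simp
  have D: "Delta (cval s V x) = Delta (cval \<theta> (Vstar g u f \<beta> \<theta>) x)" for x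
    using eq by (metis CD_nth P V_def VP_Pstar)
  then have Px: "P x = rho g (Delta (cval s V x))" for x by (simp add: P Pstar_eq)
  have "\<forall>x. V $ x = eps g (P x) + P x \<bullet> cval s V x"
    using VP_iff[OF pol, of V s] V_def by blast
  then have "V $ x = nu g (cval s V x)" for x
    unfolding nu_eps[of "cval s V x"] Px[symmetric] by blast
  then have "bellman s V = V" by (simp add: bellman_def vec_eq_iff)
  then have "V = Vstar g u f \<beta> s" by (rule Vstar_unique)
  then show ?thesis using Px by (simp add: fun_eq_iff Pstar_eq)
qed

text \<open>\<open>eps\<close> contains \<open>rho_inv\<close>, so the objective is pulled back to
  \<open>m\<close> in the variable w = rho_inv p. At \<open>v\<close> the terms from
  \<open>nu\<close> and from - Iplus w cancel because the gradient of \<open>nu\<close> is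
  \<open>rho\<close>, and the term with \<open>Drho\<close> is paired with Iplus v - Iplus v =
  0.\<close>

lemma envelope_has_derivative:
  "((\<lambda>p. eps g p + p \<bullet> c) has_derivative (\<lambda>_. 0)) (at (rho g (Delta c)) within prob_simplex)"
proof -
  define v where "v = Delta c"
  define m where "m w = nu g (Iplus w) + rho g w \<bullet> (Iplus v - Iplus w) + c $ None" for w
  have "(m has_derivative (\<lambda>h. (\<Sum>a\<in>UNIV. Iplus h $ a * cprob (Iplus v) a) + (rho g v \<bullet> (- Iplus h) + Drho v h \<bullet> (Iplus v - Iplus v)) + 0)) (at v)"
    unfolding m_def
  proof (intro has_derivative_add has_derivative_const has_derivative_inner rho_has_derivative)
    show "((\<lambda>w. nu g (Iplus w)) has_derivative (\<lambda>h. \<Sum>a\<in>UNIV. Iplus h $ a * cprob (Iplus v) a)) (at v)"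
      by (rule has_derivative_compose[where g="nu g", OF linear_imp_has_derivative[OF linear_Iplus] nu_has_derivative])
    show "((\<lambda>w. Iplus v - Iplus w) has_derivative (\<lambda>h. - Iplus h)) (at v)"
      using has_derivative_diff[OF has_derivative_const linear_imp_has_derivative[OF linear_Iplus]] by simp
  qed
  moreover have "(\<Sum>a\<in>UNIV. Iplus h $ a * cprob (Iplus v) a) = rho g v \<bullet> Iplus h" for h
    by (simp add: inner_vec_def rho_nth mult.commute)
  ultimately have "(m has_derivative (\<lambda>_. 0)) (at v)" by simp
  then have "((\<lambda>p. m (rho_inv g p)) has_derivative (\<lambda>_. 0)) (at (rho g v) within prob_simplex)"
    using has_derivative_compose[OF rho_inv_has_derivative[of v], of m "\<lambda>_. 0"] by simp
  moreover have "\<forall>\<^sub>F p in at (rho g v) within prob_simplex. m (rho_inv g p) = eps g p + p \<bullet> c"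
  proof -
    have "\<forall>\<^sub>F p in at (rho g v) within prob_simplex. p \<in> prob_simplex"
      by (simp add: eventually_at_filter)
    with eventually_rho_rho_inv[of v] show ?thesis
    proof eventually_elim
      case (elim p)
      have "c = Iplus v + c $ None *\<^sub>R 1" by (simp add: v_def Iplus_Delta)
      then have "p \<bullet> c = p \<bullet> Iplus v + c $ None"
        by (metis inner_add_right inner_scaleR_right mult.right_neutral simplex_one[OF elim(2)])
      then show ?case by (simp add: m_def elim(1) eps_def inner_diff_right)
    qed
  qed
  moreover have "m (rho_inv g (rho g v)) = eps g (rho g v) + rho g v \<bullet> c"
    using nu_eps[of c] nu_Delta[of c] by (simp add: m_def v_def)
  ultimately show ?thesis
    unfolding v_def[symmetric] by (rule has_derivative_transform_eventually) (auto simp: rho_in_simplex)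
qed

end

section \<open>Sensitivity of the values to policy and parameter\<close>

lemma norm_vec_le_sum: "norm (y :: 'b::real_normed_vector^'x::finite) \<le> (\<Sum>x\<in>UNIV. norm (y $ x))"
  unfolding norm_vec_def by (rule L2_set_le_sum) simp

lemma has_derivative_bound:
  fixes \<phi> :: "'a::real_normed_vector \<Rightarrow> 'b::real_normed_vector"
  assumes "(\<phi> has_derivative L) (at a within S)" "0 < e"
  shows "\<exists>d>0. \<forall>p\<in>S. norm (p - a) < d \<longrightarrow> norm (\<phi> p - \<phi> a - L (p - a)) \<le> e * norm (p - a)"
  using assms unfolding has_derivative_within_alt by blast

context choice_model
begin

lemma CD_diff_bound:
  assumes "\<And>x. \<bar>V $ x - W $ x\<bar> \<le> K"
  shows "norm (CD u f \<beta> s V - CD u f \<beta> s W) \<le> 2 * real CARD('x) * real CARD('d) * K"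
proof -
  have c: "\<bar>cval s V x $ a - cval s W x $ a\<bar> \<le> K" for x a
  proof -
    have "\<bar>\<Sum>x'\<in>UNIV. f a x x' * (V $ x' - W $ x')\<bar> \<le> (\<Sum>x'\<in>UNIV. f a x x' * K)"
      by (intro order_trans[OF sum_abs] sum_mono) (auto simp: abs_mult trans_nonneg assms intro!: mult_left_mono)
    then have 1: "\<bar>\<Sum>x'\<in>UNIV. f a x x' * (V $ x' - W $ x')\<bar> \<le> K"
      by (simp add: sum_distrib_right[symmetric] trans_sum)
    have "\<beta> * \<bar>\<Sum>x'\<in>UNIV. f a x x' * (V $ x' - W $ x')\<bar> \<le> 1 * K"
      using beta 1 by (intro mult_mono) auto
    moreover have "cval s V x $ a - cval s W x $ a = \<beta> * (\<Sum>x'\<in>UNIV. f a x x' * (V $ x' - W $ x'))"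
      by (simp add: cval_def Cmat_def right_diff_distrib sum_subtractf)
    ultimately show ?thesis
      using beta by (simp add: abs_mult)
  qed
  have "norm ((CD u f \<beta> s V - CD u f \<beta> s W) $ x) \<le> real CARD('d) * (2 * K)" for x
  proof -
    have "norm ((CD u f \<beta> s V - CD u f \<beta> s W) $ x) \<le> (\<Sum>d\<in>UNIV. \<bar>(CD u f \<beta> s V - CD u f \<beta> s W) $ x $ d\<bar>)"
      by (rule norm_le_l1_cart)
    also have "\<dots> \<le> (\<Sum>d\<in>(UNIV :: 'd set). 2 * K)"
    proof (rule sum_mono)
      fix d
      show "\<bar>(CD u f \<beta> s V - CD u f \<beta> s W) $ x $ d\<bar> \<le> 2 * K"
        using c[of x "Some d"] c[of x None] by (simp add: CD_nth Delta_def)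
    qed
    finally show ?thesis by simp
  qed
  then have "norm (CD u f \<beta> s V - CD u f \<beta> s W) \<le> (\<Sum>x\<in>(UNIV :: 'x set). real CARD('d) * (2 * K))"
    by (intro order_trans[OF norm_vec_le_sum sum_mono])
  then show ?thesis by (simp add: mult_ac)
qed

definition Y :: "real^'t \<Rightarrow> ('x \<Rightarrow> real^('d option)) \<Rightarrow> real^'d^'x" where
  "Y s P = CD u f \<beta> s (VP g u f \<beta> s P)"

definition pdist :: "('x \<Rightarrow> real^('d option)) \<Rightarrow> ('x \<Rightarrow> real^('d option)) \<Rightarrow> real" where
  "pdist P R = (\<Sum>x\<in>UNIV. norm (P x - R x))"

lemma pdist_ge: "norm (P x - R x) \<le> pdist P R"
  unfolding pdist_def by (rule member_le_sum) auto

lemma pdist_nonneg: "0 \<le> pdist P R"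
  unfolding pdist_def by (rule sum_nonneg) auto

text \<open>The value change W - V solves the evaluation equation of \<open>P\<close> whose
  right-hand side is the one-step change from using \<open>P\<close> against \<open>V\<close>. The
  envelope derivative makes that o(|P - R|), and \<open>resolvent_bound\<close> carries it over to
  the values.\<close>

lemma envelope_bound:
  assumes "0 < \<epsilon>"
  shows "\<exists>\<delta>>0. \<forall>P. policy P \<longrightarrow> pdist P (Pstar g u f \<beta> \<theta>) < \<delta> \<longrightarrow>
    norm (Y \<theta> P - Y \<theta> (Pstar g u f \<beta> \<theta>)) \<le> \<epsilon> * pdist P (Pstar g u f \<beta> \<theta>)"
proof -
  define R where "R = Pstar g u f \<beta> \<theta>"
  define V where "V = Vstar g u f \<beta> \<theta>"
  have R: "policy R" "VP g u f \<beta> \<theta> R = V" using policy_Pstar VP_Pstar by (auto simp: R_def V_def)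
  have Rx: "R x = rho g (Delta (cval \<theta> V x))" for x by (simp add: R_def V_def Pstar_eq)
  define c0 where "c0 = 2 * real CARD('x) * real CARD('d)"
  have c0: "0 < c0" by (simp add: c0_def)
  \<comment> \<open>Offsets the factor 1 / (1 - \<beta>) of the resolvent and the factor
    \<open>c0\<close> of \<open>CD_diff_bound\<close>.\<close>
  define e where "e = \<epsilon> * (1 - \<beta>) / c0"
  have e: "0 < e" using assms beta c0 by (simp add: e_def)
  have "\<exists>d>0. \<forall>p\<in>prob_simplex. norm (p - R x) < d \<longrightarrow>
      norm (eps g p + p \<bullet> cval \<theta> V x - V $ x) \<le> e * norm (p - R x)" for x
  proof -
    have "V $ x = eps g (R x) + R x \<bullet> cval \<theta> V x"
      using VP_iff[OF R(1), of V \<theta>] R(2) by blast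
    then show ?thesis
      using has_derivative_bound[OF envelope_has_derivative[of "cval \<theta> V x", folded Rx] e] by simp
  qed
  then obtain d where d: "\<And>x. 0 < d x" "\<And>x p. p \<in> prob_simplex \<Longrightarrow> norm (p - R x) < d x \<Longrightarrow>
      norm (eps g p + p \<bullet> cval \<theta> V x - V $ x) \<le> e * norm (p - R x)"
    by metis
  define \<delta> where "\<delta> = Min (range d)"
  have \<delta>: "0 < \<delta>" "\<And>x. \<delta> \<le> d x" using d(1) by (auto simp: \<delta>_def)
  show ?thesis
    unfolding R_def[symmetric]
  proof (intro exI[of _ \<delta>] conjI \<delta>(1) allI impI)
    fix P assume P: "policy P" "pdist P R < \<delta>"
    define W where "W = VP g u f \<beta> \<theta> P"
    have W: "W $ x = eps g (P x) + P x \<bullet> cval \<theta> W x" for x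
      using VP_iff[OF P(1), of W \<theta>] by (simp add: W_def)
    have "\<bar>(W - V) $ x\<bar> \<le> e * pdist P R / (1 - \<beta>)" for x
    proof (rule resolvent_bound[OF P(1) refl])
      fix x
      have "((mat 1 - \<beta> *\<^sub>R FP f P) *v (W - V)) $ x = ((mat 1 - \<beta> *\<^sub>R FP f P) *v W) $ x - ((mat 1 - \<beta> *\<^sub>R FP f P) *v V) $ x"
        by (simp add: matrix_vector_mult_diff_distrib)
      also have "\<dots> = eps g (P x) + P x \<bullet> cval \<theta> V x - V $ x"
        unfolding resolvent_cval[OF P(1), of _ _ \<theta>] using W[of x] by linarith
      finally have eq: "((mat 1 - \<beta> *\<^sub>R FP f P) *v (W - V)) $ x = eps g (P x) + P x \<bullet> cval \<theta> V x - V $ x" .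
      have "norm (P x - R x) < d x"
        using pdist_ge[of P x R] P(2) \<delta>(2)[of x] by linarith
      then have "\<bar>eps g (P x) + P x \<bullet> cval \<theta> V x - V $ x\<bar> \<le> e * norm (P x - R x)"
        using d(2)[of "P x" x] P(1) by simp
      also have "\<dots> \<le> e * pdist P R" using e pdist_ge by (intro mult_left_mono) auto
      finally show "\<bar>((mat 1 - \<beta> *\<^sub>R FP f P) *v (W - V)) $ x\<bar> \<le> e * pdist P R" by (simp only: eq)
    qed
    then have "norm (CD u f \<beta> \<theta> W - CD u f \<beta> \<theta> V) \<le> c0 * (e * pdist P R / (1 - \<beta>))"
      unfolding c0_def by (intro CD_diff_bound) simp
    also have "\<dots> = \<epsilon> * pdist P R"
      using beta c0 by (simp add: e_def)
    finally show "norm (Y \<theta> P - Y \<theta> R) \<le> \<epsilon> * pdist P R"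
      by (simp add: Y_def W_def R(2))
  qed
qed

definition umean :: "('x \<Rightarrow> real^('d option)) \<Rightarrow> ('x \<Rightarrow> real^('d option)) \<Rightarrow> real^'x" where
  "umean P w = (\<chi> x. P x \<bullet> w x)"

definition fut :: "real^'x \<Rightarrow> real^'d^'x" where
  "fut V = (\<chi> x. Delta (\<chi> a. \<beta> * (\<Sum>x'\<in>UNIV. f a x x' * V $ x')))"

lemma linear_fut: "linear fut"
  by (rule linearI)
    (auto simp: fut_def vec_eq_iff Delta_def algebra_simps sum.distrib sum_distrib_left)

lemma CD_fut: "CD u f \<beta> s V = (\<chi> x. Delta (u s x)) + fut V"
  by (auto simp: CD_def fut_def vec_eq_iff Delta_def Cmat_def)

lemma norm_simplex: "p \<in> prob_simplex \<Longrightarrow> norm p \<le> 1"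
  using norm_le_l1_cart[of p] by (auto simp: prob_simplex_def)

lemma VP_diff:
  "VP g u f \<beta> s P - VP g u f \<beta> s' P = res P (umean P (\<lambda>x. u s x - u s' x))"
proof -
  have "UP g u s P - UP g u s' P = umean P (\<lambda>x. u s x - u s' x)"
    by (auto simp: UP_def umean_def vec_eq_iff inner_vec_def right_diff_distrib sum_subtractf)
  then show ?thesis
    unfolding VP_res by (metis linear_diff linear_res)
qed

text \<open>At a fixed policy the entropy term cancels from Y s P - Y s' P, which leaves a linear
  function of the utility increment. Its coefficients, the policy weights and the resolvent, are
  Lipschitz in the policy, hence the product of the two sizes on the right.\<close>

lemma policy_perturbation_bound:
  assumes R: "policy R"
  shows "\<exists>C>0. \<forall>P s s'. policy P \<longrightarrow>
     norm (Y s P - Y s' P - (Y s R - Y s' R)) \<le> C * pdist P R * (\<Sum>x\<in>UNIV. norm (u s x - u s' x))"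
proof -
  define A where "A = real CARD('d option)"
  define c0 where "c0 = 2 * real CARD('x) * real CARD('d)"
  have pos: "0 < A" "0 < c0" by (auto simp: A_def c0_def)
  define C where "C = c0 * ((1 + A / (1 - \<beta>)) / (1 - \<beta>))"
  have "0 < 1 + A / (1 - \<beta>)" using pos beta by (intro add_pos_pos) auto
  then have C: "0 < C" using pos beta by (simp add: C_def)
  show ?thesis
  proof (intro exI[of _ C] conjI C allI impI)
    fix P s s' assume P: "policy P"
    define w where "w x = u s x - u s' x" for x
    define W where "W = (\<Sum>x\<in>UNIV. norm (w x))"
    have wW: "norm (w x) \<le> W" for x unfolding W_def by (rule member_le_sum) auto
    then have W0: "0 \<le> W" using order_trans[OF norm_ge_zero] by blast
    define a where "a = res P (umean P w)"
    define b where "b = res R (umean R w)"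
    have b: "\<bar>b $ x\<bar> \<le> W / (1 - \<beta>)" for x
    proof (rule resolvent_bound[OF R])
      show "(mat 1 - \<beta> *\<^sub>R FP f R) *v b = umean R w" unfolding b_def by (rule res_solves[OF R])
      fix x
      have "\<bar>R x \<bullet> w x\<bar> \<le> norm (R x) * norm (w x)" by (rule Cauchy_Schwarz_ineq2)
      also have "\<dots> \<le> 1 * W" using R norm_simplex wW by (intro mult_mono) auto
      finally show "\<bar>umean R w $ x\<bar> \<le> W" by (simp add: umean_def)
    qed
    have ab: "\<bar>(a - b) $ x\<bar> \<le> (pdist P R * W * (1 + A / (1 - \<beta>))) / (1 - \<beta>)" for x
    proof (rule resolvent_bound[OF P refl])
      fix x
      \<comment> \<open>Subtracting the two evaluation equations puts the operator of
        \<open>P\<close> in front; the difference of transition matrices then acts on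
        \<open>b\<close>, which is already bounded.\<close>
      have "(mat 1 - \<beta> *\<^sub>R FP f P) *v (a - b) = umean P w - (umean R w - (\<beta> *\<^sub>R FP f P - \<beta> *\<^sub>R FP f R) *v b)"
      proof -
        have "(mat 1 - \<beta> *\<^sub>R FP f P) *v a = umean P w" "(mat 1 - \<beta> *\<^sub>R FP f R) *v b = umean R w"
          unfolding a_def b_def by (rule res_solves[OF P], rule res_solves[OF R])
        then show ?thesis
          by (simp add: matrix_vector_mult_diff_distrib matrix_vector_mult_diff_rdistrib algebra_simps)
      qed
      then have "((mat 1 - \<beta> *\<^sub>R FP f P) *v (a - b)) $ x
         = (P x - R x) \<bullet> w x + ((\<beta> *\<^sub>R FP f P - \<beta> *\<^sub>R FP f R) *v b) $ x"
        by (simp add: umean_def inner_diff_left)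
      also have "((\<beta> *\<^sub>R FP f P - \<beta> *\<^sub>R FP f R) *v b) $ x = (\<Sum>x'\<in>UNIV. \<Sum>i\<in>UNIV. \<beta> * ((P x - R x) $ i * (f i x x' * b $ x')))"
        by (simp add: matrix_vector_mult_def FP_def sum_distrib_left sum_subtractf[symmetric] sum_distrib_right algebra_simps)
      also have "\<dots> = (\<Sum>i\<in>UNIV. (P x - R x) $ i * (\<beta> * (\<Sum>x'\<in>UNIV. f i x x' * b $ x')))"
        by (subst sum.swap) (simp add: sum_distrib_left mult_ac)
      finally have eq: "((mat 1 - \<beta> *\<^sub>R FP f P) *v (a - b)) $ x
         = (P x - R x) \<bullet> w x + (\<Sum>i\<in>UNIV. (P x - R x) $ i * (\<beta> * (\<Sum>x'\<in>UNIV. f i x x' * b $ x')))" .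
      have "\<bar>(P x - R x) \<bullet> w x\<bar> \<le> norm (P x - R x) * norm (w x)" by (rule Cauchy_Schwarz_ineq2)
      also have "\<dots> \<le> pdist P R * W" using pdist_ge wW pdist_nonneg by (intro mult_mono) auto
      finally have 1: "\<bar>(P x - R x) \<bullet> w x\<bar> \<le> pdist P R * W" .
      have inner: "\<bar>\<beta> * (\<Sum>x'\<in>UNIV. f i x x' * b $ x')\<bar> \<le> W / (1 - \<beta>)" for i
      proof -
        have "\<bar>\<Sum>x'\<in>UNIV. f i x x' * b $ x'\<bar> \<le> (\<Sum>x'\<in>UNIV. f i x x' * (W / (1 - \<beta>)))"
        proof (intro order_trans[OF sum_abs sum_mono])
          fix x'
          show "\<bar>f i x x' * b $ x'\<bar> \<le> f i x x' * (W / (1 - \<beta>))"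
            unfolding abs_mult abs_of_nonneg[OF trans_nonneg] by (intro mult_left_mono b trans_nonneg)
        qed
        then have "\<bar>\<Sum>x'\<in>UNIV. f i x x' * b $ x'\<bar> \<le> W / (1 - \<beta>)"
          by (simp add: sum_divide_distrib[symmetric] sum_distrib_right[symmetric] trans_sum)
        then have "\<beta> * \<bar>\<Sum>x'\<in>UNIV. f i x x' * b $ x'\<bar> \<le> 1 * (W / (1 - \<beta>))"
          using beta by (intro mult_mono) auto
        then show ?thesis using beta by (simp add: abs_mult)
      qed
      have "\<bar>\<Sum>i\<in>UNIV. (P x - R x) $ i * (\<beta> * (\<Sum>x'\<in>UNIV. f i x x' * b $ x'))\<bar> \<le> (\<Sum>i\<in>(UNIV :: 'd option set). pdist P R * (W / (1 - \<beta>)))"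
      proof (intro order_trans[OF sum_abs] sum_mono)
        fix i
        have "\<bar>(P x - R x) $ i\<bar> \<le> pdist P R"
          using component_le_norm_cart[of "P x - R x" i] pdist_ge[of P x R] by linarith
        then show "\<bar>(P x - R x) $ i * (\<beta> * (\<Sum>x'\<in>UNIV. f i x x' * b $ x'))\<bar> \<le> pdist P R * (W / (1 - \<beta>))"
          unfolding abs_mult[of "(P x - R x) $ i"] using inner pdist_nonneg by (intro mult_mono) auto
      qed
      also have "\<dots> = A * (pdist P R * (W / (1 - \<beta>)))" by (simp add: A_def)
      finally have 2: "\<bar>\<Sum>i\<in>UNIV. (P x - R x) $ i * (\<beta> * (\<Sum>x'\<in>UNIV. f i x x' * b $ x'))\<bar> \<le> A * (pdist P R * (W / (1 - \<beta>)))" .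
      have "pdist P R * W * (1 + A / (1 - \<beta>)) = pdist P R * W + A * (pdist P R * (W / (1 - \<beta>)))"
        by (simp add: algebra_simps)
      then show "\<bar>((mat 1 - \<beta> *\<^sub>R FP f P) *v (a - b)) $ x\<bar> \<le> pdist P R * W * (1 + A / (1 - \<beta>))"
        unfolding eq using 1 2 by linarith
    qed
    have "Y s Q - Y s' Q = (\<chi> x. Delta (w x)) + fut (res Q (umean Q w))" for Q
    proof -
      have "Y s Q - Y s' Q = (\<chi> x. Delta (w x)) + (fut (VP g u f \<beta> s Q) - fut (VP g u f \<beta> s' Q))"
        unfolding Y_def CD_fut by (auto simp: vec_eq_iff w_def Delta_def)
      then show ?thesis
        unfolding linear_diff[OF linear_fut, symmetric] VP_diff w_def .
    qed
    then have Ydiff: "Y s P - Y s' P - (Y s R - Y s' R) = CD u f \<beta> s a - CD u f \<beta> s b"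
      by (simp add: CD_fut a_def b_def)
    have "norm (Y s P - Y s' P - (Y s R - Y s' R)) \<le> c0 * ((pdist P R * W * (1 + A / (1 - \<beta>))) / (1 - \<beta>))"
      unfolding Ydiff c0_def by (rule CD_diff_bound) (use ab in simp)
    also have "\<dots> = C * pdist P R * W" by (simp add: C_def mult_ac)
    finally show "norm (Y s P - Y s' P - (Y s R - Y s' R)) \<le> C * pdist P R * (\<Sum>x\<in>UNIV. norm (u s x - u s' x))"
      by (simp add: W_def w_def)
  qed
qed

text \<open>For fixed \<open>P\<close> the value is affine in the utilities, so
  \<open>VP_diff\<close> reduces the claim to a linear map applied to a utility increment.\<close>

lemma VP_has_derivative:
  assumes "\<And>x. ((\<lambda>s. u s x) has_derivative du x) (at s within S)"
  shows "((\<lambda>s. VP g u f \<beta> s P) has_derivative (\<lambda>k. res P (umean P (\<lambda>x. du x k)))) (at s within S)"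
proof -
  have VP: "VP g u f \<beta> s' P = VP g u f \<beta> s P + res P (umean P (\<lambda>x. u s' x - u s x))" for s'
    using VP_diff[of s' P s] by (simp add: algebra_simps)
  have "((\<lambda>s'. umean P (\<lambda>x. u s' x - u s x)) has_derivative (\<lambda>k. umean P (\<lambda>x. du x k))) (at s within S)"
  proof (subst has_derivative_componentwise_within, intro ballI)
    fix i :: "real^'x" assume "i \<in> Basis"
    then obtain x where i: "i = axis x 1" by (auto simp: Basis_vec_def)
    have "((\<lambda>s'. P x \<bullet> (u s' x - u s x)) has_derivative (\<lambda>k. P x \<bullet> (du x k - 0))) (at s within S)"
      by (intro has_derivative_inner_right has_derivative_diff assms has_derivative_const)
    then show "((\<lambda>s'. umean P (\<lambda>x. u s' x - u s x) \<bullet> i) has_derivative (\<lambda>k. umean P (\<lambda>x. du x k) \<bullet> i)) (at s within S)"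
      by (simp add: i inner_axis umean_def)
  qed
  from has_derivative_compose[OF this linear_imp_has_derivative[OF linear_res]]
  have "((\<lambda>s'. res P (umean P (\<lambda>x. u s' x - u s x))) has_derivative (\<lambda>k. res P (umean P (\<lambda>x. du x k)))) (at s within S)" .
  from has_derivative_add[OF has_derivative_const[of "VP g u f \<beta> s P"] this]
  have D: "((\<lambda>s'. VP g u f \<beta> s P + res P (umean P (\<lambda>x. u s' x - u s x))) has_derivative (\<lambda>k. res P (umean P (\<lambda>x. du x k)))) (at s within S)"
    by simp
  have eqf: "(\<lambda>s'. VP g u f \<beta> s' P) = (\<lambda>s'. VP g u f \<beta> s P + res P (umean P (\<lambda>x. u s' x - u s x)))"
    by (rule ext) (rule VP)
  show ?thesis by (subst eqf) (rule D)
qed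

lemma Y_has_derivative:
  assumes du: "\<And>x. ((\<lambda>s. u s x) has_derivative du x) (at s within S)"
  shows "((\<lambda>s. Y s P) has_derivative (\<lambda>k. (\<chi> x. Delta (du x k)) + fut (res P (umean P (\<lambda>x. du x k))))) (at s within S)"
  unfolding Y_def CD_fut
proof (intro has_derivative_add)
  show "((\<lambda>s. \<chi> x. Delta (u s x)) has_derivative (\<lambda>k. \<chi> x. Delta (du x k))) (at s within S)"
  proof (subst has_derivative_componentwise_within, intro ballI)
    fix i :: "real^'d^'x" assume "i \<in> Basis"
    then obtain x j where i: "i = axis x j" by (auto simp: Basis_vec_def)
    have "((\<lambda>s. Delta (u s x) \<bullet> j) has_derivative (\<lambda>k. Delta (du x k) \<bullet> j)) (at s within S)"
      by (intro has_derivative_inner_left has_derivative_compose[OF du linear_imp_has_derivative[OF linear_Delta]])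
    then show "((\<lambda>s. (\<chi> x. Delta (u s x)) \<bullet> i) has_derivative (\<lambda>k. (\<chi> x. Delta (du x k)) \<bullet> i)) (at s within S)"
      by (simp add: i inner_axis)
  qed
  show "((\<lambda>s. fut (VP g u f \<beta> s P)) has_derivative (\<lambda>k. fut (res P (umean P (\<lambda>x. du x k))))) (at s within S)"
    by (rule has_derivative_compose[OF VP_has_derivative[OF du] linear_imp_has_derivative[OF linear_fut]])
qed

end

section \<open>The UFXP criterion\<close>

definition Zlin :: "('m::finite \<Rightarrow> 'x::finite \<Rightarrow> 'd::finite \<Rightarrow> real) \<Rightarrow> real^'d^'x \<Rightarrow> real^'m" where
  "Zlin Z y = (\<chi> i. \<Sum>x\<in>UNIV. \<Sum>d\<in>UNIV. Z i x d * y $ x $ d)"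

lemma linear_Zlin: "linear (Zlin Z)"
  by (rule linearI) (auto simp: Zlin_def vec_eq_iff distrib_left sum.distrib sum_distrib_left mult_ac)

lemma matrix_vector_mult_matrix:
  "linear f \<Longrightarrow> matrix f *v x = f x" for f :: "real^'n::finite \<Rightarrow> real^'m::finite"
  by (simp add: matrix_works linear_matrix_vector_mul_eq)

lemma normal_equations:
  fixes D :: "real^'t::finite^'m::finite"
  assumes "\<And>k. D *v k = 0 \<Longrightarrow> k = 0"
  shows "transpose D ** D ** matrix_inv (transpose D ** D) = mat 1"
    "(y - D *v (matrix_inv (transpose D ** D) *v (transpose D *v y))) \<bullet> (D *v k) = 0"
proof -
  have "k = 0" if "(transpose D ** D) *v k = 0" for k
  proof -
    have "(D *v k) \<bullet> (D *v k) = k \<bullet> ((transpose D ** D) *v k)"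
      by (metis dot_lmul_matrix inner_commute matrix_vector_mul_assoc transpose_matrix_vector)
    then have "D *v k = 0" using that by simp
    then show ?thesis by (rule assms)
  qed
  then have "invertible (transpose D ** D)"
    by (simp add: invertible_left_inverse matrix_left_invertible_ker)
  from someI_ex[OF this[unfolded invertible_def]]
  show *: "transpose D ** D ** matrix_inv (transpose D ** D) = mat 1"
    unfolding matrix_inv_def by auto
  have "transpose D *v (D *v (matrix_inv (transpose D ** D) *v (transpose D *v y))) = transpose D *v y"
    by (metis * matrix_vector_mul_assoc matrix_vector_mul_lid)
  then have "transpose D *v (y - D *v (matrix_inv (transpose D ** D) *v (transpose D *v y))) = 0"
    by (simp add: matrix_vector_mult_diff_distrib)
  then show "(y - D *v (matrix_inv (transpose D ** D) *v (transpose D *v y))) \<bullet> (D *v k) = 0"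
    by (metis dot_lmul_matrix inner_zero_left transpose_matrix_vector)
qed

locale ufxp = choice_model g g' f \<beta> u
  for g :: "real^('d::finite option) \<Rightarrow> real" and g' :: "real^('d option) \<Rightarrow> real^('d option)"
    and f :: "'d option \<Rightarrow> 'x::finite \<Rightarrow> 'x \<Rightarrow> real" and \<beta> :: real
    and u :: "real^'t::finite \<Rightarrow> 'x \<Rightarrow> real^('d option)" +
  fixes \<Theta> :: "(real^'t) set" and \<theta> :: "real^'t"
  assumes compact: "compact \<Theta>" and interior: "\<theta> \<in> interior \<Theta>"
    and smooth: "\<And>x. \<exists>du. (\<forall>\<theta>'\<in>\<Theta>. ((\<lambda>s. u s x) has_derivative du \<theta>') (at \<theta>' within \<Theta>))
                          \<and> continuous_on \<Theta> (\<lambda>\<theta>'. matrix (du \<theta>'))"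
begin

abbreviation "R \<equiv> Pstar g u f \<beta> \<theta>"

text \<open>The policy is frozen at the truth: this is the Jacobian of the rank condition, and
  \<open>Dmat\<close> turns out to be its projection.\<close>

definition J :: "real^'t \<Rightarrow> real^'d^'x" where
  "J = frechet_derivative (\<lambda>s. Y s R) (at \<theta>)"

lemma theta_in: "\<theta> \<in> \<Theta>"
  using interior interior_subset by blast

lemma u_differentiable: "s \<in> \<Theta> \<Longrightarrow> \<exists>du. \<forall>x. ((\<lambda>s. u s x) has_derivative du x) (at s within \<Theta>)"
proof -
  assume s: "s \<in> \<Theta>"
  have "\<exists>du. ((\<lambda>s. u s x) has_derivative du) (at s within \<Theta>)" for x
    using smooth[of x] s by blast
  then show ?thesis by (intro choice allI)
qed

lemma u_derivative:
  obtains du where "\<And>x. ((\<lambda>s. u s x) has_derivative du x) (at \<theta>)"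
  using u_differentiable[OF theta_in] at_within_interior[OF interior] by auto

lemma continuous_u: "continuous_on \<Theta> (\<lambda>s. u s x)"
  unfolding continuous_on_eq_continuous_within
proof
  fix s assume "s \<in> \<Theta>"
  then obtain du where "\<And>x. ((\<lambda>s. u s x) has_derivative du x) (at s within \<Theta>)"
    using u_differentiable by blast
  then show "continuous (at s within \<Theta>) (\<lambda>s. u s x)"
    by (rule has_derivative_continuous)
qed

lemma Y_differentiable: "(\<lambda>s. Y s P) differentiable_on \<Theta>"
  unfolding differentiable_on_def
proof
  fix s assume "s \<in> \<Theta>"
  then obtain du where "\<And>x. ((\<lambda>s. u s x) has_derivative du x) (at s within \<Theta>)"
    using u_differentiable by blast
  from Y_has_derivative[OF this] show "(\<lambda>s. Y s P) differentiable at s within \<Theta>"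
    by (rule differentiableI)
qed

lemma Y_has_derivative_J: "((\<lambda>s. Y s R) has_derivative J) (at \<theta>)"
proof -
  obtain du where "\<And>x. ((\<lambda>s. u s x) has_derivative du x) (at \<theta>)" using u_derivative by blast
  from Y_has_derivative[OF this] have "(\<lambda>s. Y s R) differentiable at \<theta>"
    by (rule differentiableI)
  then show ?thesis unfolding J_def by (simp add: frechet_derivative_works)
qed

text \<open>\<Theta> is not assumed convex, so the mean value theorem is avoided and increments are
  taken from \<theta> only: the derivative handles a ball of radius \<open>d\<close>, and outside it
  the bound M on the compact \<Theta> is at most (M / d) |s - \<theta>|.\<close>

lemma u_lipschitz: "\<exists>L>0. \<forall>s\<in>\<Theta>. (\<Sum>x\<in>UNIV. norm (u s x - u \<theta> x)) \<le> L * norm (s - \<theta>)"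
proof -
  obtain du where du: "\<And>x. ((\<lambda>s. u s x) has_derivative du x) (at \<theta>)" using u_derivative by blast
  have "\<exists>L\<ge>0. \<forall>s\<in>\<Theta>. norm (u s x - u \<theta> x) \<le> L * norm (s - \<theta>)" for x
  proof -
    obtain d where d: "0 < d" "\<And>s. norm (s - \<theta>) < d \<Longrightarrow> norm (u s x - u \<theta> x - du x (s - \<theta>)) \<le> 1 * norm (s - \<theta>)"
      using has_derivative_bound[OF du[of x], of 1] by auto
    obtain B where B: "0 < B" "\<And>k. norm (du x k) \<le> B * norm k"
      using linear_bounded_pos[OF has_derivative_linear[OF du[of x]]] by (metis mult.commute)
    have "bounded ((\<lambda>s. u s x - u \<theta> x) ` \<Theta>)"
      using compact by (intro compact_imp_bounded compact_continuous_image continuous_intros continuous_u)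
    then obtain M where M: "0 < M" "\<And>s. s \<in> \<Theta> \<Longrightarrow> norm (u s x - u \<theta> x) \<le> M"
      by (auto simp: bounded_pos)
    show ?thesis
    proof (intro exI[of _ "1 + B + M / d"] conjI ballI)
      show "0 \<le> 1 + B + M / d" using B M d by simp
      fix s assume s: "s \<in> \<Theta>"
      show "norm (u s x - u \<theta> x) \<le> (1 + B + M / d) * norm (s - \<theta>)"
      proof (cases "norm (s - \<theta>) < d")
        case True
        have "norm (u s x - u \<theta> x) \<le> norm (u s x - u \<theta> x - du x (s - \<theta>)) + norm (du x (s - \<theta>))"
          by (metis diff_add_cancel norm_triangle_ineq)
        also have "\<dots> \<le> 1 * norm (s - \<theta>) + B * norm (s - \<theta>)"
          by (intro add_mono d(2) True B(2))
        also have "\<dots> \<le> 1 * norm (s - \<theta>) + B * norm (s - \<theta>) + M / d * norm (s - \<theta>)"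
          using M d by simp
        finally show ?thesis by (simp add: distrib_right)
      next
        case False
        have "norm (u s x - u \<theta> x) \<le> M / d * d" using M(2)[OF s] d by simp
        also have "\<dots> \<le> M / d * norm (s - \<theta>)" using False M d by (intro mult_left_mono) auto
        also have "\<dots> \<le> (1 + B + M / d) * norm (s - \<theta>)" using B by (intro mult_right_mono) auto
        finally show ?thesis .
      qed
    qed
  qed
  then obtain L where L: "\<And>x. 0 \<le> L x" "\<And>x s. s \<in> \<Theta> \<Longrightarrow> norm (u s x - u \<theta> x) \<le> L x * norm (s - \<theta>)"
    by metis
  show ?thesis
  proof (intro exI[of _ "1 + (\<Sum>x\<in>UNIV. L x)"] conjI ballI)
    show "0 < 1 + (\<Sum>x\<in>UNIV. L x)" using L(1) by (simp add: add_pos_nonneg sum_nonneg)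
    fix s assume "s \<in> \<Theta>"
    then have "(\<Sum>x\<in>UNIV. norm (u s x - u \<theta> x)) \<le> (\<Sum>x\<in>UNIV. L x * norm (s - \<theta>))"
      by (intro sum_mono L(2))
    then have "(\<Sum>x\<in>UNIV. norm (u s x - u \<theta> x)) \<le> (\<Sum>x\<in>UNIV. L x) * norm (s - \<theta>)"
      by (simp add: sum_distrib_right[symmetric])
    then show "(\<Sum>x\<in>UNIV. norm (u s x - u \<theta> x)) \<le> (1 + (\<Sum>x\<in>UNIV. L x)) * norm (s - \<theta>)"
      unfolding distrib_right using norm_ge_zero[of "s - \<theta>"] by linarith
  qed
qed

text \<open>Identifies the matrix written with derivatives of \<open>u\<close> and of the value with
  the projected Jacobian. At the interior point \<theta> derivatives are unique, so each
  \<open>frechet_derivative\<close> can be replaced by its expression in \<open>du\<close>.\<close>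

lemma Dmat_J: "Dmat g u f \<beta> Z \<theta> *v k = Zlin Z (J k)"
proof -
  obtain du where du: "\<And>x. ((\<lambda>s. u s x) has_derivative du x) (at \<theta>)" using u_derivative by blast
  have 1: "frechet_derivative (\<lambda>s. u s x) (at \<theta>) = du x" for x
    using frechet_derivative_at[OF du] by simp
  have 2: "frechet_derivative (\<lambda>s. VP g u f \<beta> s R) (at \<theta>) = (\<lambda>k. res R (umean R (\<lambda>x. du x k)))"
    using frechet_derivative_at[OF VP_has_derivative[where S=UNIV, OF du]] by simp
  have 3: "J = (\<lambda>k. (\<chi> x. Delta (du x k)) + fut (res R (umean R (\<lambda>x. du x k))))"
    unfolding J_def using frechet_derivative_at[OF Y_has_derivative[where S=UNIV, OF du]] by simp
  have "Dmat g u f \<beta> Z \<theta> = matrix (\<lambda>k. Zlin Z (J k))"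
  proof -
    have "\<beta> * (\<Sum>x'\<in>UNIV. Delta (\<chi> a. f a x x') $ d * v $ x') = fut v $ x $ d" for x d v
      by (simp add: fut_def Delta_def left_diff_distrib right_diff_distrib sum_subtractf sum_distrib_left)
    then show ?thesis
      by (simp add: Dmat_def matrix_def Zlin_def 1 2 3 vec_eq_iff)
  qed
  moreover have "linear (\<lambda>k. Zlin Z (J k))"
    using linear_compose[OF has_derivative_linear[OF Y_has_derivative_J] linear_Zlin] by (simp add: comp_def)
  ultimately show ?thesis by (simp add: matrix_vector_mult_matrix)
qed

text \<open>Within a simplex of empty interior the derivative is a choice, arbitrary in the normal
  direction. Existence suffices for the chosen one to be valid, and the expansions evaluate it only
  at differences P x - R x.\<close>

lemma Gamma_has_derivative: "(rho_inv g has_derivative (\<lambda>h. Gamma g (R x) *v h)) (at (R x) within prob_simplex)"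
proof -
  have "rho_inv g differentiable (at (R x) within prob_simplex)"
    unfolding differentiable_def Pstar_eq using rho_inv_has_derivative by blast
  then have *: "(rho_inv g has_derivative frechet_derivative (rho_inv g) (at (R x) within prob_simplex)) (at (R x) within prob_simplex)"
    by (simp add: frechet_derivative_works)
  then show ?thesis
    unfolding Gamma_def matrix_vector_mult_matrix[OF has_derivative_linear[OF *]] .
qed

lemma Y_R: "Y \<theta> R $ x = rho_inv g (R x)"
  by (simp add: Y_def VP_Pstar Pstar_eq CD_nth)

lemma residual_expansion:
  assumes \<epsilon>: "0 < \<epsilon>"
  shows "\<exists>\<delta>>0. \<forall>P. policy P \<longrightarrow> pdist P R < \<delta> \<longrightarrow>
    norm ((\<chi> x. rho_inv g (P x)) - Y \<theta> P - (\<chi> x. Gamma g (R x) *v (P x - R x))) \<le> \<epsilon> * pdist P R"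
proof -
  obtain \<delta>1 where \<delta>1: "0 < \<delta>1" "\<And>P. policy P \<Longrightarrow> pdist P R < \<delta>1 \<Longrightarrow> norm (Y \<theta> P - Y \<theta> R) \<le> \<epsilon> / 2 * pdist P R"
    using envelope_bound[of "\<epsilon> / 2" \<theta>] \<epsilon> by auto
  have "\<exists>d>0. \<forall>p\<in>prob_simplex. norm (p - R x) < d \<longrightarrow>
      norm (rho_inv g p - rho_inv g (R x) - Gamma g (R x) *v (p - R x)) \<le> \<epsilon> / 2 * norm (p - R x)" for x
    using has_derivative_bound[OF Gamma_has_derivative[of x], of "\<epsilon> / 2"] \<epsilon> by auto
  then obtain d where d: "\<And>x. 0 < d x" "\<And>x p. p \<in> prob_simplex \<Longrightarrow> norm (p - R x) < d x \<Longrightarrow>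
      norm (rho_inv g p - rho_inv g (R x) - Gamma g (R x) *v (p - R x)) \<le> \<epsilon> / 2 * norm (p - R x)"
    by metis
  define \<delta> where "\<delta> = min \<delta>1 (Min (range d))"
  have \<delta>: "0 < \<delta>" "\<delta> \<le> \<delta>1" "\<And>x. \<delta> \<le> d x"
    using d(1) \<delta>1(1) by (auto simp: \<delta>_def min.coboundedI2)
  show ?thesis
  proof (intro exI[of _ \<delta>] conjI \<delta>(1) allI impI)
    fix P assume P: "policy P" "pdist P R < \<delta>"
    define E where "E = (\<chi> x. rho_inv g (P x) - rho_inv g (R x) - Gamma g (R x) *v (P x - R x))"
    have "norm E \<le> (\<Sum>x\<in>UNIV. norm (E $ x))" by (rule norm_vec_le_sum)
    also have "\<dots> \<le> (\<Sum>x\<in>UNIV. \<epsilon> / 2 * norm (P x - R x))"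
    proof (rule sum_mono)
      fix x
      have "norm (P x - R x) < d x" using pdist_ge[of P x R] P(2) \<delta>(3)[of x] by linarith
      then show "norm (E $ x) \<le> \<epsilon> / 2 * norm (P x - R x)"
        using d(2)[of "P x" x] P(1) by (simp add: E_def)
    qed
    also have "\<dots> = \<epsilon> / 2 * pdist P R" by (simp add: pdist_def sum_distrib_left)
    finally have E: "norm E \<le> \<epsilon> / 2 * pdist P R" .
    have "(\<chi> x. rho_inv g (P x)) - Y \<theta> P - (\<chi> x. Gamma g (R x) *v (P x - R x)) = E - (Y \<theta> P - Y \<theta> R)"
      by (simp add: vec_eq_iff E_def Y_R)
    then have "norm ((\<chi> x. rho_inv g (P x)) - Y \<theta> P - (\<chi> x. Gamma g (R x) *v (P x - R x))) \<le> norm E + norm (Y \<theta> P - Y \<theta> R)"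
      by (simp only: norm_triangle_ineq4)
    then show "norm ((\<chi> x. rho_inv g (P x)) - Y \<theta> P - (\<chi> x. Gamma g (R x) *v (P x - R x))) \<le> \<epsilon> * pdist P R"
      using E \<delta>1(2)[OF P(1)] P(2) \<delta>(2) by fastforce
  qed
qed

text \<open>First-order response of the estimator to an error \<open>h\<close> in the choice
  probabilities, by least squares on the linearised criterion.\<close>

definition influence :: "('m::finite \<Rightarrow> 'x \<Rightarrow> 'd \<Rightarrow> real) \<Rightarrow> ('x \<Rightarrow> real^('d option)) \<Rightarrow> real^'t" where
  "influence Z h = (let D = Dmat g u f \<beta> Z \<theta> in
     matrix_inv (transpose D ** D) *v (transpose D *v Zlin Z (\<chi> x. Gamma g (R x) *v h x)))"

lemma Qcrit_norm: "Qcrit g u f \<beta> Z P s = (norm (Zlin Z ((\<chi> x. rho_inv g (P x)) - Y s P)))\<^sup>2"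
  by (simp add: Qcrit_def Zlin_def Y_def norm_vec_def L2_set_def sum_nonneg)

text \<open>An instance of \<open>minimizer_expansion\<close> with \<open>y\<close> the projected
  residual at \<theta>, \<psi> the projected gap at the true policy, and a perturbation proportional
  to |P - R|. Half of \<epsilon> pays for the minimiser, half for replacing \<open>y\<close> by its
  linearisation.\<close>

lemma estimator_expansion:
  fixes Z :: "'m::finite \<Rightarrow> 'x \<Rightarrow> 'd \<Rightarrow> real"
  assumes ident: "\<And>s. s \<in> \<Theta> \<Longrightarrow> Zlin Z (Y s R - Y \<theta> R) = 0 \<Longrightarrow> s = \<theta>"
    and rank: "\<And>k. Zlin Z (J k) = 0 \<Longrightarrow> k = 0" and \<epsilon>: "0 < \<epsilon>"
  shows "\<exists>\<delta>>0. \<forall>P s. policy P \<longrightarrow> pdist P R < \<delta> \<longrightarrow> s \<in> \<Theta> \<longrightarrow>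
     (\<forall>s'\<in>\<Theta>. Qcrit g u f \<beta> Z P s \<le> Qcrit g u f \<beta> Z P s') \<longrightarrow>
     norm (s - \<theta> - influence Z (\<lambda>x. P x - R x)) \<le> \<epsilon> * pdist P R"
proof -
  define D where "D = Dmat g u f \<beta> Z \<theta>"
  have DJ: "D *v k = Zlin Z (J k)" for k unfolding D_def by (rule Dmat_J)
  have Dinj: "D *v k = 0 \<Longrightarrow> k = 0" for k using rank by (simp add: DJ)
  define Dp where "Dp y = matrix_inv (transpose D ** D) *v (transpose D *v y)" for y
  have linDp: "linear Dp"
    unfolding Dp_def matrix_vector_mul_assoc by (rule matrix_vector_mul_linear)
  have orth: "(y - D *v Dp y) \<bullet> (D *v k) = 0" for y k
    unfolding Dp_def by (rule normal_equations(2)[OF Dinj])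
  define \<psi> where "\<psi> s = Zlin Z (Y s R - Y \<theta> R)" for s
  have \<psi>_deriv: "(\<psi> has_derivative (\<lambda>k. D *v k)) (at \<theta>)"
    unfolding \<psi>_def DJ
    using has_derivative_compose[OF has_derivative_diff[OF Y_has_derivative_J has_derivative_const] linear_imp_has_derivative[OF linear_Zlin]]
    by simp
  have \<psi>_cont: "continuous_on \<Theta> \<psi>"
    unfolding \<psi>_def
    by (intro linear_continuous_on_compose[OF _ linear_Zlin] continuous_on_diff continuous_on_const differentiable_imp_continuous_on Y_differentiable)
  have \<psi>0: "\<psi> \<theta> = 0" by (simp add: \<psi>_def linear_0[OF linear_Zlin])
  obtain Bz where Bz: "0 < Bz" "\<And>y. norm (Zlin Z y) \<le> Bz * norm y"
    using linear_bounded_pos[OF linear_Zlin] by (metis mult.commute)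
  obtain M where M: "0 < M" "\<And>y. norm (Dp y) \<le> M * norm y"
    using linear_bounded_pos[OF linDp] by (metis mult.commute)
  obtain L where L: "0 < L" "\<And>s. s \<in> \<Theta> \<Longrightarrow> (\<Sum>x\<in>UNIV. norm (u s x - u \<theta> x)) \<le> L * norm (s - \<theta>)"
    using u_lipschitz by blast
  obtain C where C: "0 < C" "\<And>P s s'. policy P \<Longrightarrow> norm (Y s P - Y s' P - (Y s R - Y s' R)) \<le> C * pdist P R * (\<Sum>x\<in>UNIV. norm (u s x - u s' x))"
    using policy_perturbation_bound[OF policy_Pstar] by blast
  have "\<exists>G>0. \<forall>P. norm (\<chi> x. Gamma g (R x) *v (P x - R x)) \<le> G * pdist P R"
  proof -
    obtain B where B: "\<And>x. 0 < B x" "\<And>x h. norm (Gamma g (R x) *v h) \<le> B x * norm h"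
    proof -
      have "\<forall>x. \<exists>B>0. \<forall>h. norm (Gamma g (R x) *v h) \<le> B * norm h"
        using linear_bounded_pos[OF matrix_vector_mul_linear] by blast
      then show ?thesis using that by metis
    qed
    show ?thesis
    proof (intro exI[of _ "\<Sum>x\<in>UNIV. B x"] conjI allI)
      show "0 < (\<Sum>x\<in>UNIV. B x)" using B(1) by (intro sum_pos) auto
      fix P :: "'x \<Rightarrow> real^('d option)"
      have "norm (\<chi> x. Gamma g (R x) *v (P x - R x)) \<le> (\<Sum>x\<in>UNIV. norm (Gamma g (R x) *v (P x - R x)))"
        using norm_vec_le_sum[of "\<chi> x. Gamma g (R x) *v (P x - R x)"] by simp
      also have "\<dots> \<le> (\<Sum>x\<in>UNIV. B x * pdist P R)"
        using B(1) by (intro sum_mono order_trans[OF B(2)] mult_left_mono pdist_ge less_imp_le)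
      finally show "norm (\<chi> x. Gamma g (R x) *v (P x - R x)) \<le> (\<Sum>x\<in>UNIV. B x) * pdist P R"
        by (simp add: sum_distrib_right)
    qed
  qed
  then obtain G where G: "0 < G" "\<And>P. norm (\<chi> x. Gamma g (R x) *v (P x - R x)) \<le> G * pdist P R" by blast
  \<comment> \<open>Chosen against |y| \<le> Bz (G + 1) |P - R|, where G comes from the linear term
    and 1 from \<epsilon>2 \<le> 1.\<close>
  define \<epsilon>1 where "\<epsilon>1 = \<epsilon> / (2 * (Bz * (G + 1)))"
  have \<epsilon>1: "0 < \<epsilon>1" using \<epsilon> Bz G by (simp add: \<epsilon>1_def)
  define \<epsilon>2 where "\<epsilon>2 = min 1 (\<epsilon> / (2 * (M * Bz)))"
  have \<epsilon>2: "0 < \<epsilon>2" "\<epsilon>2 \<le> 1" using \<epsilon> Bz M by (auto simp: \<epsilon>2_def)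
  have \<epsilon>2': "M * Bz * \<epsilon>2 \<le> \<epsilon> / 2"
  proof -
    have "M * Bz * \<epsilon>2 \<le> M * Bz * (\<epsilon> / (2 * (M * Bz)))"
      using M Bz by (intro mult_left_mono) (auto simp: \<epsilon>2_def)
    also have "\<dots> = \<epsilon> / 2" using M(1) Bz(1) by simp
    finally show ?thesis .
  qed
  obtain \<delta>1 where \<delta>1: "0 < \<delta>1" "\<And>y \<tau> F s. norm y < \<delta>1 \<Longrightarrow> \<tau> < \<delta>1 \<Longrightarrow> (\<forall>s\<in>\<Theta>. norm (F s - (y - \<psi> s)) \<le> \<tau> * norm (s - \<theta>)) \<Longrightarrow>
     s \<in> \<Theta> \<Longrightarrow> (\<forall>s'\<in>\<Theta>. norm (F s) \<le> norm (F s')) \<Longrightarrow> norm (s - \<theta> - Dp y) \<le> \<epsilon>1 * norm y"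
    using minimizer_expansion[OF compact interior \<psi>_cont \<psi>0 _ \<psi>_deriv Dinj linDp orth \<epsilon>1] ident unfolding \<psi>_def by blast
  obtain \<delta>2 where \<delta>2: "0 < \<delta>2" "\<And>P. policy P \<Longrightarrow> pdist P R < \<delta>2 \<Longrightarrow>
    norm ((\<chi> x. rho_inv g (P x)) - Y \<theta> P - (\<chi> x. Gamma g (R x) *v (P x - R x))) \<le> \<epsilon>2 * pdist P R"
    using residual_expansion[OF \<epsilon>2(1)] by blast
  define \<delta> where "\<delta> = min \<delta>2 (min (\<delta>1 / (Bz * (G + 1))) (\<delta>1 / (Bz * C * L)))"
  show ?thesis
  proof (intro exI[of _ \<delta>] conjI allI impI)
    show "0 < \<delta>" using \<delta>1(1) \<delta>2(1) Bz(1) G(1) C(1) L(1) by (simp add: \<delta>_def)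
    fix P s assume P: "policy P" and Pd: "pdist P R < \<delta>" and s: "s \<in> \<Theta>"
      and min: "\<forall>s'\<in>\<Theta>. Qcrit g u f \<beta> Z P s \<le> Qcrit g u f \<beta> Z P s'"
    have Pd': "pdist P R < \<delta>2" "pdist P R * (Bz * (G + 1)) < \<delta>1" "pdist P R * (Bz * C * L) < \<delta>1"
      using Pd Bz(1) G(1) C(1) L(1) by (auto simp: \<delta>_def pos_less_divide_eq)
    define F where "F s = Zlin Z ((\<chi> x. rho_inv g (P x)) - Y s P)" for s
    define y where "y = F \<theta>"
    have yG: "norm (y - Zlin Z (\<chi> x. Gamma g (R x) *v (P x - R x))) \<le> Bz * (\<epsilon>2 * pdist P R)"
      unfolding y_def F_def linear_diff[OF linear_Zlin, symmetric]
      using Bz(1) \<delta>2(2)[OF P Pd'(1)] by (intro order_trans[OF Bz(2)] mult_left_mono) auto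
    have ny: "norm y \<le> Bz * (G + 1) * pdist P R"
    proof -
      have "norm y \<le> norm (Zlin Z (\<chi> x. Gamma g (R x) *v (P x - R x))) + norm (y - Zlin Z (\<chi> x. Gamma g (R x) *v (P x - R x)))"
        by (rule norm_triangle_sub)
      also have "\<dots> \<le> Bz * (G * pdist P R) + Bz * (1 * pdist P R)"
      proof (rule add_mono)
        show "norm (Zlin Z (\<chi> x. Gamma g (R x) *v (P x - R x))) \<le> Bz * (G * pdist P R)"
          using Bz(1) by (intro order_trans[OF Bz(2)] mult_left_mono G(2)) auto
        have "\<epsilon>2 * pdist P R \<le> 1 * pdist P R"
          using \<epsilon>2 pdist_nonneg by (intro mult_right_mono) auto
        then have "Bz * (\<epsilon>2 * pdist P R) \<le> Bz * (1 * pdist P R)"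
          using Bz(1) by (intro mult_left_mono) auto
        then show "norm (y - Zlin Z (\<chi> x. Gamma g (R x) *v (P x - R x))) \<le> Bz * (1 * pdist P R)"
          using yG by linarith
      qed
      finally show ?thesis by (simp add: algebra_simps)
    qed
    have 1: "norm (s - \<theta> - Dp y) \<le> \<epsilon>1 * norm y"
    proof (rule \<delta>1(2)[of y "pdist P R * (Bz * C * L)" F s])
      show "norm y < \<delta>1" using ny Pd'(2) by (simp add: mult_ac)
      show "pdist P R * (Bz * C * L) < \<delta>1" by (rule Pd')
      show "s \<in> \<Theta>" by (rule s)
      show "\<forall>s'\<in>\<Theta>. norm (F s) \<le> norm (F s')"
        using min unfolding Qcrit_norm F_def by (simp add: power2_le_iff_abs_le)
      show "\<forall>s\<in>\<Theta>. norm (F s - (y - \<psi> s)) \<le> pdist P R * (Bz * C * L) * norm (s - \<theta>)"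
      proof
        fix s assume s: "s \<in> \<Theta>"
        \<comment> \<open>A double difference in parameter and policy, which
          \<open>policy_perturbation_bound\<close> controls; this is why the perturbation vanishes
          at s = \<theta>.\<close>
        have "F s - (y - \<psi> s) = Zlin Z (- (Y s P - Y \<theta> P - (Y s R - Y \<theta> R)))"
          unfolding F_def y_def \<psi>_def linear_diff[OF linear_Zlin, symmetric] by (simp add: algebra_simps)
        then have "norm (F s - (y - \<psi> s)) \<le> Bz * norm (Y s P - Y \<theta> P - (Y s R - Y \<theta> R))"
          by (metis Bz(2) norm_minus_cancel)
        also have "\<dots> \<le> Bz * (C * pdist P R * (L * norm (s - \<theta>)))"
          using Bz(1) C(1) pdist_nonneg L(2)[OF s]
          by (intro mult_left_mono order_trans[OF C(2)[OF P]]) auto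
        finally show "norm (F s - (y - \<psi> s)) \<le> pdist P R * (Bz * C * L) * norm (s - \<theta>)"
          by (simp add: mult_ac)
      qed
    qed
    have infl: "influence Z (\<lambda>x. P x - R x) = Dp (Zlin Z (\<chi> x. Gamma g (R x) *v (P x - R x)))"
      by (simp add: influence_def Dp_def D_def Let_def)
    have "norm (Dp y - influence Z (\<lambda>x. P x - R x)) \<le> M * (Bz * (\<epsilon>2 * pdist P R))"
      unfolding infl linear_diff[OF linDp, symmetric]
      using M(1) yG by (intro order_trans[OF M(2)] mult_left_mono) auto
    also have "\<dots> = (M * Bz * \<epsilon>2) * pdist P R" by simp
    also have "\<dots> \<le> \<epsilon> / 2 * pdist P R"
      using \<epsilon>2' pdist_nonneg by (rule mult_right_mono)
    finally have 2: "norm (Dp y - influence Z (\<lambda>x. P x - R x)) \<le> \<epsilon> / 2 * pdist P R" .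
    have "\<epsilon>1 * norm y \<le> \<epsilon>1 * (Bz * (G + 1) * pdist P R)"
      using \<epsilon>1 by (intro mult_left_mono ny) auto
    also have "\<dots> = (\<epsilon>1 * (Bz * (G + 1))) * pdist P R" by simp
    also have "\<epsilon>1 * (Bz * (G + 1)) = \<epsilon> / 2"
    proof -
      have "\<epsilon> / (2 * q) * q = \<epsilon> / 2" if "0 < q" for q :: real using that by simp
      moreover have "0 < Bz * (G + 1)" using Bz(1) G(1) by simp
      ultimately show ?thesis unfolding \<epsilon>1_def by blast
    qed
    finally have 3: "norm (s - \<theta> - Dp y) \<le> \<epsilon> / 2 * pdist P R" using 1 by linarith
    have "norm (s - \<theta> - influence Z (\<lambda>x. P x - R x)) \<le> norm (s - \<theta> - Dp y) + norm (Dp y - influence Z (\<lambda>x. P x - R x))"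
    proof -
      have eq: "s - \<theta> - influence Z (\<lambda>x. P x - R x) = (s - \<theta> - Dp y) + (Dp y - influence Z (\<lambda>x. P x - R x))" by simp
      show ?thesis by (subst eq) (rule norm_triangle_ineq)
    qed
    then show "norm (s - \<theta> - influence Z (\<lambda>x. P x - R x)) \<le> \<epsilon> * pdist P R"
      using 2 3 by simp
  qed
qed

end

section \<open>The asymptotic covariance matrix\<close>

lemma SigmaP_bilinear:
  assumes "(\<Sum>a\<in>UNIV. p $ a) = 1"
  shows "c \<bullet> (SigmaP p *v c') = (\<Sum>a\<in>UNIV. p $ a * (c \<bullet> (axis a 1 - p)) * (c' \<bullet> (axis a 1 - p)))"
proof -
  have "(SigmaP p *v c') $ i = p $ i * (c' $ i - c' \<bullet> p)" for i
  proof -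
    have "(SigmaP p *v c') $ i = (\<Sum>j\<in>UNIV. (if i = j then p $ i * c' $ i else 0) - p $ i * (c' $ j * p $ j))"
      unfolding SigmaP_def matrix_vector_mult_def by (auto intro!: sum.cong simp: algebra_simps)
    also have "\<dots> = p $ i * c' $ i - p $ i * (c' \<bullet> p)"
      by (simp add: sum_subtractf inner_vec_def sum_distrib_left)
    finally show ?thesis by (simp add: algebra_simps)
  qed
  then have 1: "c \<bullet> (SigmaP p *v c') = (\<Sum>a\<in>UNIV. p $ a * c $ a * (c' $ a - c' \<bullet> p))"
    by (simp add: inner_vec_def[of c "SigmaP p *v c'"] mult_ac)
  have "(\<Sum>a\<in>UNIV. p $ a * (c \<bullet> p) * (c' $ a - c' \<bullet> p)) = (c \<bullet> p) * ((\<Sum>a\<in>UNIV. p $ a * c' $ a) - (\<Sum>a\<in>UNIV. p $ a) * (c' \<bullet> p))"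
    by (simp add: sum_distrib_left sum_distrib_right sum_subtractf[symmetric] algebra_simps)
  also have "\<dots> = 0" using assms by (simp add: inner_vec_def mult.commute)
  finally have 2: "(\<Sum>a\<in>UNIV. p $ a * (c \<bullet> p) * (c' $ a - c' \<bullet> p)) = 0" .
  have "(\<Sum>a\<in>UNIV. p $ a * (c \<bullet> (axis a 1 - p)) * (c' \<bullet> (axis a 1 - p)))
      = (\<Sum>a\<in>UNIV. p $ a * c $ a * (c' $ a - c' \<bullet> p)) - (\<Sum>a\<in>UNIV. p $ a * (c \<bullet> p) * (c' $ a - c' \<bullet> p))"
    by (simp add: inner_diff_right inner_axis sum_subtractf[symmetric] algebra_simps)
  then show ?thesis using 1 2 by simp
qed

lemma sum_UNIV_prod: "(\<Sum>p\<in>UNIV. h p) = (\<Sum>x\<in>UNIV. \<Sum>y\<in>UNIV. h (x, y))"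
  by (simp add: sum.cartesian_product)

lemma dot_matrix_transpose: "a \<bullet> (A *v b) = (transpose A *v a) \<bullet> b"
  for A :: "real^'n::finite^'m::finite"
  by (metis dot_lmul_matrix transpose_matrix_vector)

lemma transpose_inverse_symmetric:
  fixes A B :: "real^'n::finite^'n"
  assumes "A ** B = mat 1" "transpose A = A"
  shows "transpose B = B"
proof -
  have "transpose B ** A = mat 1"
    using assms by (metis matrix_transpose_mul transpose_mat)
  then show ?thesis using assms(1)
    by (metis matrix_mul_assoc matrix_mul_lid matrix_mul_rid)
qed

context ufxp
begin

definition infl_at :: "('m::finite \<Rightarrow> 'x \<Rightarrow> 'd \<Rightarrow> real) \<Rightarrow> 'x \<Rightarrow> real^('d option) \<Rightarrow> real^'t" where
  "infl_at Z x v = (let D = Dmat g u f \<beta> Z \<theta> in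
     matrix_inv (transpose D ** D) *v (transpose D *v (transpose (zmat Z x) *v (Gamma g (R x) *v v))))"

lemma linear_infl_at: "linear (infl_at Z x)"
  unfolding infl_at_def Let_def matrix_vector_mul_assoc by (rule matrix_vector_mul_linear)

lemma influence_sum: "influence Z h = (\<Sum>x\<in>UNIV. infl_at Z x (h x))"
proof -
  have "Zlin Z (\<chi> x. Gamma g (R x) *v h x) = (\<Sum>x\<in>UNIV. transpose (zmat Z x) *v (Gamma g (R x) *v h x))"
  proof -
    have "transpose (zmat Z x) *v v = (\<chi> i. \<Sum>d\<in>UNIV. Z i x d * v $ d)" for x v
      by (simp add: vec_eq_iff matrix_vector_mult_def transpose_def zmat_def)
    then show ?thesis
      by (simp only: vec_eq_iff Zlin_def vec_lambda_beta sum_component) simp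
  qed
  then show ?thesis
    unfolding influence_def infl_at_def Let_def
    by (simp add: linear_sum[OF matrix_vector_mul_linear])
qed

text \<open>Contribution to the linearised estimator of one observation of action \<open>a\<close>
  in state \<open>x\<close>.\<close>

definition noise :: "('m::finite \<Rightarrow> 'x \<Rightarrow> 'd \<Rightarrow> real) \<Rightarrow> 'x \<Rightarrow> 'd option \<Rightarrow> real^'t" where
  "noise Z x a = infl_at Z x (axis a 1 - R x)"

lemma R_sum: "(\<Sum>a\<in>UNIV. R x $ a) = 1"
  using policy_Pstar[of \<theta>] by (auto simp: prob_simplex_def)

lemma R_nonneg: "0 \<le> R x $ a"
  using policy_Pstar[of \<theta>] by (auto simp: prob_simplex_def)

lemma R_pos: "0 < R x $ a"
  by (simp add: Pstar_eq rho_pos)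

lemma centered_mean: "(\<Sum>a\<in>UNIV. R x $ a *\<^sub>R (axis a 1 - R x)) = 0"
proof -
  have "(\<Sum>a\<in>UNIV. R x $ a *\<^sub>R axis a 1) = R x"
    by (simp add: vec_eq_iff axis_def if_distrib[of "\<lambda>c. _ * c"] cong: if_cong)
  moreover have "(\<Sum>a\<in>UNIV. R x $ a *\<^sub>R R x) = R x"
    by (simp add: scaleR_sum_left[symmetric] R_sum)
  ultimately show ?thesis by (simp add: scaleR_diff_right sum_subtractf)
qed

lemma noise_mean: "(\<Sum>a\<in>UNIV. R x $ a *\<^sub>R noise Z x a) = 0"
proof -
  have "(\<Sum>a\<in>UNIV. R x $ a *\<^sub>R noise Z x a) = infl_at Z x (\<Sum>a\<in>UNIV. R x $ a *\<^sub>R (axis a 1 - R x))"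
    by (simp add: noise_def linear_sum[OF linear_infl_at] linear_scale[OF linear_infl_at])
  then show ?thesis by (simp only: centered_mean linear_0[OF linear_infl_at])
qed

text \<open>Symmetry of the inverse of D'D lets each factor of the sandwich move across the inner
  product, and \<open>SigmaP_bilinear\<close> writes the multinomial covariance as an average over
  actions. The sandwich formula thus becomes a second moment of \<open>noise\<close>.\<close>

lemma Sigma_bilinear:
  fixes Z :: "'m::finite \<Rightarrow> 'x \<Rightarrow> 'd \<Rightarrow> real"
  assumes rank: "\<And>k. Zlin Z (J k) = 0 \<Longrightarrow> k = 0"
  shows "b \<bullet> (Sigma_UFXP g u f \<beta> Z \<eta> \<theta> *v b') =
     (\<Sum>x\<in>UNIV. (1 / \<eta> x) * (\<Sum>a\<in>UNIV. R x $ a * (b \<bullet> noise Z x a) * (b' \<bullet> noise Z x a)))"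
proof -
  define D where "D = Dmat g u f \<beta> Z \<theta>"
  define B where "B = matrix_inv (transpose D ** D)"
  have Dinj: "D *v k = 0 \<Longrightarrow> k = 0" for k using rank by (simp add: D_def Dmat_J)
  have "transpose D ** D ** B = mat 1" unfolding B_def by (rule normal_equations(1)[OF Dinj])
  then have B: "transpose B = B"
    by (rule transpose_inverse_symmetric) (simp add: matrix_transpose_mul)
  define Mx where "Mx x = transpose (zmat Z x) ** Gamma g (R x) ** SigmaP (R x) ** transpose (Gamma g (R x)) ** zmat Z x" for x
  define q where "q x b = transpose (Gamma g (R x)) *v (zmat Z x *v (D *v (B *v b)))" for x b
  have q: "b \<bullet> infl_at Z x v = q x b \<bullet> v" for b x v
    unfolding infl_at_def Let_def D_def[symmetric] B_def[symmetric] q_def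
    by (simp only: dot_matrix_transpose transpose_transpose B)
  have "b \<bullet> (Sigma_UFXP g u f \<beta> Z \<eta> \<theta> *v b') = (D *v (B *v b)) \<bullet> ((\<Sum>x\<in>UNIV. (1 / \<eta> x) *\<^sub>R Mx x) *v (D *v (B *v b')))"
    unfolding Sigma_UFXP_def Let_def D_def[symmetric] B_def[symmetric] Mx_def[symmetric]
    by (simp only: matrix_vector_mul_assoc[symmetric] dot_matrix_transpose[of _ B] dot_matrix_transpose[of _ "transpose D"] transpose_transpose B)
  also have "(\<Sum>x\<in>UNIV. (1 / \<eta> x) *\<^sub>R Mx x) *v w = (\<Sum>x\<in>UNIV. (1 / \<eta> x) *\<^sub>R (Mx x *v w))" for w
  proof -
    have "(\<Sum>x\<in>I. (1 / \<eta> x) *\<^sub>R Mx x) *v w = (\<Sum>x\<in>I. (1 / \<eta> x) *\<^sub>R (Mx x *v w))" if "finite I" for I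
      using that by (induction I rule: finite_induct)
        (auto simp: matrix_vector_mult_add_rdistrib scaleR_matrix_vector_assoc)
    then show ?thesis by simp
  qed
  also have "(D *v (B *v b)) \<bullet> (\<Sum>x\<in>UNIV. (1 / \<eta> x) *\<^sub>R (Mx x *v (D *v (B *v b')))) = (\<Sum>x\<in>UNIV. (1 / \<eta> x) * (q x b \<bullet> (SigmaP (R x) *v q x b')))"
  proof -
    have "y \<bullet> (Mx x *v w) = (transpose (Gamma g (R x)) *v (zmat Z x *v y)) \<bullet> (SigmaP (R x) *v (transpose (Gamma g (R x)) *v (zmat Z x *v w)))" for x y w
      unfolding Mx_def
      by (simp only: matrix_vector_mul_assoc[symmetric] dot_matrix_transpose[of _ "transpose (zmat Z x)"] dot_matrix_transpose[of _ "Gamma g (R x)"] transpose_transpose)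
    then show ?thesis by (simp add: inner_sum_right q_def)
  qed
  also have "\<dots> = (\<Sum>x\<in>UNIV. (1 / \<eta> x) * (\<Sum>a\<in>UNIV. R x $ a * (b \<bullet> noise Z x a) * (b' \<bullet> noise Z x a)))"
    by (simp only: SigmaP_bilinear[OF R_sum] noise_def q)
  finally show ?thesis .
qed

text \<open>One column of \<open>K\<close> per state-action pair, weighted by sqrt(R / \<eta>),
  displays the matrix as a Gram matrix; \<open>gram_square_root\<close> then supplies the square
  factor that \<open>mvn\<close> presupposes.\<close>

lemma Sigma_square_root:
  fixes Z :: "'m::finite \<Rightarrow> 'x \<Rightarrow> 'd \<Rightarrow> real"
  assumes rank: "\<And>k. Zlin Z (J k) = 0 \<Longrightarrow> k = 0" and \<eta>: "\<And>x. 0 < \<eta> x"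
  shows "\<exists>L :: real^'t^'t. L ** transpose L = Sigma_UFXP g u f \<beta> Z \<eta> \<theta>"
proof -
  define K :: "real^('x \<times> 'd option)^'t" where
    "K = (\<chi> i p. sqrt (R (fst p) $ snd p / \<eta> (fst p)) * noise Z (fst p) (snd p) $ i)"
  have "K ** transpose K = Sigma_UFXP g u f \<beta> Z \<eta> \<theta>"
  proof (simp only: vec_eq_iff, intro allI)
    fix i j
    have sq: "(sqrt c * a) * (sqrt c * b) = c * a * b" if "0 \<le> c" for a b c :: real
    proof -
      have "(sqrt c * a) * (sqrt c * b) = (sqrt c * sqrt c) * a * b" by (simp add: mult_ac del: real_sqrt_mult_self)
      then show ?thesis using that by simp
    qed
    have c: "0 \<le> R x $ a / \<eta> x" for x a
      using R_nonneg \<eta>[of x] by (intro divide_nonneg_pos) auto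
    have "(K ** transpose K) $ i $ j = (\<Sum>p\<in>UNIV. R (fst p) $ snd p / \<eta> (fst p) * noise Z (fst p) (snd p) $ i * noise Z (fst p) (snd p) $ j)"
      unfolding matrix_matrix_mult_def transpose_def K_def by (simp only: vec_lambda_beta sq[OF c])
    also have "\<dots> = (\<Sum>x\<in>UNIV. (1 / \<eta> x) * (\<Sum>a\<in>UNIV. R x $ a * (axis i 1 \<bullet> noise Z x a) * (axis j 1 \<bullet> noise Z x a)))"
      unfolding sum_UNIV_prod
      by (simp add: inner_axis' sum_distrib_left mult_ac)
    also have "\<dots> = axis i 1 \<bullet> (Sigma_UFXP g u f \<beta> Z \<eta> \<theta> *v axis j 1)"
      by (rule Sigma_bilinear[OF rank, symmetric])
    also have "\<dots> = Sigma_UFXP g u f \<beta> Z \<eta> \<theta> $ i $ j"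
      by (simp add: inner_axis' matrix_vector_mult_basis column_def)
    finally show "(K ** transpose K) $ i $ j = Sigma_UFXP g u f \<beta> Z \<eta> \<theta> $ i $ j" .
  qed
  then show ?thesis using gram_square_root[of K] by metis
qed

end

section \<open>Asymptotics of the estimator\<close>

lemma Phat_minus:
  fixes \<omega> :: "'x::finite \<times> nat \<Rightarrow> 'a::finite option"
  assumes "0 < Ns x"
  shows "Phat Ns \<omega> x - p = (1 / real (Ns x)) *\<^sub>R (\<Sum>j<Ns x. axis (\<omega> (x, j)) 1 - p)"
proof -
  have "real (card {j. j < Ns x \<and> \<omega> (x, j) = a}) = (\<Sum>j<Ns x. if \<omega> (x, j) = a then 1 else 0)" for a
  proof -
    have "{j. j < Ns x \<and> \<omega> (x, j) = a} = {j \<in> {..<Ns x}. \<omega> (x, j) = a}" by auto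
    then show ?thesis by (simp add: sum.If_cases Int_def)
  qed
  then have "Phat Ns \<omega> x = (1 / real (Ns x)) *\<^sub>R (\<Sum>j<Ns x. axis (\<omega> (x, j)) 1)"
    by (simp add: Phat_def vec_eq_iff axis_def eq_commute)
  moreover have "(1 / real (Ns x)) *\<^sub>R (\<Sum>j<Ns x. p) = p"
    using assms by (simp add: sum_constant_scaleR del: sum_constant)
  ultimately show ?thesis by (simp only: sum_subtractf scaleR_diff_right)
qed

lemma Phat_simplex:
  fixes \<omega> :: "'x::finite \<times> nat \<Rightarrow> 'a::finite option"
  assumes "0 < Ns x"
  shows "Phat Ns \<omega> x \<in> prob_simplex"
proof -
  have "(\<Sum>a\<in>UNIV. card {j. j < Ns x \<and> \<omega> (x, j) = a}) = card (\<Union>a. {j. j < Ns x \<and> \<omega> (x, j) = a})"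
    by (subst card_UN_disjoint) auto
  also have "(\<Union>a. {j. j < Ns x \<and> \<omega> (x, j) = a}) = {..<Ns x}" by auto
  finally have "(\<Sum>a\<in>UNIV. real (card {j. j < Ns x \<and> \<omega> (x, j) = a})) = real (Ns x)"
    by (simp flip: of_nat_sum)
  then show ?thesis
    using assms by (simp add: prob_simplex_def Phat_def sum_divide_distrib[symmetric])
qed

context ufxp
begin

context
  fixes Ns :: "nat \<Rightarrow> 'x \<Rightarrow> nat" and \<eta> :: "'x \<Rightarrow> real" and Z :: "'m::finite \<Rightarrow> 'x \<Rightarrow> 'd \<Rightarrow> real"
    and est :: "nat \<Rightarrow> ('x \<times> nat \<Rightarrow> 'd option) \<Rightarrow> real^'t"
  assumes N_infty: "filterlim (\<lambda>k. \<Sum>x\<in>UNIV. Ns k x) at_top sequentially"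
    and eta_lim: "\<And>x. (\<lambda>k. real (Ns k x) / real (\<Sum>y\<in>UNIV. Ns k y)) \<longlonglongrightarrow> \<eta> x"
    and eta_pos: "\<And>x. 0 < \<eta> x"
    and ident: "\<forall>s\<in>\<Theta>. Zlin Z (Y s R - Y \<theta> R) = 0 \<longrightarrow> s = \<theta>"
    and rank: "\<forall>k. Zlin Z (J k) = 0 \<longrightarrow> k = 0"
    and est: "\<forall>k \<omega>. (\<forall>x a. 0 < Phat (Ns k) \<omega> x $ a) \<longrightarrow> est k \<omega> \<in> \<Theta> \<and>
      (\<forall>s\<in>\<Theta>. Qcrit g u f \<beta> Z (Phat (Ns k) \<omega>) (est k \<omega>) \<le> Qcrit g u f \<beta> Z (Phat (Ns k) \<omega>) s)"
begin

definition "rootN k = sqrt (real (\<Sum>x\<in>UNIV. Ns k x))"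
definition "Pr k = measure_pmf.prob (sample_pmf (Ns k) R)"
definition "W k = scaled_sum Ns (noise Z) k"
definition "err k \<omega> = pdist (Phat (Ns k) \<omega>) R"

lemma rootN_nonneg: "\<bar>rootN k\<bar> = rootN k"
  by (simp add: rootN_def sum_nonneg)

lemma rootN_at_top: "filterlim rootN at_top sequentially"
  unfolding rootN_def
  by (rule filterlim_compose[OF sqrt_at_top filterlim_compose[OF filterlim_real_sequentially N_infty]])

lemma eventually_all_positive: "\<forall>\<^sub>F k in sequentially. \<forall>x. 0 < Ns k x"
proof (rule eventually_all_finite)
  fix x
  have "filterlim (\<lambda>k. Ns k x) at_top sequentially"
    by (rule Ns_at_top[OF policy_Pstar[rule_format] N_infty eta_lim eta_pos])
  then show "\<forall>\<^sub>F k in sequentially. 0 < Ns k x"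
    unfolding filterlim_at_top by (auto elim!: allE[of _ 1] eventually_mono)
qed

lemma Pr_mono: "A \<subseteq> B \<Longrightarrow> Pr k A \<le> Pr k B"
  unfolding Pr_def by (rule measure_pmf.finite_measure_mono) auto

lemma Pr_union: "A \<subseteq> B \<union> C \<Longrightarrow> Pr k A \<le> Pr k B + Pr k C"
  unfolding Pr_def
  by (rule order_trans[OF measure_pmf.finite_measure_mono measure_Un_le]) auto

lemma tight_W: "0 < e \<Longrightarrow> \<exists>b>0. \<forall>\<^sub>F k in sequentially. Pr k {\<omega>. b < norm (W k \<omega>)} \<le> e"
  unfolding Pr_def W_def
  by (rule tight_scaled_sum[OF policy_Pstar[rule_format] N_infty eta_lim eta_pos noise_mean])

lemma influence_W:
  assumes "\<forall>x. 0 < Ns k x"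
  shows "rootN k *\<^sub>R influence Z (\<lambda>x. Phat (Ns k) \<omega> x - R x) = W k \<omega>"
proof -
  have "influence Z (\<lambda>x. Phat (Ns k) \<omega> x - R x) = (\<Sum>x\<in>UNIV. (1 / real (Ns k x)) *\<^sub>R (\<Sum>j<Ns k x. noise Z x (\<omega> (x, j))))"
    unfolding influence_sum using assms
    by (simp add: Phat_minus linear_scale[OF linear_infl_at] linear_sum[OF linear_infl_at] noise_def)
  then show ?thesis
    unfolding W_def scaled_sum_def rootN_def by (simp add: scaleR_sum_right)
qed

text \<open>\<open>\<zeta>\<close> places the centred choice in the block of its state, so the
  components of one scaled sum are the frequency errors of all states, and a single tightness
  statement covers them.\<close>

lemma tight_err:
  assumes e: "0 < e"
  shows "\<exists>b>0. \<forall>\<^sub>F k in sequentially. Pr k {\<omega>. b < rootN k * err k \<omega>} \<le> e"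
proof -
  define \<zeta> :: "'x \<Rightarrow> 'd option \<Rightarrow> real^('d option)^'x" where
    "\<zeta> x a = axis x (axis a 1 - R x)" for x a
  have mean: "(\<Sum>a\<in>UNIV. R x $ a *\<^sub>R \<zeta> x a) = 0" for x
  proof -
    have "(\<Sum>a\<in>UNIV. R x $ a *\<^sub>R \<zeta> x a) = axis x (\<Sum>a\<in>UNIV. R x $ a *\<^sub>R (axis a 1 - R x))"
    proof -
      have "(\<Sum>a\<in>UNIV. c a *\<^sub>R axis x (v a)) = axis x (\<Sum>a\<in>UNIV. c a *\<^sub>R v a)" for c and v :: "'d option \<Rightarrow> real^('d option)"
        by (auto simp: vec_eq_iff axis_def)
      then show ?thesis by (simp only: \<zeta>_def)
    qed
    then show ?thesis by (simp only: centered_mean axis_eq_0_iff)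
  qed
  obtain b where b: "0 < b" "\<forall>\<^sub>F k in sequentially. Pr k {\<omega>. b < norm (scaled_sum Ns \<zeta> k \<omega>)} \<le> e"
    using tight_scaled_sum[where P=R and \<xi>=\<zeta>, OF policy_Pstar[rule_format] N_infty eta_lim eta_pos mean e]
    unfolding Pr_def[symmetric] by (elim exE conjE) (rule that)
  have bound: "rootN k * err k \<omega> \<le> real CARD('x) * norm (scaled_sum Ns \<zeta> k \<omega>)" if pos: "\<forall>x. 0 < Ns k x" for k \<omega>
  proof -
    have comp: "scaled_sum Ns \<zeta> k \<omega> $ x = rootN k *\<^sub>R (Phat (Ns k) \<omega> x - R x)" for x
    proof -
      have "scaled_sum Ns \<zeta> k \<omega> $ x = (\<Sum>y\<in>UNIV. if y = x then (rootN k / real (Ns k x)) *\<^sub>R (\<Sum>j<Ns k x. axis (\<omega> (x, j)) 1 - R x) else 0)"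
        unfolding scaled_sum_def rootN_def[symmetric] sum_component
      proof (rule sum.cong[OF refl])
        fix y
        show "((rootN k / real (Ns k y)) *\<^sub>R (\<Sum>j<Ns k y. \<zeta> y (\<omega> (y, j)))) $ x
           = (if y = x then (rootN k / real (Ns k x)) *\<^sub>R (\<Sum>j<Ns k x. axis (\<omega> (x, j)) 1 - R x) else 0)"
          unfolding \<zeta>_def vector_scaleR_component sum_component by (cases "y = x") (simp_all add: axis_def[of y])
      qed
      then show ?thesis using pos by (simp add: Phat_minus)
    qed
    have "rootN k * err k \<omega> = (\<Sum>x\<in>UNIV. norm (scaled_sum Ns \<zeta> k \<omega> $ x))"
      by (simp add: comp err_def pdist_def sum_distrib_left rootN_nonneg)
    also have "\<dots> \<le> (\<Sum>x\<in>(UNIV :: 'x set). norm (scaled_sum Ns \<zeta> k \<omega>))"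
      by (intro sum_mono Finite_Cartesian_Product.norm_nth_le)
    finally show ?thesis by simp
  qed
  define b' where "b' = real CARD('x) * b"
  have b': "0 < b'" using b by (simp add: b'_def)
  from b(2) eventually_all_positive
  have "\<forall>\<^sub>F k in sequentially. Pr k {\<omega>. b' < rootN k * err k \<omega>} \<le> e"
  proof eventually_elim
    case (elim k)
    have "{\<omega>. b' < rootN k * err k \<omega>} \<subseteq> {\<omega>. b < norm (scaled_sum Ns \<zeta> k \<omega>)}"
    proof clarify
      fix \<omega> assume "b' < rootN k * err k \<omega>"
      then have "real CARD('x) * b < real CARD('x) * norm (scaled_sum Ns \<zeta> k \<omega>)"
        using bound[OF elim(2), of \<omega>] unfolding b'_def by linarith
      then show "b < norm (scaled_sum Ns \<zeta> k \<omega>)" by (simp add: mult_less_cancel_left)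
    qed
    then show ?case using Pr_mono elim(1) order_trans by blast
  qed
  then show ?thesis using b' by blast
qed

text \<open>On samples with rootN |Phat - R| \<le> b, an event of probability near 1, the
  deterministic expansion applies with tolerance e / b; its error becomes at most e after
  scaling.\<close>

lemma expansion_close:
  assumes e: "0 < e"
  shows "(\<lambda>k. Pr k {\<omega>. e < dist (rootN k *\<^sub>R (est k \<omega> - \<theta>)) (W k \<omega>)}) \<longlonglongrightarrow> 0"
proof (rule LIMSEQ_I)
  fix r :: real assume r: "0 < r"
  obtain b where b: "0 < b" "\<forall>\<^sub>F k in sequentially. Pr k {\<omega>. b < rootN k * err k \<omega>} \<le> r / 2"
    using tight_err[of "r / 2"] r by auto
  obtain \<delta> where \<delta>: "0 < \<delta>" "\<And>P s. policy P \<Longrightarrow> pdist P R < \<delta> \<Longrightarrow> s \<in> \<Theta> \<Longrightarrow>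
     (\<forall>s'\<in>\<Theta>. Qcrit g u f \<beta> Z P s \<le> Qcrit g u f \<beta> Z P s') \<Longrightarrow>
     norm (s - \<theta> - influence Z (\<lambda>x. P x - R x)) \<le> (e / b) * pdist P R"
    using estimator_expansion[of Z "e / b"] ident rank e b(1) divide_pos_pos[OF e b(1)] by blast
  \<comment> \<open>At most the smallest true choice probability, so that an error below it leaves
    all frequencies positive and \<open>est\<close> is known to be a minimiser.\<close>
  define \<delta>' where "\<delta>' = min \<delta> (Min (range (\<lambda>(x, a). R x $ a)))"
  have \<delta>': "0 < \<delta>'" "\<delta>' \<le> \<delta>" "\<And>x a. \<delta>' \<le> R x $ a"
  proof -
    show "0 < \<delta>'" using \<delta>(1) R_pos by (auto simp: \<delta>'_def)
    show "\<delta>' \<le> \<delta>" by (simp add: \<delta>'_def)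
    show "\<delta>' \<le> R x $ a" for x a
    proof -
      have "Min (range (\<lambda>(x, a). R x $ a)) \<le> R x $ a"
        by (rule Min_le) (auto intro!: image_eqI[of _ _ "(x, a)"])
      then show ?thesis by (simp add: \<delta>'_def min.coboundedI2)
    qed
  qed
  have "\<forall>\<^sub>F k in sequentially. b / \<delta>' < rootN k"
    using rootN_at_top by (simp add: filterlim_at_top_dense)
  with b(2) eventually_all_positive
  have "\<forall>\<^sub>F k in sequentially. norm (Pr k {\<omega>. e < dist (rootN k *\<^sub>R (est k \<omega> - \<theta>)) (W k \<omega>)} - 0) < r"
  proof eventually_elim
    case (elim k)
    have "{\<omega>. e < dist (rootN k *\<^sub>R (est k \<omega> - \<theta>)) (W k \<omega>)} \<subseteq> {\<omega>. b < rootN k * err k \<omega>}"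
    proof (rule ccontr)
      assume "\<not> ?thesis"
      then obtain \<omega> where \<omega>: "e < dist (rootN k *\<^sub>R (est k \<omega> - \<theta>)) (W k \<omega>)" "rootN k * err k \<omega> \<le> b"
        unfolding subset_iff mem_Collect_eq not_less[symmetric] by blast
      have rN: "0 < rootN k" using elim(3) b(1) \<delta>'(1) by (meson divide_pos_pos less_trans)
      have "b < rootN k * \<delta>'" using elim(3) \<delta>'(1) by (simp add: pos_divide_less_eq)
      then have "rootN k * err k \<omega> < rootN k * \<delta>'" using \<omega>(2) by linarith
      then have small: "err k \<omega> < \<delta>'" using rN by simp
      have pos: "0 < Phat (Ns k) \<omega> x $ a" for x a
      proof -
        have "\<bar>(Phat (Ns k) \<omega> x - R x) $ a\<bar> \<le> err k \<omega>"
          unfolding err_def by (rule order_trans[OF component_le_norm_cart pdist_ge])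
        then show ?thesis using small \<delta>'(3)[of x a] by simp
      qed
      have pol: "policy (Phat (Ns k) \<omega>)" using elim(2) Phat_simplex by blast
      have "norm (est k \<omega> - \<theta> - influence Z (\<lambda>x. Phat (Ns k) \<omega> x - R x)) \<le> (e / b) * pdist (Phat (Ns k) \<omega>) R"
        using est[rule_format, of k \<omega>] pos small \<delta>'(2) by (intro \<delta>(2) pol) (auto simp: err_def)
      then have "rootN k * norm (est k \<omega> - \<theta> - influence Z (\<lambda>x. Phat (Ns k) \<omega> x - R x)) \<le> rootN k * ((e / b) * err k \<omega>)"
        using rN unfolding err_def by (intro mult_left_mono) auto
      moreover have "dist (rootN k *\<^sub>R (est k \<omega> - \<theta>)) (W k \<omega>) = rootN k * norm (est k \<omega> - \<theta> - influence Z (\<lambda>x. Phat (Ns k) \<omega> x - R x))"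
        unfolding influence_W[OF elim(2), symmetric] dist_norm scaleR_diff_right[symmetric] using rN by simp
      moreover have "rootN k * ((e / b) * err k \<omega>) \<le> (e / b) * b"
        using \<omega>(2) e b(1) by (simp add: field_simps)
      ultimately show False using \<omega>(1) b(1) by simp
    qed
    then have "Pr k {\<omega>. e < dist (rootN k *\<^sub>R (est k \<omega> - \<theta>)) (W k \<omega>)} \<le> r / 2"
      using Pr_mono elim(1) order_trans by blast
    moreover have "0 \<le> Pr k {\<omega>. e < dist (rootN k *\<^sub>R (est k \<omega> - \<theta>)) (W k \<omega>)}"
      by (simp add: Pr_def)
    ultimately show ?case using r by simp
  qed
  then show "\<exists>no. \<forall>k\<ge>no. norm (Pr k {\<omega>. e < dist (rootN k *\<^sub>R (est k \<omega> - \<theta>)) (W k \<omega>)} - 0) < r"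
    by (simp add: eventually_sequentially)
qed

text \<open>Read off from the expansion: rootN |est - \<theta>| \<le> b + 1 with high probability
  while rootN \<rightarrow> \<infinity>.\<close>

lemma estimator_consistent:
  assumes e: "0 < e"
  shows "(\<lambda>k. measure_pmf.prob (sample_pmf (Ns k) R) {\<omega>. e < dist (est k \<omega>) \<theta>}) \<longlonglongrightarrow> 0"
  unfolding Pr_def[symmetric]
proof (rule LIMSEQ_I)
  fix r :: real assume r: "0 < r"
  obtain b where b: "0 < b" "\<forall>\<^sub>F k in sequentially. Pr k {\<omega>. b < norm (W k \<omega>)} \<le> r / 3"
    using tight_W[of "r / 3"] r by auto
  have "\<forall>\<^sub>F k in sequentially. Pr k {\<omega>. 1 < dist (rootN k *\<^sub>R (est k \<omega> - \<theta>)) (W k \<omega>)} < r / 3"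
    by (rule order_tendstoD[OF expansion_close[of 1]]) (use r in auto)
  moreover have "\<forall>\<^sub>F k in sequentially. (b + 1) / e < rootN k"
    using rootN_at_top by (simp add: filterlim_at_top_dense)
  ultimately have "\<forall>\<^sub>F k in sequentially. norm (Pr k {\<omega>. e < dist (est k \<omega>) \<theta>} - 0) < r"
    using b(2)
  proof eventually_elim
    case (elim k)
    have be: "b + 1 < rootN k * e" using elim(2) e by (simp add: pos_divide_less_eq)
    have rN: "0 < rootN k" using elim(2) b(1) e by (meson add_pos_pos divide_pos_pos less_trans zero_less_one)
    have "{\<omega>. e < dist (est k \<omega>) \<theta>} \<subseteq> {\<omega>. b < norm (W k \<omega>)} \<union> {\<omega>. 1 < dist (rootN k *\<^sub>R (est k \<omega> - \<theta>)) (W k \<omega>)}"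
    proof (rule ccontr)
      assume "\<not> ?thesis"
      then obtain \<omega> where \<omega>: "e < dist (est k \<omega>) \<theta>" "norm (W k \<omega>) \<le> b" "dist (rootN k *\<^sub>R (est k \<omega> - \<theta>)) (W k \<omega>) \<le> 1"
        unfolding subset_iff Un_iff mem_Collect_eq not_less[symmetric] by blast
      have "rootN k * dist (est k \<omega>) \<theta> = norm (rootN k *\<^sub>R (est k \<omega> - \<theta>))" using rN by (simp add: dist_norm)
      also have "\<dots> \<le> norm (W k \<omega>) + dist (rootN k *\<^sub>R (est k \<omega> - \<theta>)) (W k \<omega>)"
        unfolding dist_norm by (rule norm_triangle_sub)
      also have "\<dots> \<le> b + 1" using \<omega> by linarith
      finally have "rootN k * dist (est k \<omega>) \<theta> < rootN k * e" using be by linarith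
      then show False using \<omega>(1) rN by simp
    qed
    from Pr_union[OF this, of k] have "Pr k {\<omega>. e < dist (est k \<omega>) \<theta>} < r"
      using elim r by linarith
    then show ?case by (simp add: Pr_def)
  qed
  then show "\<exists>no. \<forall>k\<ge>no. norm (Pr k {\<omega>. e < dist (est k \<omega>) \<theta>} - 0) < r"
    by (simp add: eventually_sequentially)
qed

text \<open>Normality is established for the exactly linear statistic \<open>W\<close> through its
  characteristic function and carried over to the estimator by Slutsky.\<close>

lemma estimator_asymptotically_normal:
  "conv_distr (\<lambda>k. distr (measure_pmf (sample_pmf (Ns k) R)) borel
      (\<lambda>\<omega>. sqrt (real (\<Sum>x\<in>UNIV. Ns k x)) *\<^sub>R (est k \<omega> - \<theta>)))
     (mvn (Sigma_UFXP g u f \<beta> Z \<eta> \<theta>))"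
  unfolding rootN_def[symmetric]
proof (rule conv_distr_slutsky[where W=W])
  let ?S = "Sigma_UFXP g u f \<beta> Z \<eta> \<theta>"
  have meas: "(\<lambda>y :: real^'t. cis (b \<bullet> y)) \<in> borel_measurable borel" for b
    by (intro borel_measurable_continuous_onI continuous_intros)
  show "conv_distr (\<lambda>k. distr (measure_pmf (sample_pmf (Ns k) R)) borel (W k)) (mvn ?S)"
  proof (rule conv_distr_char)
    show "prob_space (distr (measure_pmf (sample_pmf (Ns k) R)) borel (W k))" for k
      by (rule measure_pmf.prob_space_distr) simp
    show "prob_space (mvn ?S)" "sets (mvn ?S) = sets borel"
      by (rule prob_space_mvn, rule sets_mvn)
    fix b
    have "(\<Sum>x\<in>UNIV. (1 / \<eta> x) * (\<Sum>a\<in>UNIV. R x $ a * (b \<bullet> noise Z x a)\<^sup>2)) = b \<bullet> (?S *v b)"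
      using Sigma_bilinear[of Z b \<eta> b] rank by (simp add: power2_eq_square mult.assoc)
    moreover have "\<exists>L :: real^'t^'t. L ** transpose L = ?S"
      by (rule Sigma_square_root) (use rank eta_pos in auto)
    ultimately have "(\<lambda>k. \<integral>\<omega>. cis (b \<bullet> W k \<omega>) \<partial>measure_pmf (sample_pmf (Ns k) R)) \<longlonglongrightarrow> (\<integral>y. cis (b \<bullet> y) \<partial>mvn ?S)"
      using char_scaled_sum[where P=R and \<xi>="noise Z" and b=b, OF policy_Pstar[rule_format] N_infty eta_lim eta_pos noise_mean]
      by (simp add: char_mvn W_def)
    then show "(\<lambda>k. \<integral>y. cis (b \<bullet> y) \<partial>distr (measure_pmf (sample_pmf (Ns k) R)) borel (W k)) \<longlonglongrightarrow> (\<integral>y. cis (b \<bullet> y) \<partial>mvn ?S)"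
      by (simp add: integral_distr meas)
  next
    fix e :: real assume "0 < e"
    then obtain c where "\<forall>\<^sub>F k in sequentially. Pr k {\<omega>. c < norm (W k \<omega>)} \<le> e"
      using tight_W by blast
    then have "\<forall>\<^sub>F k in sequentially. measure (distr (measure_pmf (sample_pmf (Ns k) R)) borel (W k)) {y. c < norm y} \<le> e"
      by eventually_elim (simp add: measure_distr Pr_def vimage_def)
    then show "\<exists>c. \<forall>\<^sub>F k in sequentially. measure (distr (measure_pmf (sample_pmf (Ns k) R)) borel (W k)) {y. c < norm y} \<le> e"
      by blast
  qed simp
  show "\<exists>c. \<forall>\<^sub>F k in sequentially. measure_pmf.prob (sample_pmf (Ns k) R) {\<omega>. c < norm (W k \<omega>)} \<le> e" if "0 < e" for e
    using tight_W[OF that] unfolding Pr_def by blast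
  show "(\<lambda>k. measure_pmf.prob (sample_pmf (Ns k) R) {\<omega>. e < dist (rootN k *\<^sub>R (est k \<omega> - \<theta>)) (W k \<omega>)}) \<longlonglongrightarrow> 0" if "0 < e" for e
    using expansion_close[OF that] unfolding Pr_def .
qed

end

text \<open>If \<open>J\<close> annihilated some k \<noteq> 0, the hyperplane orthogonal to k would
  already produce the whole range, whose dimension would then be at most t - 1.\<close>

lemma J_injective:
  assumes "dim (range (frechet_derivative (\<lambda>s'. CD u f \<beta> s' (VP g u f \<beta> s' R)) (at \<theta> within \<Theta>))) = CARD('t)"
    and "J k = 0"
  shows "k = 0"
proof (rule ccontr)
  assume k: "k \<noteq> 0"
  have lin: "linear J" by (rule has_derivative_linear[OF Y_has_derivative_J])
  have "range J \<subseteq> J ` {x. k \<bullet> x = 0}"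
  proof clarify
    fix x
    define y where "y = x - ((k \<bullet> x) / (k \<bullet> k)) *\<^sub>R k"
    have "J y = J x" unfolding y_def linear_diff[OF lin] linear_scale[OF lin] assms(2) by simp
    moreover have "y \<in> {x. k \<bullet> x = 0}" using k by (simp add: y_def inner_diff_right)
    ultimately show "J x \<in> J ` {x. k \<bullet> x = 0}" by (rule image_eqI[OF sym])
  qed
  then have "dim (range J) \<le> dim (J ` {x. k \<bullet> x = 0})" by (rule dim_subset)
  also have "\<dots> \<le> dim {x. k \<bullet> x = 0}" by (rule dim_image_le[OF lin])
  also have "\<dots> = DIM(real^'t) - 1" by (rule dim_hyperplane[OF k])
  also have "\<dots> < CARD('t)" by (simp add: card_gt_0_iff)
  finally show False
    using assms(1) unfolding J_def Y_def at_within_interior[OF interior] by simp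
qed

text \<open>\<open>AE_projection_nonzero\<close> is used on two families with t parameters: the gaps
  at s \<noteq> \<theta>, nonzero by \<open>identification\<close> and injectivity, and the vectors
  J k for k \<noteq> 0. Matrices are flattened because that lemma speaks of vectors
  \<open>real^'k\<close>.\<close>

lemma random_projection:
  fixes \<mu> :: "real measure"
  assumes id: "inj_on (\<lambda>s. CD u f \<beta> s (VP g u f \<beta> s (Pstar g u f \<beta> s))) \<Theta>"
    and rank: "dim (range (frechet_derivative (\<lambda>s'. CD u f \<beta> s' (VP g u f \<beta> s' R)) (at \<theta> within \<Theta>))) = CARD('t)"
    and card: "CARD('m::finite) > CARD('t)"
    and \<mu>: "prob_space \<mu>" "sets \<mu> = sets borel" "absolutely_continuous lborel \<mu>"
  shows "AE Zf in PiM UNIV (\<lambda>_::'m \<times> 'x \<times> 'd. \<mu>).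
    (\<forall>s\<in>\<Theta>. Zlin (\<lambda>i x d. Zf (i :: 'm, x, d)) (Y s R - Y \<theta> R) = 0 \<longrightarrow> s = \<theta>) \<and>
    (\<forall>k. Zlin (\<lambda>i x d. Zf (i :: 'm, x, d)) (J k) = 0 \<longrightarrow> k = 0)"
proof -
  define flat :: "real^'d^'x \<Rightarrow> real^('x \<times> 'd)" where "flat y = (\<chi> p. y $ fst p $ snd p)" for y
  have flat0: "flat y = 0 \<longleftrightarrow> y = 0" for y by (auto simp: flat_def vec_eq_iff)
  have lin: "linear flat" by (rule linearI) (auto simp: flat_def vec_eq_iff)
  have flat_sum: "(\<Sum>p\<in>UNIV. Zf (i, p) * flat y $ p) = Zlin (\<lambda>i x d. Zf (i, x, d)) y $ i" for Zf and i :: 'm and y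
    by (simp add: sum_UNIV_prod flat_def Zlin_def)
  have 1: "AE Zf in PiM UNIV (\<lambda>_::'m \<times> 'x \<times> 'd. \<mu>). \<forall>s\<in>\<Theta> - {\<theta>}. \<exists>i. (\<Sum>p\<in>UNIV. Zf (i, p) * flat (Y s R - Y \<theta> R) $ p) \<noteq> 0"
  proof (rule AE_projection_nonzero[OF \<mu> card])
    have "(\<lambda>s. Y s R - Y \<theta> R) differentiable_on \<Theta> - {\<theta>}"
      by (intro differentiable_on_diff differentiable_on_const differentiable_on_subset[OF Y_differentiable]) auto
    from differentiable_on_compose[OF this linear_imp_differentiable_on[OF lin]]
    show "(\<lambda>s. flat (Y s R - Y \<theta> R)) differentiable_on \<Theta> - {\<theta>}" .
    show "flat (Y s R - Y \<theta> R) \<noteq> 0" if s: "s \<in> \<Theta> - {\<theta>}" for s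
    proof
      assume "flat (Y s R - Y \<theta> R) = 0"
      then have eq: "CD u f \<beta> s (VP g u f \<beta> s R) = CD u f \<beta> \<theta> (VP g u f \<beta> \<theta> R)"
        by (simp add: flat0 Y_def)
      have "Pstar g u f \<beta> s = R" by (rule identification[OF refl eq])
      then have "s = \<theta>" using inj_onD[OF id, of s \<theta>] eq s theta_in by simp
      then show False using s by simp
    qed
  qed
  have 2: "AE Zf in PiM UNIV (\<lambda>_::'m \<times> 'x \<times> 'd. \<mu>). \<forall>k\<in>UNIV - {0}. \<exists>i. (\<Sum>p\<in>UNIV. Zf (i, p) * flat (J k) $ p) \<noteq> 0"
  proof (rule AE_projection_nonzero[OF \<mu> card])
    show "(\<lambda>k. flat (J k)) differentiable_on UNIV - {0}"
      using linear_imp_differentiable_on[OF linear_compose[OF has_derivative_linear[OF Y_has_derivative_J] lin]] by (simp add: comp_def)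
    show "flat (J k) \<noteq> 0" if "k \<in> UNIV - {0}" for k
      using J_injective[OF rank, of k] that by (auto simp: flat0)
  qed
  from 1 2 show ?thesis
    unfolding flat_sum
  proof eventually_elim
    case (elim Zf)
    then show ?case by (metis DiffI UNIV_I singletonD zero_index)
  qed
qed

end

theorem theorem1:
  fixes g :: "real^('d::finite option) \<Rightarrow> real"
    and g' :: "real^('d option) \<Rightarrow> real^('d option)"
    and u :: "real^'t::finite \<Rightarrow> 'x::finite \<Rightarrow> real^('d option)"
    and f :: "'d option \<Rightarrow> 'x \<Rightarrow> 'x \<Rightarrow> real"
    and \<beta> :: real
    and \<Theta> :: "(real^'t) set"
    and \<theta> :: "real^'t"
    and Ns :: "nat \<Rightarrow> 'x \<Rightarrow> nat"
    and \<eta> :: "'x \<Rightarrow> real"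
    and \<mu> :: "real measure"
  assumes beta: "0 \<le> \<beta>" "\<beta> < 1"
    and trans_nonneg: "\<And>a x x'. 0 \<le> f a x x'"
    and trans_sum: "\<And>a x. (\<Sum>x'\<in>UNIV. f a x x') = 1"
    \<comment> \<open>(Compactness)\<close>
    and compact: "compact \<Theta>" and interior: "\<theta> \<in> interior \<Theta>"
    \<comment> \<open>(Smoothness) u continuously differentiable in theta on Theta\<close>
    and smooth: "\<And>x. \<exists>du. (\<forall>\<theta>'\<in>\<Theta>. ((\<lambda>s. u s x) has_derivative du \<theta>') (at \<theta>' within \<Theta>))
                          \<and> continuous_on \<Theta> (\<lambda>\<theta>'. matrix (du \<theta>'))"
    \<comment> \<open>(Error-distribution regularity)\<close>
    and g_pos: "\<And>e. 0 < g e"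
    and g_density: "integrable lborel g" "(\<integral>e. g e \<partial>lborel) = 1"
    and g_C1: "\<And>e. (g has_derivative (\<lambda>h. g' e \<bullet> h)) (at e)" "continuous_on UNIV g'"
    and g_moment: "integrable lborel (\<lambda>e. norm e * g e)"
    and g_grad: "integrable lborel (\<lambda>e. norm (g' e))"
    \<comment> \<open>(Identification)\<close>
    and ident: "inj_on (\<lambda>s. CD u f \<beta> s (VP g u f \<beta> s (Pstar g u f \<beta> s))) \<Theta>"
    \<comment> \<open>(Full rank)\<close>
    and full_rank: "\<And>s. s \<in> \<Theta> \<Longrightarrow>
        dim (range (frechet_derivative (\<lambda>s'. CD u f \<beta> s' (VP g u f \<beta> s' (Pstar g u f \<beta> s)))
                      (at s within \<Theta>))) = CARD('t)"
    \<comment> \<open>(Random projection)\<close>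
    and m_gt_t: "CARD('m::finite) > CARD('t)"
    and mu_prob: "prob_space \<mu>" and mu_sets: "sets \<mu> = sets borel"
    and mu_ac: "absolutely_continuous lborel \<mu>"
    \<comment> \<open>sample sizes: N(x) observations at state x, N = sum_x N(x) \<rightarrow> \<infinity>, N(x)/N \<rightarrow> eta(x) > 0\<close>
    and N_infty: "filterlim (\<lambda>k. \<Sum>x\<in>UNIV. Ns k x) at_top sequentially"
    and eta_lim: "\<And>x. (\<lambda>k. real (Ns k x) / real (\<Sum>y\<in>UNIV. Ns k y)) \<longlonglongrightarrow> \<eta> x"
    and eta_pos: "\<And>x. 0 < \<eta> x"
  shows "AE Zf in PiM UNIV (\<lambda>_::'m \<times> 'x \<times> 'd. \<mu>).
     (\<forall>est :: nat \<Rightarrow> ('x \<times> nat \<Rightarrow> 'd option) \<Rightarrow> real^'t.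
       (\<forall>k \<omega>. (\<forall>x a. 0 < Phat (Ns k) \<omega> x $ a) \<longrightarrow>
           est k \<omega> \<in> \<Theta> \<and>
           (\<forall>s\<in>\<Theta>. Qcrit g u f \<beta> (\<lambda>i x d. Zf (i, x, d)) (Phat (Ns k) \<omega>) (est k \<omega>)
                    \<le> Qcrit g u f \<beta> (\<lambda>i x d. Zf (i, x, d)) (Phat (Ns k) \<omega>) s))
       \<longrightarrow>
       (\<forall>\<epsilon>>0. (\<lambda>k. measure_pmf.prob (sample_pmf (Ns k) (Pstar g u f \<beta> \<theta>))
                       {\<omega>. \<epsilon> < dist (est k \<omega>) \<theta>}) \<longlonglongrightarrow> 0)
       \<and> conv_distr
           (\<lambda>k. distr (measure_pmf (sample_pmf (Ns k) (Pstar g u f \<beta> \<theta>))) borel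
                  (\<lambda>\<omega>. sqrt (real (\<Sum>x\<in>UNIV. Ns k x)) *\<^sub>R (est k \<omega> - \<theta>)))
           (mvn (Sigma_UFXP g u f \<beta> (\<lambda>i x d. Zf (i, x, d)) \<eta> \<theta>)))"
proof -
  interpret ufxp g g' f \<beta> u \<Theta> \<theta>
    by unfold_locales (fact g_pos g_density g_C1 g_moment g_grad beta trans_nonneg trans_sum compact interior smooth)+
  show ?thesis
    \<comment> \<open>The only exceptional set: it depends on \<theta> and the model, not on the
      sample or on \<open>est\<close>, so one event serves all selections of minimisers.\<close>
    using random_projection[where 'm='m, OF ident full_rank[OF theta_in] m_gt_t mu_prob mu_sets mu_ac]
  proof eventually_elim
    case (elim Zf)
    define Z :: "'m \<Rightarrow> 'x \<Rightarrow> 'd \<Rightarrow> real" where "Z = (\<lambda>i x d. Zf (i, x, d))"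
    have good: "\<forall>s\<in>\<Theta>. Zlin Z (Y s R - Y \<theta> R) = 0 \<longrightarrow> s = \<theta>" "\<forall>k. Zlin Z (J k) = 0 \<longrightarrow> k = 0"
      using elim unfolding Z_def by blast+
    show ?case
      unfolding Z_def[symmetric]
    proof (intro allI impI conjI)
      fix est :: "nat \<Rightarrow> ('x \<times> nat \<Rightarrow> 'd option) \<Rightarrow> real^'t"
      assume est: "\<forall>k \<omega>. (\<forall>x a. 0 < Phat (Ns k) \<omega> x $ a) \<longrightarrow> est k \<omega> \<in> \<Theta> \<and>
        (\<forall>s\<in>\<Theta>. Qcrit g u f \<beta> Z (Phat (Ns k) \<omega>) (est k \<omega>) \<le> Qcrit g u f \<beta> Z (Phat (Ns k) \<omega>) s)"
      note prems = N_infty eta_lim eta_pos good est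
      show "(\<lambda>k. measure_pmf.prob (sample_pmf (Ns k) R) {\<omega>. \<epsilon> < dist (est k \<omega>) \<theta>}) \<longlonglongrightarrow> 0" if "0 < \<epsilon>" for \<epsilon>
        by (rule estimator_consistent[OF prems that])
      show "conv_distr (\<lambda>k. distr (measure_pmf (sample_pmf (Ns k) R)) borel
          (\<lambda>\<omega>. sqrt (real (\<Sum>x\<in>UNIV. Ns k x)) *\<^sub>R (est k \<omega> - \<theta>))) (mvn (Sigma_UFXP g u f \<beta> Z \<eta> \<theta>))"
        by (rule estimator_asymptotically_normal[OF prems])
    qed
  qed
qed

end
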